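(* Let $h$ be a continuous function defined on an open set containing $[h_1,h_2]$. Under the standing assumptions on $A_n, Z_n, H$ given in the context, for every $z\in\mathbb{C}^+$, $$\frac{1}{n}\operatorname{tr}\left(h(A_n)\left(\hat{A}_n-z\right)^{-1}\right)\longrightarrow \int \frac{h(t)\,dH(t)}{t-z-\sigma^2 m_{\hat{\mu}}(z)}\qquad\text{almost surely as } n\to\infty,$$ where $m_{\hat\mu}$ is the Stieltjes transform of the free additive convolution $\hat\mu=H\boxplus\rho_{sc;\sigma^2}$ of $H$ with the centered semicircular distribution of variance $\sigma^2$.
   Context: Standing assumptions. For each $n$, $A_n\in\mathbb{R}^{n\times n}$ is a real symmetric matrix (deterministic or random), $\sigma>0$ is fixed, and $\hat{A}_n=A_n+\sigma n^{-1/2}Z_n$, with $n\to\infty$. (i) The empirical spectral distribution $\mu_n=n^{-1}\sum_{k=1}^n\delta_{\lambda_k}$ of the eigenvalues $\lambda_1\ge\dots\ge\lambda_n$ of $A_n$ converges weakly almost surely to a deterministic probability measure $H$. (ii) $H$ is supported on a compact interval of $\mathbb{R}$, and eventually (for all large $n$) all eigenvalues of $A_n$ lie in a compact interval $[h_1,h_2]\subset\mathbb{R}$. (iii) $Z_n$ is real symmetric and independent of $A_n$; it is the top-left $n\times n$ submatrix of an infinite symmetric matrix $(Z_{ij})_{i,j\ge1}$ whose entries on and above the diagonal are i.i.d. with mean $0$, variance $1$ and finite fourth moment. Notation. $h(A_n)$ is defined by functional calculus. The Stieltjes transform of a probability measure $\mu$ on $\mathbb{R}$ is $m_\mu(z)=\int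 (x-z)^{-1}\mu(dx)$, $z\in\mathbb{C}^+$. The measure $\hat\mu=H\boxplus\rho_{sc;\sigma^2}$ is the limiting spectral distribution of $\hat A_n$, and its Stieltjes transform satisfies $m_{\hat\mu}(z)=\int \frac{dH(t)}{t-z-\sigma^2m_{\hat\mu}(z)}$ for $z\in\mathbb{C}^+$. *)

theory Defs
  imports
    "HOL-Probability.Probability"
    "Jordan_Normal_Form.Gauss_Jordan_Elimination"
    "Jordan_Normal_Form.Char_Poly"
begin

text \<open>Matrices are those of the Jordan-Normal-Form library, whose dimension is a value and not
  a type, so that the size \<open>n\<close> can tend to infinity; their indices start at \<open>0\<close>.\<close>

definition mat_trace :: "'a::comm_monoid_add mat \<Rightarrow> 'a" where
  "mat_trace B = (\<Sum>i<dim_row B. B $$ (i, i))"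

text \<open>The eigenvalues of a real symmetric matrix with multiplicity, in decreasing order. (For such
  matrices the characteristic polynomial splits over the reals, so the list has length
  \<open>dim_row B\<close>.)\<close>

definition sym_eigvals :: "real mat \<Rightarrow> real list" where
  "sym_eigvals B = rev (sorted_list_of_multiset (proots (char_poly B)))"

definition esd :: "real mat \<Rightarrow> real measure" where
  "esd B = distr (uniform_count_measure {..<dim_row B}) borel (\<lambda>k. sym_eigvals B ! k)"

text \<open>Functional calculus: \<open>h(B) = Q diag(h(d\<^sub>0), \<dots>, h(d\<^sub>n\<^sub>-\<^sub>1)) Q\<^sup>T\<close> for any orthogonal
  diagonalization \<open>B = Q diag(d\<^sub>0, \<dots>, d\<^sub>n\<^sub>-\<^sub>1) Q\<^sup>T\<close> of the real symmetric matrix \<open>B\<close>; the result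
  does not depend on the diagonalization. The predicate \<open>similar_mat_wit\<close> includes
  \<open>Q Q\<^sup>T = Q\<^sup>T Q = 1\<close>.\<close>

definition mat_fun :: "(real \<Rightarrow> complex) \<Rightarrow> real mat \<Rightarrow> complex mat" where
  "mat_fun h B = (THE C. \<exists>Q d.
     similar_mat_wit B (mat_diag (dim_row B) d) Q (transpose_mat Q) \<and>
     C = map_mat complex_of_real Q * mat_diag (dim_row B) (\<lambda>i. h (d i))
           * map_mat complex_of_real (transpose_mat Q))"

definition resolvent :: "real mat \<Rightarrow> complex \<Rightarrow> complex mat" where
  "resolvent B z = the (mat_inverse (map_mat complex_of_real B - z \<cdot>\<^sub>m 1\<^sub>m (dim_row B)))"

definition perturbed :: "real \<Rightarrow> real mat \<Rightarrow> (nat \<Rightarrow> nat \<Rightarrow> real) \<Rightarrow> real mat" where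
  "perturbed \<sigma> B W = B + (\<sigma> / sqrt (real (dim_row B))) \<cdot>\<^sub>m
     Matrix.mat (dim_row B) (dim_row B) (\<lambda>(i, j). W i j)"

definition stieltjes :: "real measure \<Rightarrow> complex \<Rightarrow> complex" where
  "stieltjes \<mu> z = (LINT x|\<mu>. 1 / (complex_of_real x - z))"

definition compactly_supported :: "real measure \<Rightarrow> bool" where
  "compactly_supported \<mu> \<longleftrightarrow> (\<exists>a b. AE x in \<mu>. x \<in> {a..b})"

definition semicircle :: "real \<Rightarrow> real measure" where
  "semicircle v = density lborel
     (\<lambda>x. ennreal (indicator {- 2 * sqrt v..2 * sqrt v} x * sqrt (4 * v - x\<^sup>2) / (2 * pi * v)))"

text \<open>Voiculescu's R-transform of a compactly supported probability measure \<open>\<mu>\<close>: with the Cauchy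
  transform \<open>G z = (\<integral>x. 1 / (z - x) \<partial>\<mu>) = - stieltjes \<mu> z\<close>, it is the function \<open>R\<close>,
  analytic at \<open>0\<close>, such that \<open>w \<mapsto> R w + 1 / w\<close> is the inverse of \<open>G\<close> near
  infinity. As \<open>G\<close> is injective near infinity, this determines the germ of \<open>R\<close> at \<open>0\<close>.\<close>

definition has_R_transform :: "real measure \<Rightarrow> (complex \<Rightarrow> complex) \<Rightarrow> bool" where
  "has_R_transform \<mu> R \<longleftrightarrow>
     R analytic_on {0} \<and> (\<forall>\<^sub>F w in at 0. - stieltjes \<mu> (R w + 1 / w) = w)"

text \<open>For compactly supported probability measures \<open>\<mu>\<close> and \<open>\<nu>\<close>, the free additive convolution
  is the compactly supported probability measure whose R-transform is the sum of theirs. There is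
  exactly one such measure, as the Cauchy transform near infinity determines its moments.\<close>

definition is_free_additive_convolution ::
    "real measure \<Rightarrow> real measure \<Rightarrow> real measure \<Rightarrow> bool" where
  "is_free_additive_convolution \<mu> \<nu> \<kappa> \<longleftrightarrow>
     real_distribution \<kappa> \<and> compactly_supported \<kappa> \<and>
     (\<exists>R\<^sub>1 R\<^sub>2. has_R_transform \<mu> R\<^sub>1 \<and> has_R_transform \<nu> R\<^sub>2 \<and>
        has_R_transform \<kappa> (\<lambda>w. R\<^sub>1 w + R\<^sub>2 w))"

end

theory Submission
  imports Defs "HOL-Complex_Analysis.Complex_Analysis"
begin

text \<open>Write \<open>A\<close> for \<open>A n\<close>, \<open>G\<close> for the resolvent of the perturbed matrix at \<open>z\<close>, \<open>m = tr G / n\<close> and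
  \<open>\<omega> = z + \<sigma>\<^sup>2 m\<close>. The theorem holds because, seen by functions of \<open>A\<close>, the random matrix \<open>G\<close> behaves
  like the resolvent of \<open>A\<close> itself at the shifted point \<open>\<omega>\<close>, and because \<open>m\<close> converges.

  The first fact is tested on resolvents: for fixed \<open>w\<close> off the real line and \<open>B\<close> the resolvent of \<open>A\<close>
  at \<open>w\<close>, the \<open>defect\<close> is the normalized trace of \<open>B ((A - \<omega>) G - 1)\<close>. Expanding \<open>G\<close> with the
  equation that defines it turns the defect into \<open>- \<sigma> n\<^sup>-\<^sup>3\<^sup>/\<^sup>2 (\<Sum>i j. Z i j (G B) j i) - \<sigma>\<^sup>2 m tr (B G) / n\<close>.
  As the entries of \<open>Z\<close> have mean \<open>0\<close> and variance \<open>1\<close>, multiplication by \<open>Z i j\<close> acts in the mean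
  like differentiation in \<open>Z i j\<close>, up to a Taylor remainder (\<open>stein_coordinate\<close>); the derivatives
  cancel the last term, and the mean of the defect is \<open>O(n\<^sup>-\<^sup>1\<^sup>/\<^sup>2)\<close> (\<open>mean_err\<close>). Moreover the defect has
  Lipschitz constant \<open>O(n\<^sup>-\<^sup>3\<^sup>/\<^sup>2)\<close> in each of the \<open>O(n\<^sup>2)\<close> independent entries, so that its fourth central
  moment is \<open>O(n\<^sup>-\<^sup>2)\<close> (\<open>coordinate_lipschitz_moments\<close>). All bounds come from the operator norms of
  resolvents and are uniform in \<open>A\<close>; since \<open>Z\<close> is independent of \<open>A\<close>, Borel-Cantelli gives almost sure
  convergence of the defect to \<open>0\<close> (\<open>AE_defect_tendsto_0\<close>), simultaneously for \<open>w = \<i>, 2 \<i>, 3 \<i>, \<dots>\<close>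

  From here on the argument is deterministic (\<open>trace_limit\<close>). In the eigenbasis of \<open>A\<close> the defect is a
  weighted sum of the values \<open>1 / (t - w)\<close> at the eigenvalues, with bounded weights. Countably many
  \<open>w\<close> suffice to extend the convergence to all continuous functions on \<open>{h\<^sub>1..h\<^sub>2}\<close>
  (\<open>weighted_sums_vanish\<close>), which means that \<open>tr (f(A) G) / n = (\<integral>t. f t / (t - \<omega>) \<partial>esd A) + o(1)\<close>.
  For \<open>f = 1\<close> this is a fixed point equation for \<open>m\<close>. In the limit it reads
  \<open>s = stieltjes H (z + \<sigma>\<^sup>2 s)\<close>, which has only one solution with \<open>Im s \<ge> 0\<close>
  (\<open>stieltjes_fixed_point_unique\<close>); so \<open>m\<close> converges to \<open>s\<close>, and \<open>f = h\<close> gives the limit claimed.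

  It remains to see that \<open>s\<close> is the Stieltjes transform of the free convolution at \<open>z\<close>. The semicircle
  distribution has the R-transform \<open>w \<mapsto> \<sigma>\<^sup>2 w\<close>, and with it the additivity of R-transforms becomes the
  fixed point equation near infinity; analytic continuation extends it to the upper half-plane
  (\<open>free_convolution_semicircle_subordination\<close>).\<close>

(* Matrices have their dimension as a value here; the equally named constants for matrices that
   are indexed by types are put aside, and so are other meanings of the subscript notation. *)
unbundle no vec_syntax
no_notation fps_nth (infixl "$" 75)
hide_const (open) Finite_Cartesian_Product.mat Determinants.det Finite_Cartesian_Product.transpose
  Finite_Cartesian_Product.vec Finite_Cartesian_Product.row Finite_Cartesian_Product.column

section \<open>Operator norm bounds and traces of complex matrices\<close>

lemma mult_carrier_square [simp]:
  "X \<in> carrier_mat n n \<Longrightarrow> Y \<in> carrier_mat n n \<Longrightarrow> X * Y \<in> carrier_mat n n"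
  by (rule mult_carrier_mat)

definition vnorm :: "complex vec \<Rightarrow> real" where
  "vnorm v = L2_set (\<lambda>i. cmod (v $ i)) {..<dim_vec v}"

text \<open>An upper bound for the operator norm is all that is ever needed, so the norm itself is not
  introduced. Such bounds are what keeps every estimate below independent of \<open>A\<close>.\<close>

definition op_bounded :: "nat \<Rightarrow> real \<Rightarrow> complex mat \<Rightarrow> bool" where
  "op_bounded n c X \<longleftrightarrow> X \<in> carrier_mat n n \<and> 0 \<le> c \<and>
     (\<forall>v\<in>carrier_vec n. vnorm (X *\<^sub>v v) \<le> c * vnorm v)"

lemma op_boundedD:
  assumes "op_bounded n c X"
  shows "X \<in> carrier_mat n n" "0 \<le> c" "v \<in> carrier_vec n \<Longrightarrow> vnorm (X *\<^sub>v v) \<le> c * vnorm v"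
  using assms by (auto simp: op_bounded_def)

lemma op_bounded_mult:
  assumes X: "op_bounded n c X" and Y: "op_bounded n d Y"
  shows "op_bounded n (c * d) (X * Y)"
  unfolding op_bounded_def
proof (intro conjI ballI)
  note X' = op_boundedD[OF X] and Y' = op_boundedD[OF Y]
  show "X * Y \<in> carrier_mat n n" "0 \<le> c * d" using X' Y' by auto
  fix v :: "complex vec" assume v: "v \<in> carrier_vec n"
  have "vnorm (X * Y *\<^sub>v v) = vnorm (X *\<^sub>v (Y *\<^sub>v v))"
    using X'(1) Y'(1) v by (simp add: assoc_mult_mat_vec)
  also have "\<dots> \<le> c * vnorm (Y *\<^sub>v v)"
    by (rule X'(3)) (use Y'(1) v in auto)
  also have "\<dots> \<le> c * (d * vnorm v)"
    by (intro mult_left_mono Y'(3) v X'(2))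
  finally show "vnorm (X * Y *\<^sub>v v) \<le> c * d * vnorm v" by (simp add: mult_ac)
qed

lemma mult_unit_vec_col:
  assumes "X \<in> carrier_mat n n" "j < n"
  shows "X *\<^sub>v unit_vec n j = col (X :: complex mat) j"
  by (rule eq_vecI) (use assms in \<open>auto simp: scalar_prod_def unit_vec_def if_distrib cong: if_cong\<close>)

lemma cmod_le_vnorm: "i < dim_vec v \<Longrightarrow> cmod (v $ i) \<le> vnorm v"
  unfolding vnorm_def by (rule member_le_L2_set[where f="\<lambda>i. cmod (v $ i)"]) auto

lemma vnorm_unit_vec: "j < n \<Longrightarrow> vnorm (unit_vec n j) = 1"
  by (simp add: vnorm_def L2_set_def unit_vec_def if_distrib if_distribR cong: if_cong)

lemma op_bounded_entry:
  assumes X: "op_bounded n c X" and "i < n" "j < n"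
  shows "cmod (X $$ (i, j)) \<le> c"
proof -
  note X' = op_boundedD[OF X]
  have "X $$ (i, j) = (X *\<^sub>v unit_vec n j) $ i"
    using X'(1) assms by (simp add: mult_unit_vec_col)
  also have "cmod \<dots> \<le> vnorm (X *\<^sub>v unit_vec n j)"
    by (rule cmod_le_vnorm) (use X'(1) assms in auto)
  also have "\<dots> \<le> c * 1"
    using X'(3)[of "unit_vec n j"] vnorm_unit_vec[of j n] assms by simp
  finally show ?thesis by simp
qed

lemma op_bounded_trace:
  assumes X: "op_bounded n c X"
  shows "cmod (mat_trace X) \<le> n * c"
proof -
  have "cmod (mat_trace X) \<le> (\<Sum>i<n. cmod (X $$ (i, i)))"
    using op_boundedD(1)[OF X] unfolding mat_trace_def by (auto intro: norm_sum)
  also have "\<dots> \<le> (\<Sum>i<n. c)"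
    by (intro sum_mono op_bounded_entry[OF X]) auto
  finally show ?thesis by simp
qed

lemma mat_trace_add:
  "X \<in> carrier_mat n n \<Longrightarrow> Y \<in> carrier_mat n n \<Longrightarrow> mat_trace (X + Y) = mat_trace X + mat_trace Y"
  by (auto simp: mat_trace_def sum.distrib)

lemma mat_trace_diff:
  "X \<in> carrier_mat n n \<Longrightarrow> Y \<in> carrier_mat n n \<Longrightarrow> mat_trace (X - Y) = mat_trace X - mat_trace (Y::complex mat)"
  by (auto simp: mat_trace_def sum_subtractf)

lemma mat_trace_smult:
  "mat_trace (c \<cdot>\<^sub>m X) = c * mat_trace (X::complex mat)" if "X \<in> carrier_mat n n"
  using that by (auto simp: mat_trace_def sum_distrib_left)

lemma mat_trace_mult:
  assumes "X \<in> carrier_mat n n" "Y \<in> carrier_mat n n"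
  shows "mat_trace (X * Y) = (\<Sum>i<n. \<Sum>j<n. X $$ (i, j) * Y $$ (j, i))"
  using assms by (auto simp: mat_trace_def scalar_prod_def lessThan_atLeast0 intro!: sum.cong)

lemma mat_trace_comm:
  assumes "X \<in> carrier_mat n n" "Y \<in> carrier_mat n n"
  shows "mat_trace (X * Y) = mat_trace (Y * X :: complex mat)"
  unfolding mat_trace_mult[OF assms] mat_trace_mult[OF assms(2,1)]
  by (subst sum.swap) (simp add: mult.commute)

text \<open>The derivative of a symmetric matrix with respect to its independent entry \<open>(i, j)\<close>.\<close>

definition sym_unit :: "nat \<Rightarrow> nat \<Rightarrow> nat \<Rightarrow> complex mat" where
  "sym_unit n i j = Matrix.mat n n (\<lambda>(a, b). if (a = i \<and> b = j) \<or> (a = j \<and> b = i) then 1 else 0)"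

lemma sym_unit_carrier [simp]: "sym_unit n i j \<in> carrier_mat n n"
  by (simp add: sym_unit_def)

lemma sym_unit_mult_vec:
  assumes "v \<in> carrier_vec n" "i < n" "j < n" "a < n"
  shows "(sym_unit n i j *\<^sub>v v) $ a = (if a = i then v $ j else if a = j then v $ i else 0)"
proof -
  have "(sym_unit n i j *\<^sub>v v) $ a
      = (\<Sum>b\<in>{0..<n}. (if (a = i \<and> b = j) \<or> (a = j \<and> b = i) then 1 else 0) * v $ b)"
    using assms by (simp add: sym_unit_def scalar_prod_def)
  also have "\<dots> = (\<Sum>b\<in>{0..<n}. if b = (if a = i then j else i) then (if a = i \<or> a = j then v $ b else 0) else 0)"
    by (intro sum.cong) auto
  also have "\<dots> = (if a = i then v $ j else if a = j then v $ i else 0)"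
    using assms by simp
  finally show ?thesis .
qed

text \<open>Applied to a vector, the matrix only swaps two coordinates and forgets all others.\<close>

lemma op_bounded_sym_unit:
  assumes "i < n" "j < n"
  shows "op_bounded n 1 (sym_unit n i j)"
  unfolding op_bounded_def
proof (intro conjI ballI)
  fix v :: "complex vec" assume v: "v \<in> carrier_vec n"
  let ?s = "\<lambda>a. if a = i then j else if a = j then i else a"
  have dim: "dim_vec (sym_unit n i j *\<^sub>v v) = n" "dim_vec v = n"
    using v by (auto simp: sym_unit_def)
  have "(\<Sum>a<n. (cmod ((sym_unit n i j *\<^sub>v v) $ a))\<^sup>2) \<le> (\<Sum>a<n. (cmod (v $ ?s a))\<^sup>2)"
    by (intro sum_mono) (auto simp: sym_unit_mult_vec[OF v assms])
  also have "\<dots> = (\<Sum>a<n. (cmod (v $ a))\<^sup>2)"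
    by (rule sum.reindex_bij_witness[of _ ?s ?s]) (use assms in auto)
  finally show "vnorm (sym_unit n i j *\<^sub>v v) \<le> 1 * vnorm v"
    unfolding vnorm_def L2_set_def dim by simp
qed auto

lemma mult_sym_unit_entry:
  assumes "X \<in> carrier_mat n n" "Y \<in> carrier_mat n n" "i < n" "j < n" "a < n" "b < n"
  shows "(X * sym_unit n i j * Y) $$ (a, b) =
     (if i = j then X $$ (a, i) * Y $$ (i, b)
      else X $$ (a, i) * Y $$ (j, b) + X $$ (a, j) * Y $$ (i, b))"
proof -
  have r: "X * sym_unit n i j * Y = X * (sym_unit n i j * Y)"
    using assms by (intro assoc_mult_mat) auto
  have c: "(sym_unit n i j * Y) $$ (c, b) = (if c = i then Y $$ (j, b) else if c = j then Y $$ (i, b) else 0)"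
    if "c < n" for c
  proof -
    have "(sym_unit n i j * Y) $$ (c, b) = (sym_unit n i j *\<^sub>v col Y b) $ c"
      using that assms by (simp add: sym_unit_def)
    also have "\<dots> = (if c = i then col Y b $ j else if c = j then col Y b $ i else 0)"
      using that assms by (intro sym_unit_mult_vec) auto
    finally show ?thesis using assms by auto
  qed
  have "(X * (sym_unit n i j * Y)) $$ (a, b) = (\<Sum>c\<in>{0..<n}. X $$ (a, c) * (sym_unit n i j * Y) $$ (c, b))"
  proof -
    define W where "W = sym_unit n i j * Y"
    have "W \<in> carrier_mat n n"
      unfolding W_def by (rule mult_carrier_mat[OF sym_unit_carrier]) (use assms in auto)
    thus ?thesis unfolding W_def[symmetric] using assms by (simp add: scalar_prod_def)
  qed
  also have "\<dots> = (\<Sum>c\<in>{0..<n}. X $$ (a, c) * (if c = i then Y $$ (j, b) else if c = j then Y $$ (i, b) else 0))"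
    by (intro sum.cong) (auto simp: c)
  also have "\<dots> = (\<Sum>c\<in>{0..<n}. (if c = i then X $$ (a, i) * Y $$ (j, b) else 0) + (if c = j then (if i = j then 0 else X $$ (a, j) * Y $$ (i, b)) else 0))"
    by (intro sum.cong) auto
  also have "\<dots> = X $$ (a, i) * Y $$ (j, b) + (if i = j then 0 else X $$ (a, j) * Y $$ (i, b))"
    using assms by (simp add: sum.distrib)
  finally show ?thesis by (auto simp: r)
qed

lemma mat_trace_mult_sym_unit:
  assumes "X \<in> carrier_mat n n" "i < n" "j < n"
  shows "mat_trace (X * sym_unit n i j) = (if i = j then X $$ (i, i) else X $$ (i, j) + X $$ (j, i))"
proof -
  have "mat_trace (X * sym_unit n i j) = (\<Sum>a<n. (X * sym_unit n i j * 1\<^sub>m n) $$ (a, a))"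
    using assms by (simp add: mat_trace_def right_mult_one_mat[of _ n n])
  also have "\<dots> = (\<Sum>a<n. (if a = i then (if i = j then X $$ (i, i) else X $$ (i, j)) else 0)
       + (if a = j then if i = j then 0 else X $$ (j, i) else 0))"
    by (intro sum.cong refl, subst mult_sym_unit_entry) (use assms in auto)
  also have "\<dots> = (if i = j then X $$ (i, i) else X $$ (i, j) + X $$ (j, i))"
    using assms by (simp add: sum.distrib)
  finally show ?thesis .
qed

section \<open>Resolvents of real symmetric matrices\<close>

abbreviation cmat :: "real mat \<Rightarrow> complex mat" where
  "cmat \<equiv> map_mat complex_of_real"

text \<open>For symmetric \<open>A\<close> the form \<open>\<langle>v, A v\<rangle>\<close> is real, so the imaginary part of
  \<open>\<langle>v, (A - z) v\<rangle>\<close> is \<open>- Im z \<parallel>v\<parallel>\<^sup>2\<close>; Cauchy-Schwarz does the rest. This one estimate gives the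
  invertibility of \<open>A - z\<close> and the norm of its inverse.\<close>

lemma sym_shift_coercive:
  fixes A :: "real mat"
  assumes A: "A \<in> carrier_mat n n" "transpose_mat A = A" and v: "v \<in> carrier_vec n"
  shows "\<bar>Im z\<bar> * vnorm v \<le> vnorm ((cmat A - z \<cdot>\<^sub>m 1\<^sub>m n) *\<^sub>v v)"
proof -
  let ?M = "cmat A - z \<cdot>\<^sub>m 1\<^sub>m n"
  define N where "N = vnorm v"
  have dims: "dim_vec v = n" "dim_vec (?M *\<^sub>v v) = n" using A v by auto
  have sym: "A $$ (i, j) = A $$ (j, i)" if "i < n" "j < n" for i j
    using A that by (metis carrier_matD index_transpose_mat(1))
  have ent: "(?M *\<^sub>v v) $ i = (\<Sum>j<n. of_real (A $$ (i, j)) * v $ j) - z * v $ i" if "i < n" for i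
  proof -
    have "(?M *\<^sub>v v) $ i = (\<Sum>j<n. (of_real (A $$ (i, j)) - z * (if i = j then 1 else 0)) * v $ j)"
      using that A v by (auto simp: scalar_prod_def lessThan_atLeast0 intro!: sum.cong)
    also have "\<dots> = (\<Sum>j<n. of_real (A $$ (i, j)) * v $ j - (if i = j then z * v $ i else 0))"
      by (intro sum.cong) (auto simp: algebra_simps)
    finally show ?thesis using that by (simp add: sum_subtractf)
  qed
  define P where "P = (\<Sum>i<n. \<Sum>j<n. cnj (v $ i) * (of_real (A $$ (i, j)) * v $ j))"
  have "cnj P = (\<Sum>i<n. \<Sum>j<n. v $ i * (of_real (A $$ (i, j)) * cnj (v $ j)))"
    by (simp add: P_def)
  also have "\<dots> = (\<Sum>j<n. \<Sum>i<n. v $ i * (of_real (A $$ (i, j)) * cnj (v $ j)))"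
    by (rule sum.swap)
  also have "\<dots> = P"
    unfolding P_def by (intro sum.cong refl) (use sym in \<open>auto simp: mult_ac\<close>)
  finally have ImP: "Im P = 0" by (metis complex_cnj_cancel_iff Reals_cnj_iff complex_is_Real_iff)
  have N2: "N\<^sup>2 = (\<Sum>i<n. (cmod (v $ i))\<^sup>2)"
    unfolding N_def vnorm_def L2_set_def dims by (simp add: sum_nonneg)
  have "(\<Sum>i<n. cnj (v $ i) * (?M *\<^sub>v v) $ i) = P - z * of_real (N\<^sup>2)"
    proof -
    have "(\<Sum>i<n. cnj (v $ i) * (?M *\<^sub>v v) $ i)
        = (\<Sum>i<n. (\<Sum>j<n. cnj (v $ i) * (of_real (A $$ (i, j)) * v $ j)) - z * of_real ((cmod (v $ i))\<^sup>2))"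
      by (intro sum.cong refl, subst ent)
         (auto simp: sum_distrib_left algebra_simps complex_norm_square simp del: of_real_power)
    thus ?thesis by (simp add: N2 P_def sum_subtractf sum_distrib_left del: of_real_power)
  qed
  hence "Im (\<Sum>i<n. cnj (v $ i) * (?M *\<^sub>v v) $ i) = - Im z * N\<^sup>2"
    by (simp add: ImP)
  hence "\<bar>Im z\<bar> * N\<^sup>2 \<le> cmod (\<Sum>i<n. cnj (v $ i) * (?M *\<^sub>v v) $ i)"
    using abs_Im_le_cmod[of "\<Sum>i<n. cnj (v $ i) * (?M *\<^sub>v v) $ i"] by (simp add: abs_mult)
  also have "\<dots> \<le> (\<Sum>i<n. \<bar>cmod (v $ i)\<bar> * \<bar>cmod ((?M *\<^sub>v v) $ i)\<bar>)"
    by (rule order_trans[OF norm_sum]) (simp add: norm_mult)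
  also have "\<dots> \<le> N * vnorm (?M *\<^sub>v v)"
    unfolding N_def vnorm_def dims by (rule L2_set_mult_ineq)
  finally have *: "\<bar>Im z\<bar> * N\<^sup>2 \<le> N * vnorm (?M *\<^sub>v v)" .
  have "N \<ge> 0" "vnorm (?M *\<^sub>v v) \<ge> 0" by (auto simp: N_def vnorm_def)
  show ?thesis
  proof (cases "N = 0")
    case True thus ?thesis using \<open>vnorm (?M *\<^sub>v v) \<ge> 0\<close> by (simp add: N_def)
  next
    case False
    hence "N * (\<bar>Im z\<bar> * N) \<le> N * vnorm (?M *\<^sub>v v)" using * by (simp add: power2_eq_square mult_ac)
    thus ?thesis using False \<open>N \<ge> 0\<close> by (simp add: N_def)
  qed
qed

lemma vnorm_zero_imp:
  assumes "v \<in> carrier_vec n" "vnorm v \<le> 0" shows "v = 0\<^sub>v n"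
proof (rule eq_vecI)
  fix i assume "i < dim_vec (0\<^sub>v n :: complex vec)"
  hence "cmod (v $ i) \<le> vnorm v" using cmod_le_vnorm[of i v] assms by auto
  hence "v $ i = 0" using assms(2) by (metis norm_le_zero_iff order_trans)
  thus "v $ i = 0\<^sub>v n $ i" using \<open>i < _\<close> by simp
qed (use assms in auto)

lemma sym_shift_det:
  assumes A: "A \<in> carrier_mat n n" "transpose_mat A = A" and z: "Im z \<noteq> 0"
  shows "Determinant.det (cmat A - z \<cdot>\<^sub>m 1\<^sub>m n) \<noteq> 0"
proof
  let ?M = "cmat A - z \<cdot>\<^sub>m 1\<^sub>m n"
  assume "Determinant.det ?M = 0"
  hence "\<exists>v. v \<in> carrier_vec n \<and> v \<noteq> 0\<^sub>v n \<and> ?M *\<^sub>v v = 0\<^sub>v n"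
    by (subst (asm) det_0_iff_vec_prod_zero_field[of _ n]) (use A in auto)
  then obtain v where v: "v \<in> carrier_vec n" "v \<noteq> 0\<^sub>v n" "?M *\<^sub>v v = 0\<^sub>v n" by auto
  have "\<bar>Im z\<bar> * vnorm v \<le> 0"
    using sym_shift_coercive[OF A v(1), of z] unfolding v(3) by (simp add: vnorm_def L2_set_def)
  hence "vnorm v \<le> 0" using z by (simp add: mult_le_0_iff)
  with v vnorm_zero_imp show False by blast
qed

lemma smult_smult_mat: "a \<cdot>\<^sub>m (b \<cdot>\<^sub>m X) = (a * b) \<cdot>\<^sub>m (X :: complex mat)"
  by (rule eq_matI) auto

lemma inverse_unique_mat:
  assumes "X \<in> carrier_mat n n" "Y \<in> carrier_mat n n" "Y' \<in> carrier_mat n n"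
    "Y * X = 1\<^sub>m n" "X * Y' = 1\<^sub>m n"
  shows "Y = (Y' :: complex mat)"
proof -
  have "Y = Y * (X * Y')" using assms by simp
  also have "\<dots> = (Y * X) * Y'" using assms(1-3) by (simp add: assoc_mult_mat)
  also have "\<dots> = Y'" using assms by simp
  finally show ?thesis .
qed

text \<open>The formula with the adjugate serves to see that resolvent entries are measurable functions of
  the matrix entries.\<close>

lemma
  assumes A: "A \<in> carrier_mat n n" "transpose_mat A = A" and z: "Im z \<noteq> 0"
  shows resolvent_carrier: "resolvent A z \<in> carrier_mat n n"
    and resolvent_right: "(cmat A - z \<cdot>\<^sub>m 1\<^sub>m n) * resolvent A z = 1\<^sub>m n"
    and resolvent_left: "resolvent A z * (cmat A - z \<cdot>\<^sub>m 1\<^sub>m n) = 1\<^sub>m n"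
    and resolvent_adj: "resolvent A z = (1 / Determinant.det (cmat A - z \<cdot>\<^sub>m 1\<^sub>m n)) \<cdot>\<^sub>m adj_mat (cmat A - z \<cdot>\<^sub>m 1\<^sub>m n)"
    and resolvent_bounded: "op_bounded n (1 / \<bar>Im z\<bar>) (resolvent A z)"
    and resolvent_sym: "transpose_mat (resolvent A z) = resolvent A z"
proof -
  let ?M = "cmat A - z \<cdot>\<^sub>m 1\<^sub>m n"
  have M: "?M \<in> carrier_mat n n" using A by auto
  have d: "Determinant.det ?M \<noteq> 0" using sym_shift_det[OF A z] .
  define R where "R = (1 / Determinant.det ?M) \<cdot>\<^sub>m adj_mat ?M"
  have R: "R \<in> carrier_mat n n" "?M * R = 1\<^sub>m n" "R * ?M = 1\<^sub>m n"
    unfolding R_def using adj_mat[OF M] M d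
    by (auto simp: mult_smult_distrib[OF M] mult_smult_assoc_mat[of _ n n] smult_smult_mat)
  have "mat_inverse ?M \<noteq> None"
  proof
    assume "mat_inverse ?M = None"
    from mat_inverse(1)[OF M this, of "()"]
    have "?M \<notin> Units (ring_mat TYPE(complex) n ())" .
    moreover have "?M \<in> Units (ring_mat TYPE(complex) n ())"
      unfolding Units_def ring_mat_def using M R by auto
    ultimately show False by simp
  qed
  then obtain B where B: "mat_inverse ?M = Some B" by auto
  note B' = mat_inverse(2)[OF M B]
  have rB: "resolvent A z = B"
    using A B by (auto simp: resolvent_def)
  have BR: "B = R" by (rule inverse_unique_mat[OF M]) (use B' R in auto)
  show c: "resolvent A z \<in> carrier_mat n n" and r: "?M * resolvent A z = 1\<^sub>m n" 
    and l: "resolvent A z * ?M = 1\<^sub>m n" using B' rB by auto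
  show "resolvent A z = (1 / Determinant.det ?M) \<cdot>\<^sub>m adj_mat ?M"
    using rB BR R_def by simp
  show "op_bounded n (1 / \<bar>Im z\<bar>) (resolvent A z)"
    unfolding op_bounded_def
  proof (intro conjI ballI c)
    fix v :: "complex vec" assume v: "v \<in> carrier_vec n"
    have "\<bar>Im z\<bar> * vnorm (resolvent A z *\<^sub>v v) \<le> vnorm (?M *\<^sub>v (resolvent A z *\<^sub>v v))"
      by (rule sym_shift_coercive[OF A]) (use c v in auto)
    also have "?M *\<^sub>v (resolvent A z *\<^sub>v v) = v"
      using assoc_mult_mat_vec[OF M c v] r v by simp
    finally show "vnorm (resolvent A z *\<^sub>v v) \<le> 1 / \<bar>Im z\<bar> * vnorm v"
      using z by (simp add: field_simps)
  qed auto
  have sM: "transpose_mat ?M = ?M"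
  proof (rule eq_matI)
    fix i j assume "i < dim_row ?M" "j < dim_col ?M"
    moreover have "A $$ (j, i) = A $$ (i, j)" if "i < n" "j < n"
      using A that by (metis carrier_matD index_transpose_mat(1))
    ultimately show "transpose_mat ?M $$ (i, j) = ?M $$ (i, j)" using A by auto
  qed (use A in auto)
  show "transpose_mat (resolvent A z) = resolvent A z"
  proof (rule inverse_unique_mat[OF M])
    show "transpose_mat (resolvent A z) * ?M = 1\<^sub>m n"
      using transpose_mult[OF M c] r sM by simp
  qed (use c r in auto)
qed

lemma resolvent_diff:
  assumes A: "A \<in> carrier_mat n n" "transpose_mat A = A"
    and B: "B \<in> carrier_mat n n" "transpose_mat B = B" and z: "Im z \<noteq> 0" "Im w \<noteq> 0"
  shows "resolvent B w - resolvent A z = resolvent B w * (cmat A - cmat B + (w - z) \<cdot>\<^sub>m 1\<^sub>m n) * resolvent A z"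
proof -
  let ?MA = "cmat A - z \<cdot>\<^sub>m 1\<^sub>m n" and ?MB = "cmat B - w \<cdot>\<^sub>m 1\<^sub>m n"
  let ?RA = "resolvent A z" and ?RB = "resolvent B w"
  have c: "?MA \<in> carrier_mat n n" "?MB \<in> carrier_mat n n" "?RA \<in> carrier_mat n n" "?RB \<in> carrier_mat n n"
    using A B resolvent_carrier[OF A z(1)] resolvent_carrier[OF B z(2)] by auto
  have "cmat A - cmat B + (w - z) \<cdot>\<^sub>m 1\<^sub>m n = ?MA - ?MB"
    by (rule eq_matI) (use A B in \<open>auto simp: algebra_simps\<close>)
  hence "?RB * (cmat A - cmat B + (w - z) \<cdot>\<^sub>m 1\<^sub>m n) * ?RA = ?RB * (?MA - ?MB) * ?RA" by simp
  also have "\<dots> = ?RB * ?MA * ?RA - ?RB * ?MB * ?RA"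
    using c by (simp add: mult_minus_distrib_mat minus_mult_distrib_mat[of _ n n])
  also have "?RB * ?MA * ?RA = ?RB"
    using c resolvent_right[OF A z(1)] by (simp add: assoc_mult_mat[of _ n n])
  also have "?RB * ?MB * ?RA = ?RA"
    using c resolvent_left[OF B z(2)] by simp
  finally show ?thesis by simp
qed

section \<open>The spectral theorem and functional calculus\<close>

lemma sym_entry: "A \<in> carrier_mat n n \<Longrightarrow> transpose_mat A = A \<Longrightarrow> i < n \<Longrightarrow> j < n \<Longrightarrow> A $$ (i, j) = A $$ (j, i)"
  by (metis carrier_matD index_transpose_mat(1))

text \<open>A complex root of the characteristic polynomial exists, and it is real because \<open>A - z\<close> is
  invertible off the real line.\<close>

lemma sym_real_eigenvalue:
  fixes A :: "real mat"
  assumes A: "A \<in> carrier_mat n n" "transpose_mat A = A" and n: "n > 0"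
  shows "\<exists>e. eigenvalue A e"
proof -
  have cA: "cmat A \<in> carrier_mat n n" using A by simp
  obtain as where as: "char_poly (cmat A) = (\<Prod>a\<leftarrow>as. [:- a, 1:])" "length as = n"
    using char_poly_factorized[OF cA] by auto
  then obtain a bs where "as = a # bs" using n by (cases as) auto
  hence "poly (char_poly (cmat A)) a = 0" by (simp add: as)
  hence ev: "eigenvalue (cmat A) a" using eigenvalue_root_char_poly[OF cA] by simp
  have cm: "char_matrix (cmat A) a = cmat A - a \<cdot>\<^sub>m 1\<^sub>m n"
    using A by (auto simp: char_matrix_def)
  have "Im a = 0"
    using ev sym_shift_det[OF A, of a] by (auto simp: eigenvalue_det[OF cA] cm)
  then obtain x where x: "a = of_real x" by (metis complex_is_Real_iff Reals_cases)
  have "char_matrix (cmat A) a = cmat (char_matrix A x)"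
    using A by (auto simp: char_matrix_def x intro!: eq_matI)
  hence "eigenvalue A x"
    using ev A by (simp add: eigenvalue_det[OF cA] eigenvalue_det[OF A(1)] of_real_hom.hom_det)
  thus ?thesis by auto
qed

text \<open>The reflection that exchanges the unit vector \<open>v\<close> and the first basis vector: an explicit
  orthogonal matrix with a prescribed first column, which spares the completion of \<open>v\<close> to an
  orthonormal basis.\<close>

lemma householder:
  fixes v :: "nat \<Rightarrow> real"
  assumes v: "(\<Sum>i<n. (v i)\<^sup>2) = 1" and n: "n > 0"
  obtains Q where "Q \<in> carrier_mat n n" "transpose_mat Q = Q" "Q * Q = 1\<^sub>m n"
    "\<And>i. i < n \<Longrightarrow> Q $$ (i, 0) = v i"
proof (cases "v 0 = 1")
  case True
  have "(\<Sum>i\<in>{..<n} - {0}. (v i)\<^sup>2) = 0"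
    using v True n by (simp add: sum_diff1)
  hence "v i = 0" if "i < n" "i \<noteq> 0" for i
    using that by (subst (asm) sum_nonneg_eq_0_iff) auto
  with True that[of "1\<^sub>m n"] n show ?thesis by auto
next
  case False
  (* Q = 1 - 2 u u\<^sup>T / (u \<bullet> u), where u is v minus the first basis vector and u \<bullet> u = 2 c. *)
  define u where "u i = v i - (if i = 0 then 1 else 0)" for i
  define c where "c = 1 - v 0"
  have c: "c \<noteq> 0" using False by (simp add: c_def)
  have uu: "(\<Sum>i<n. u i * u i) = 2 * c"
  proof -
    have "(\<Sum>i<n. u i * u i) = (\<Sum>i<n. (v i)\<^sup>2 + (if i = 0 then 1 - 2 * v 0 else 0))"
      by (intro sum.cong) (auto simp: u_def power2_eq_square algebra_simps)
    also have "\<dots> = 2 * c" using n by (simp add: sum.distrib v c_def)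
    finally show ?thesis .
  qed
  define Q where "Q = Matrix.mat n n (\<lambda>(i, j). (if i = j then 1 else 0) - u i * u j / c)"
  have Q: "Q \<in> carrier_mat n n" by (simp add: Q_def)
  show ?thesis
  proof (rule that[OF Q])
    show "transpose_mat Q = Q" by (rule eq_matI) (auto simp: Q_def)
    show "Q $$ (i, 0) = v i" if "i < n" for i
      using that n c by (simp add: Q_def u_def c_def field_simps)
    show "Q * Q = 1\<^sub>m n"
    proof (rule eq_matI)
      fix i j assume "i < dim_row (1\<^sub>m n :: real mat)" "j < dim_col (1\<^sub>m n :: real mat)"
      hence ij: "i < n" "j < n" by auto
      have "(Q * Q) $$ (i, j) = (\<Sum>k<n. ((if i = k then 1 else 0) - u i * u k / c) * ((if k = j then 1 else 0) - u k * u j / c))"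
        using ij by (auto simp: Q_def scalar_prod_def lessThan_atLeast0 intro!: sum.cong)
      also have "\<dots> = (\<Sum>k<n. (if k = i then (if i = j then 1 else 0) - u i * u j / c else 0)
          - (if k = j then u i * u j / c else 0) + (u i * u j / c\<^sup>2) * (u k * u k))"
        by (intro sum.cong refl) (auto simp: algebra_simps power2_eq_square)
      also have "\<dots> = (if i = j then 1 else 0) - 2 * (u i * u j / c) + (u i * u j / c\<^sup>2) * (\<Sum>k<n. u k * u k)"
        unfolding sum_distrib_left using ij by (simp add: sum.distrib sum_subtractf)
      also have "\<dots> = (if i = j then 1 else 0) - 2 * (u i * u j / c) + (u i * u j / c\<^sup>2) * (2 * c)"
        by (simp add: uu)
      also have "\<dots> = (if i = j then 1 else 0)"
        using c by (simp add: field_simps power2_eq_square)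
      finally show "(Q * Q) $$ (i, j) = 1\<^sub>m n $$ (i, j)" using ij by simp
    qed (auto simp: Q_def)
  qed
qed

lemma one_mat_four_block: "1\<^sub>m (Suc n) = four_block_mat (1\<^sub>m 1) (0\<^sub>m 1 n) (0\<^sub>m n 1) (1\<^sub>m n)"
  by (rule eq_matI) auto

lemma mult_block_diag:
  fixes A1 B1 A2 B2 :: "real mat"
  assumes "A1 \<in> carrier_mat 1 1" "B1 \<in> carrier_mat 1 1" "A2 \<in> carrier_mat n n" "B2 \<in> carrier_mat n n"
  shows "four_block_mat A1 (0\<^sub>m 1 n) (0\<^sub>m n 1) A2 * four_block_mat B1 (0\<^sub>m 1 n) (0\<^sub>m n 1) B2
    = four_block_mat (A1 * B1) (0\<^sub>m 1 n) (0\<^sub>m n 1) (A2 * B2)"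
proof -
  have "A1 * B1 + 0\<^sub>m 1 n * 0\<^sub>m n 1 = A1 * B1" "A1 * 0\<^sub>m 1 n + 0\<^sub>m 1 n * B2 = 0\<^sub>m 1 n"
    "0\<^sub>m n 1 * B1 + A2 * 0\<^sub>m n 1 = 0\<^sub>m n 1" "0\<^sub>m n 1 * 0\<^sub>m 1 n + A2 * B2 = A2 * B2"
    using assms by (auto intro!: eq_matI simp: scalar_prod_def)
  thus ?thesis
    by (subst mult_four_block_mat[of _ 1 1 _ n _ n _ _ 1 _ n]) (use assms in simp_all)
qed

text \<open>Induction on the dimension: conjugation by the Householder reflection of a unit eigenvector
  splits off a one-dimensional block, and symmetry makes the first row vanish with the first
  column.\<close>

theorem real_spectral_theorem:
  fixes A :: "real mat"
  assumes "A \<in> carrier_mat n n" "transpose_mat A = A"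
  shows "\<exists>Q d. similar_mat_wit A (mat_diag n d) Q (transpose_mat Q)"
  using assms
proof (induction n arbitrary: A)
  case 0
  show ?case
    by (intro exI[of _ "1\<^sub>m 0"] exI similar_mat_witI) (use 0 in \<open>auto intro!: eq_matI simp: mat_diag_def\<close>)
next
  case (Suc n)
  note A = Suc.prems
  obtain e where "eigenvalue A e" using sym_real_eigenvalue[OF A] by auto
  then obtain w where w: "w \<in> carrier_vec (Suc n)" "w \<noteq> 0\<^sub>v (Suc n)" "A *\<^sub>v w = e \<cdot>\<^sub>v w"
    using A by (auto simp: eigenvalue_def eigenvector_def)
  define N where "N = sqrt (\<Sum>i<Suc n. (w $ i)\<^sup>2)"
  have "\<exists>i<Suc n. w $ i \<noteq> 0"
  proof (rule ccontr)
    assume "\<not> ?thesis"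
    hence "w = 0\<^sub>v (Suc n)" using w(1) by (intro eq_vecI) auto
    thus False using w(2) by simp
  qed
  then obtain i0 where "i0 < Suc n" "w $ i0 \<noteq> 0" by auto
  hence "(\<Sum>i<Suc n. (w $ i)\<^sup>2) > 0"
    by (intro sum_pos2[of _ i0]) auto
  hence N: "N > 0" "N\<^sup>2 = (\<Sum>i<Suc n. (w $ i)\<^sup>2)" by (auto simp: N_def)
  define v where "v i = w $ i / N" for i
  have v1: "(\<Sum>i<Suc n. (v i)\<^sup>2) = 1"
  proof -
    have "(\<Sum>i<Suc n. (v i)\<^sup>2) = (\<Sum>i<Suc n. (w $ i)\<^sup>2) / N\<^sup>2"
      unfolding sum_divide_distrib by (simp add: v_def power_divide)
    thus ?thesis using N by (metis divide_self less_irrefl zero_less_power)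
  qed
  obtain Q where Q: "Q \<in> carrier_mat (Suc n) (Suc n)" "transpose_mat Q = Q" "Q * Q = 1\<^sub>m (Suc n)"
    and Qv: "\<And>i. i < Suc n \<Longrightarrow> Q $$ (i, 0) = v i"
    using householder[OF v1] by auto
  define B where "B = Q * A * Q"
  have B: "B \<in> carrier_mat (Suc n) (Suc n)" using A Q by (auto simp: B_def)
  have Bs: "transpose_mat B = B"
    using A Q by (simp add: B_def transpose_mult[of _ "Suc n" "Suc n" _ "Suc n"] assoc_mult_mat[of _ "Suc n" "Suc n" _ "Suc n" _ "Suc n"])
  have colQ: "col Q 0 = (1 / N) \<cdot>\<^sub>v w"
    by (rule eq_vecI) (use Q Qv w in \<open>auto simp: v_def\<close>)
  have "col B 0 = Q *\<^sub>v col (A * Q) 0"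
    unfolding B_def using A Q by (simp add: assoc_mult_mat[of _ "Suc n" "Suc n" _ "Suc n" _ "Suc n"]
        col_mult2[of _ "Suc n" "Suc n" _ "Suc n"] del: col_mult)
  also have "col (A * Q) 0 = A *\<^sub>v col Q 0"
    using A Q by (intro col_mult2[of _ "Suc n" "Suc n" _ "Suc n"]) auto
  also have "A *\<^sub>v col Q 0 = e \<cdot>\<^sub>v col Q 0"
    unfolding colQ mult_mat_vec[OF A(1) w(1)] w(3) by (rule eq_vecI) auto
  also have "Q *\<^sub>v (e \<cdot>\<^sub>v col Q 0) = e \<cdot>\<^sub>v (Q *\<^sub>v col Q 0)"
    by (rule mult_mat_vec[OF Q(1)]) (use Q(1) in \<open>metis col_dim carrier_matD(1)\<close>)
  also have "Q *\<^sub>v col Q 0 = col (Q * Q) 0"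
    by (rule col_mult2[OF Q(1) Q(1), symmetric]) simp
  finally have colB: "col B 0 = e \<cdot>\<^sub>v unit_vec (Suc n) 0" unfolding Q(3) by simp
  have B0: "B $$ (i, 0) = (if i = 0 then e else 0)" if "i < Suc n" for i
  proof -
    have "B $$ (i, 0) = col B 0 $ i" using that B by auto
    thus ?thesis using that by (simp add: colB)
  qed
  define C where "C = Matrix.mat n n (\<lambda>(i, j). B $$ (Suc i, Suc j))"
  have C: "C \<in> carrier_mat n n" by (simp add: C_def)
  have Cs: "transpose_mat C = C"
    by (rule eq_matI) (auto simp: C_def sym_entry[OF B Bs])
  obtain P d where P: "similar_mat_wit C (mat_diag n d) P (transpose_mat P)"
    using Suc.IH[OF C Cs] by auto
  note P' = similar_mat_witD2[OF C P]
  define W where "W = four_block_mat (1\<^sub>m 1) (0\<^sub>m 1 n) (0\<^sub>m n 1) P"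
  have W: "W \<in> carrier_mat (Suc n) (Suc n)"
    using four_block_carrier_mat[of "1\<^sub>m 1" 1 1 P n n] P' by (simp add: W_def)
  have WT: "transpose_mat W = four_block_mat (1\<^sub>m 1) (0\<^sub>m 1 n) (0\<^sub>m n 1) (transpose_mat P)"
    unfolding W_def by (subst transpose_four_block_mat[of _ 1 1 _ n _ n]) (use P' in auto)
  have WW: "W * transpose_mat W = 1\<^sub>m (Suc n)" "transpose_mat W * W = 1\<^sub>m (Suc n)"
    unfolding WT unfolding W_def one_mat_four_block
    by (subst mult_block_diag; use P' in simp)+
  define d' where "d' i = (case i of 0 \<Rightarrow> e | Suc j \<Rightarrow> d j)" for i
  have D: "mat_diag (Suc n) d' = four_block_mat (mat_diag 1 (\<lambda>_. e)) (0\<^sub>m 1 n) (0\<^sub>m n 1) (mat_diag n d)"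
    by (rule eq_matI) (auto simp: mat_diag_def d'_def split: nat.splits)
  have WD: "W * mat_diag (Suc n) d' * transpose_mat W = four_block_mat (mat_diag 1 (\<lambda>_. e)) (0\<^sub>m 1 n) (0\<^sub>m n 1) C"
  proof -
    have "W * mat_diag (Suc n) d' = four_block_mat (mat_diag 1 (\<lambda>_. e)) (0\<^sub>m 1 n) (0\<^sub>m n 1) (P * mat_diag n d)"
      unfolding D W_def using P' by (subst mult_block_diag) (auto simp: left_mult_one_mat[OF mat_diag_dim] simp del: One_nat_def)
    also have "\<dots> * transpose_mat W = four_block_mat (mat_diag 1 (\<lambda>_. e)) (0\<^sub>m 1 n) (0\<^sub>m n 1) (P * mat_diag n d * transpose_mat P)"
      unfolding WT using P'(5-7) by (subst mult_block_diag) (auto simp: right_mult_one_mat[OF mat_diag_dim] simp del: One_nat_def)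
    finally show ?thesis unfolding P'(3)[symmetric] .
  qed
  note WD
  also have "four_block_mat (mat_diag 1 (\<lambda>_. e)) (0\<^sub>m 1 n) (0\<^sub>m n 1) C = B"
  proof (rule eq_matI)
    fix i j assume "i < dim_row B" "j < dim_col B"
    hence ij: "i < Suc n" "j < Suc n" using B by auto
    have "B $$ (0, j) = (if j = 0 then e else 0)" using B0[OF ij(2)] sym_entry[OF B Bs, of 0 j] ij by simp
    thus "four_block_mat (mat_diag 1 (\<lambda>_. e)) (0\<^sub>m 1 n) (0\<^sub>m n 1) C $$ (i, j) = B $$ (i, j)"
      using ij B0[OF ij(1)] by (cases i; cases j) (auto simp: C_def mat_diag_def)
  qed (use B C in \<open>auto simp: mat_diag_def\<close>)
  finally have WB: "W * mat_diag (Suc n) d' * transpose_mat W = B" .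
  let ?R = "Q * W"
  have c: "W \<in> carrier_mat (Suc n) (Suc n)" "transpose_mat W \<in> carrier_mat (Suc n) (Suc n)"
    "mat_diag (Suc n) d' \<in> carrier_mat (Suc n) (Suc n)" using W by auto
  have RT: "transpose_mat ?R = transpose_mat W * Q"
    using W Q by (simp add: transpose_mult[of _ "Suc n" "Suc n" _ "Suc n"])
  note assoc = assoc_mult_mat[of _ "Suc n" "Suc n" _ "Suc n" _ "Suc n"]
  have "similar_mat_wit A (mat_diag (Suc n) d') ?R (transpose_mat ?R)"
  proof (rule similar_mat_witI)
    show "?R * transpose_mat ?R = 1\<^sub>m (Suc n)"
    proof -
      have "?R * transpose_mat ?R = Q * (W * transpose_mat W) * Q"
        unfolding RT using c Q(1) by (simp add: assoc)
      thus ?thesis using WW Q by simp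
    qed
    show "transpose_mat ?R * ?R = 1\<^sub>m (Suc n)"
    proof -
      have "transpose_mat ?R * ?R = transpose_mat W * (Q * Q) * W"
        unfolding RT using c Q(1) by (simp add: assoc)
      thus ?thesis using WW Q W by simp
    qed
    have "?R * mat_diag (Suc n) d' * transpose_mat ?R = Q * (W * mat_diag (Suc n) d' * transpose_mat W) * Q"
      unfolding RT using c Q(1) by (simp add: assoc)
    also have "\<dots> = (Q * Q) * A * (Q * Q)"
      unfolding WB B_def using A Q(1) by (simp add: assoc)
    also have "\<dots> = A" using A Q by simp
    finally show "A = ?R * mat_diag (Suc n) d' * transpose_mat ?R" by simp
  qed (use A Q W in auto)
  thus ?case by blast
qed

text \<open>Two orthogonal diagonalizations of \<open>A\<close> are related by \<open>R = Q\<^sup>T Q'\<close>, and \<open>R\<close> intertwines the two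
  diagonal matrices: \<open>R\<close> vanishes at \<open>(i, j)\<close> unless \<open>d i = d' j\<close>. Hence it also intertwines their
  images under \<open>h\<close>, and the description in \<open>mat_fun\<close> is unique.\<close>

lemma mat_fun_diag:
  assumes A: "A \<in> carrier_mat n n" and w: "similar_mat_wit A (mat_diag n d) Q (transpose_mat Q)"
  shows "mat_fun h A = cmat Q * mat_diag n (\<lambda>i. h (d i)) * cmat (transpose_mat Q)"
proof -
  define C where "C Q d = cmat Q * mat_diag n (\<lambda>i. h (d i)) * cmat (transpose_mat Q)" for Q d
  have uniq: "C Q' d' = C Q d" if w': "similar_mat_wit A (mat_diag n d') Q' (transpose_mat Q')" for Q' d'
  proof -
    note W = similar_mat_witD2[OF A w] and W' = similar_mat_witD2[OF A w']
    note assoc = assoc_mult_mat[of _ n n _ n _ n]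
    define R where "R = transpose_mat Q * Q'"
    have Rc: "R \<in> carrier_mat n n" using W W' by (simp add: R_def)
    have QR: "Q * R = Q'"
    proof -
      have "Q * R = (Q * transpose_mat Q) * Q'" unfolding R_def using W(6,7) W'(6,7) by (simp add: assoc)
      thus ?thesis using W W' by simp
    qed
    have RQ: "R * transpose_mat Q' = transpose_mat Q"
    proof -
      have "R * transpose_mat Q' = transpose_mat Q * (Q' * transpose_mat Q')"
        unfolding R_def using W(6,7) W'(6,7) by (simp add: assoc)
      thus ?thesis using W W' by simp
    qed
    have "transpose_mat Q * A * Q' = mat_diag n d * R"
    proof -
      have "transpose_mat Q * A * Q' = transpose_mat Q * (Q * mat_diag n d * transpose_mat Q) * Q'"
        using W(3) by simp
      also have "\<dots> = (transpose_mat Q * Q) * mat_diag n d * R"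
        unfolding R_def using W(5-7) W'(6,7) by (simp add: assoc)
      finally show ?thesis using W(2,5) by simp
    qed
    moreover have "transpose_mat Q * A * Q' = R * mat_diag n d'"
    proof -
      have "transpose_mat Q * A * Q' = transpose_mat Q * (Q' * mat_diag n d' * transpose_mat Q') * Q'"
        using W'(3) by simp
      also have "\<dots> = R * mat_diag n d' * (transpose_mat Q' * Q')"
        unfolding R_def using W(5-7) W'(5-7) by (simp add: assoc)
      finally show ?thesis using W'(2,5) Rc by simp
    qed
    ultimately have DR: "mat_diag n d * R = R * mat_diag n d'" by simp
    have "h (d i) * of_real (R $$ (i, j)) = of_real (R $$ (i, j)) * h (d' j)" if "i < n" "j < n" for i j
    proof -
      have "d i * R $$ (i, j) = R $$ (i, j) * d' j"
        using arg_cong[OF DR, of "\<lambda>X. X $$ (i, j)"] that Rc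
        by (simp add: mat_diag_mult_left[OF Rc] mat_diag_mult_right[OF Rc])
      thus ?thesis by (cases "R $$ (i, j) = 0") auto
    qed
    hence hR: "mat_diag n (\<lambda>i. h (d i)) * cmat R = cmat R * mat_diag n (\<lambda>i. h (d' i))"
      using Rc by (subst mat_diag_mult_left[of _ n n], simp, subst mat_diag_mult_right[of _ n n], simp)
        (auto intro!: eq_matI)
    have "C Q' d' = (cmat Q * cmat R) * mat_diag n (\<lambda>i. h (d' i)) * cmat (transpose_mat Q')"
      unfolding C_def using W Rc QR by (simp flip: of_real_hom.mat_hom_mult[of _ n n _ n])
    also have "\<dots> = cmat Q * (cmat R * mat_diag n (\<lambda>i. h (d' i))) * cmat (transpose_mat Q')"
      using W(6,7) W'(6,7) Rc by (simp add: assoc)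
    also have "\<dots> = cmat Q * mat_diag n (\<lambda>i. h (d i)) * (cmat R * cmat (transpose_mat Q'))"
      unfolding hR[symmetric] using W(6,7) W'(6,7) Rc by (simp add: assoc)
    also have "cmat R * cmat (transpose_mat Q') = cmat (transpose_mat Q)"
      using W' Rc RQ by (simp flip: of_real_hom.mat_hom_mult[of _ n n _ n])
    finally show ?thesis by (simp add: C_def)
  qed
  have dim: "dim_row A = n" using A by simp
  show ?thesis
    unfolding mat_fun_def dim
  proof (rule the_equality)
    show "\<exists>Q' d'. similar_mat_wit A (mat_diag n d') Q' (transpose_mat Q') \<and>
        cmat Q * mat_diag n (\<lambda>i. h (d i)) * cmat (transpose_mat Q)
      = cmat Q' * mat_diag n (\<lambda>i. h (d' i)) * cmat (transpose_mat Q')"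
      using w by blast
    show "X = cmat Q * mat_diag n (\<lambda>i. h (d i)) * cmat (transpose_mat Q)"
      if "\<exists>Q' d'. similar_mat_wit A (mat_diag n d') Q' (transpose_mat Q') \<and>
        X = cmat Q' * mat_diag n (\<lambda>i. h (d' i)) * cmat (transpose_mat Q')" for X
      using that uniq unfolding C_def by metis
  qed
qed

lemma resolvent_diag:
  assumes A: "A \<in> carrier_mat n n" "transpose_mat A = A" and w: "similar_mat_wit A (mat_diag n d) Q (transpose_mat Q)"
    and z: "Im z \<noteq> 0"
  shows "resolvent A z = cmat Q * mat_diag n (\<lambda>i. 1 / (of_real (d i) - z)) * cmat (transpose_mat Q)"
    (is "_ = ?R")
proof (rule inverse_unique_mat)
  note W = similar_mat_witD2[OF A(1) w]
  note assoc = assoc_mult_mat[of _ n n _ n _ n]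
  have cQ: "cmat Q \<in> carrier_mat n n" "cmat (transpose_mat Q) \<in> carrier_mat n n" using W by auto
  have QQ: "cmat Q * cmat (transpose_mat Q) = 1\<^sub>m n" "cmat (transpose_mat Q) * cmat Q = 1\<^sub>m n"
    using W by (simp_all add: of_real_hom.mat_hom_one flip: of_real_hom.mat_hom_mult[of _ n n _ n])
  have cD: "cmat (mat_diag n d) = mat_diag n (\<lambda>i. of_real (d i))"
    by (rule eq_matI) (auto simp: mat_diag_def)
  have cA: "cmat A = cmat Q * mat_diag n (\<lambda>i. of_real (d i)) * cmat (transpose_mat Q)"
    using W(5-7) by (subst W(3)) (simp add: of_real_hom.mat_hom_mult[of _ n n _ n] flip: cD)
  let ?M = "cmat A - z \<cdot>\<^sub>m 1\<^sub>m n" and ?D = "mat_diag n (\<lambda>i. of_real (d i) - z)"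
    and ?E = "mat_diag n (\<lambda>i. 1 / (of_real (d i) - z))"
  have M: "?M = cmat Q * ?D * cmat (transpose_mat Q)"
  proof -
    have D: "?D = mat_diag n (\<lambda>i. of_real (d i)) - z \<cdot>\<^sub>m 1\<^sub>m n"
      by (rule eq_matI) (auto simp: mat_diag_def)
    have "cmat Q * ?D = cmat Q * mat_diag n (\<lambda>i. of_real (d i)) - z \<cdot>\<^sub>m cmat Q"
      unfolding D using cQ by (subst mult_minus_distrib_mat[of _ n n _ n]) (auto simp: mult_smult_distrib[of _ n n])
    hence "cmat Q * ?D * cmat (transpose_mat Q) = cmat A - z \<cdot>\<^sub>m (cmat Q * cmat (transpose_mat Q))"
      unfolding cA using cQ
      by (simp, subst minus_mult_distrib_mat[of _ n n _ _ n]) (auto simp: mult_smult_assoc_mat[of _ n n])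
    thus ?thesis using QQ by simp
  qed
  have ne: "of_real (d i) \<noteq> z" for i using z by auto
  have DE: "?D * ?E = 1\<^sub>m n" using ne by (simp add: mat_diag_one)
  show "?M * ?R = 1\<^sub>m n"
  proof -
    have "?M * ?R = cmat Q * ?D * (cmat (transpose_mat Q) * cmat Q) * ?E * cmat (transpose_mat Q)"
      unfolding M using cQ by (simp add: assoc)
    also have "\<dots> = cmat Q * (?D * ?E) * cmat (transpose_mat Q)"
      unfolding QQ using cQ by (simp add: assoc right_mult_one_mat[of _ n n] left_mult_one_mat[of _ n n] del: mat_diag_diag)
    finally show ?thesis unfolding DE using QQ cQ by simp
  qed
  show "?M \<in> carrier_mat n n" "resolvent A z \<in> carrier_mat n n" "?R \<in> carrier_mat n n"
    "resolvent A z * ?M = 1\<^sub>m n"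
    using A resolvent_carrier[OF A z] resolvent_left[OF A z] cQ by auto
qed

lemma vnorm_orthogonal:
  assumes Q: "Q \<in> carrier_mat n n" "transpose_mat Q * Q = 1\<^sub>m n" and v: "v \<in> carrier_vec n"
  shows "vnorm (cmat Q *\<^sub>v v) = vnorm v"
proof -
  have QQ: "(\<Sum>i<n. Q $$ (i, j) * Q $$ (i, k)) = (if j = k then 1 else 0)" if "j < n" "k < n" for j k
  proof -
    have "(transpose_mat Q * Q) $$ (j, k) = (\<Sum>i<n. Q $$ (i, j) * Q $$ (i, k))"
      using that Q(1) by (simp add: scalar_prod_def lessThan_atLeast0)
    thus ?thesis using Q(2) that by simp
  qed
  have ent: "(cmat Q *\<^sub>v v) $ i = (\<Sum>j<n. of_real (Q $$ (i, j)) * v $ j)" if "i < n" for i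
    using that Q v by (auto simp: scalar_prod_def lessThan_atLeast0 intro!: sum.cong)
  have "complex_of_real (\<Sum>i<n. (cmod ((cmat Q *\<^sub>v v) $ i))\<^sup>2)
     = (\<Sum>i<n. (\<Sum>j<n. of_real (Q $$ (i, j)) * v $ j) * cnj (\<Sum>k<n. of_real (Q $$ (i, k)) * v $ k))"
    unfolding of_real_sum by (intro sum.cong refl) (auto simp: ent complex_norm_square simp del: of_real_power)
  also have "\<dots> = (\<Sum>i<n. \<Sum>j<n. \<Sum>k<n. of_real (Q $$ (i, j) * Q $$ (i, k)) * (v $ j * cnj (v $ k)))"
    by (simp add: sum_product mult_ac)
  also have "\<dots> = (\<Sum>j<n. \<Sum>i<n. \<Sum>k<n. of_real (Q $$ (i, j) * Q $$ (i, k)) * (v $ j * cnj (v $ k)))"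
    by (rule sum.swap)
  also have "\<dots> = (\<Sum>j<n. \<Sum>k<n. \<Sum>i<n. of_real (Q $$ (i, j) * Q $$ (i, k)) * (v $ j * cnj (v $ k)))"
    by (intro sum.cong refl sum.swap)
  also have "\<dots> = (\<Sum>j<n. \<Sum>k<n. of_real (\<Sum>i<n. Q $$ (i, j) * Q $$ (i, k)) * (v $ j * cnj (v $ k)))"
    by (simp add: sum_distrib_right)
  also have "\<dots> = (\<Sum>j<n. \<Sum>k<n. (if k = j then v $ j * cnj (v $ j) else 0))"
    by (intro sum.cong refl, subst QQ) auto
  also have "\<dots> = complex_of_real (\<Sum>j<n. (cmod (v $ j))\<^sup>2)"
    unfolding of_real_sum by (simp add: complex_norm_square del: of_real_power)
  finally have "(\<Sum>i<n. (cmod ((cmat Q *\<^sub>v v) $ i))\<^sup>2) = (\<Sum>j<n. (cmod (v $ j))\<^sup>2)"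
    by (simp only: of_real_eq_iff)
  thus ?thesis using Q v by (simp add: vnorm_def L2_set_def)
qed

lemma op_bounded_conjugate:
  assumes Q: "Q \<in> carrier_mat n n" "transpose_mat Q * Q = 1\<^sub>m n" "Q * transpose_mat Q = 1\<^sub>m n"
    and X: "op_bounded n c X"
  shows "op_bounded n c (cmat (transpose_mat Q) * X * cmat Q)"
proof -
  have 1: "op_bounded n 1 (cmat Q)"
    using Q vnorm_orthogonal[OF Q(1,2)] by (auto simp: op_bounded_def)
  have 2: "op_bounded n 1 (cmat (transpose_mat Q))"
    using Q vnorm_orthogonal[of "transpose_mat Q" n] by (auto simp: op_bounded_def)
  show ?thesis using op_bounded_mult[OF op_bounded_mult[OF 2 X] 1] by simp
qed

lemma trace_diag_conj:
  assumes Q: "Q \<in> carrier_mat n n" and X: "X \<in> carrier_mat n n"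
  shows "mat_trace (cmat Q * mat_diag n f * cmat (transpose_mat Q) * X)
       = (\<Sum>i<n. f i * (cmat (transpose_mat Q) * X * cmat Q) $$ (i, i))"
proof -
  note assoc = assoc_mult_mat[of _ n n _ n _ n]
  have cQ: "cmat Q \<in> carrier_mat n n" "cmat (transpose_mat Q) \<in> carrier_mat n n" using Q by auto
  let ?Y = "cmat (transpose_mat Q) * X * cmat Q"
  have Y: "?Y \<in> carrier_mat n n" using Q X by auto
  have "mat_trace (cmat Q * mat_diag n f * cmat (transpose_mat Q) * X)
      = mat_trace (cmat Q * (mat_diag n f * cmat (transpose_mat Q) * X))"
    using cQ X by (simp add: assoc)
  also have "\<dots> = mat_trace ((mat_diag n f * cmat (transpose_mat Q) * X) * cmat Q)"
    by (rule mat_trace_comm[of _ n]) (use cQ X in \<open>auto simp del: map_carrier_mat\<close>)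
  also have "\<dots> = mat_trace (mat_diag n f * ?Y)"
    using cQ X by (simp add: assoc)
  also have "\<dots> = (\<Sum>i<n. f i * ?Y $$ (i, i))"
    by (subst mat_diag_mult_left[OF Y]) (simp add: mat_trace_def)
  finally show ?thesis .
qed

lemma sym_eigvals_diag:
  assumes A: "A \<in> carrier_mat n n" and w: "similar_mat_wit A (mat_diag n d) Q (transpose_mat Q)"
  shows "mset (sym_eigvals A) = image_mset d (mset [0..<n])"
    "i < n \<Longrightarrow> eigenvalue A (d i)"
proof -
  have sim: "similar_mat A (mat_diag n d)" using w by (auto simp: similar_mat_def)
  have cp: "char_poly A = (\<Prod>a\<leftarrow>map d [0..<n]. [:- a, 1:])"
  proof -
    have "char_poly A = char_poly (mat_diag n d)" by (rule char_poly_similar[OF sim])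
    also have "\<dots> = (\<Prod>a\<leftarrow>diag_mat (mat_diag n d). [:- a, 1:])"
      by (rule char_poly_upper_triangular[of _ n]) (auto simp: mat_diag_def upper_triangular_def)
    also have "diag_mat (mat_diag n d) = map d [0..<n]"
      by (auto simp: diag_mat_def mat_diag_def)
    finally show ?thesis .
  qed
  have pr: "proots (\<Prod>a\<leftarrow>xs. [:- a, 1:]) = mset xs" for xs :: "real list"
  proof (induction xs)
    case (Cons x xs)
    have "(\<Prod>a\<leftarrow>xs. [:- a, 1:]) \<noteq> 0" by (subst prod_list_zero_iff) auto
    thus ?case using Cons by (simp add: proots_mult del: mult_pCons_left)
  qed simp
  show "mset (sym_eigvals A) = image_mset d (mset [0..<n])"
    by (simp add: sym_eigvals_def cp pr del: mset_upt map_map prod_list.Cons)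
  show "eigenvalue A (d i)" if "i < n"
    unfolding eigenvalue_root_char_poly[OF A] cp using that
    by (auto simp: poly_prod_list prod_list_zero_iff o_def)
qed

lemma esd_prob:
  assumes "A \<in> carrier_mat n n" "n > 0" shows "real_distribution (esd A)"
proof -
  have [simp]: "dim_row A = n" using assms by simp
  interpret prob_space "uniform_count_measure {..<n}"
    using assms by (intro prob_space_uniform_count_measure) auto
  show ?thesis unfolding esd_def by (auto intro!: real_distribution_distr)
qed

lemma esd_integral:
  fixes f :: "real \<Rightarrow> complex"
  assumes A: "A \<in> carrier_mat n n" and w: "similar_mat_wit A (mat_diag n d) Q (transpose_mat Q)"
    and f: "f \<in> borel_measurable borel"
  shows "(\<integral>x. f x \<partial>esd A) = (\<Sum>i<n. f (d i)) / n"
proof -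
  have dim: "dim_row A = n" using A by simp
  have len: "length (sym_eigvals A) = n"
    using arg_cong[OF sym_eigvals_diag(1)[OF A w], of size] by simp
  have "(\<integral>x. f x \<partial>esd A) = (\<integral>k. f (sym_eigvals A ! k) \<partial>uniform_count_measure {..<n})"
    unfolding esd_def dim by (rule integral_distr) (use f in \<open>auto simp: uniform_count_measure_def\<close>)
  also have "\<dots> = (\<Sum>k<n. f (sym_eigvals A ! k)) / n"
    by (simp add: uniform_count_measure_def lebesgue_integral_point_measure_finite scaleR_conv_of_real sum_divide_distrib)
  also have "(\<Sum>k<n. f (sym_eigvals A ! k)) = sum_list (map f (sym_eigvals A))"
    by (simp add: sum_list_sum_nth len lessThan_atLeast0)
  also have "\<dots> = sum_mset (image_mset f (mset (sym_eigvals A)))"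
    by (metis mset_map sum_mset_sum_list)
  also have "\<dots> = (\<Sum>i<n. f (d i))"
    unfolding sym_eigvals_diag(1)[OF A w] by (simp add: sum_unfold_sum_mset lessThan_atLeast0 image_mset.compositionality o_def)
  finally show ?thesis .
qed

section \<open>Functions of independent random variables\<close>

lemma (in prob_space) integrable_bounded:
  fixes f :: "'a \<Rightarrow> 'b::{banach, second_countable_topology}"
  assumes "f \<in> borel_measurable M" "\<And>x. norm (f x) \<le> K"
  shows "integrable M f"
  by (rule integrable_const_bound[of _ K]) (use assms in auto)

text \<open>The mixed term \<open>4 a b\<^sup>3\<close> is absorbed by \<open>2 a\<^sup>2 b\<^sup>2 + 2 b\<^sup>4\<close>, so that only the term linear in \<open>b\<close>,
  which will average to zero, has an uncontrolled sign.\<close>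

lemma fourth_power_add_le: "(a + b :: real) ^ 4 \<le> a ^ 4 + 4 * a ^ 3 * b + 8 * a\<^sup>2 * b\<^sup>2 + 3 * b ^ 4"
proof -
  have "0 \<le> 2 * (b * (a - b))\<^sup>2" by simp
  thus ?thesis by (simp add: algebra_simps power2_eq_square power3_eq_cube power4_eq_xxxx)
qed

lemma abs_le_one_plus_pow4: "\<bar>x\<bar> \<le> 1 + (x :: real) ^ 4"
proof (cases "\<bar>x\<bar> \<le> 1")
  case True
  moreover have "0 \<le> x ^ 4" by (rule zero_le_even_power) simp
  ultimately show ?thesis by linarith
next
  case False
  hence "\<bar>x\<bar> ^ 1 \<le> \<bar>x\<bar> ^ 4" by (intro power_increasing) auto
  thus ?thesis by simp
qed

lemma one_plus_pow4: "(1 + \<bar>x\<bar>) ^ 4 \<le> 8 + (x :: real) ^ 4 * 8"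
proof -
  have *: "(a + b)\<^sup>2 \<le> 2 * a\<^sup>2 + 2 * b\<^sup>2" for a b :: real
    using sum_squares_bound[of a b] by (simp add: power2_sum)
  have "((1 + \<bar>x\<bar>)\<^sup>2)\<^sup>2 \<le> (2 + 2 * x\<^sup>2)\<^sup>2"
    using *[of 1 "\<bar>x\<bar>"] by (intro power_mono) auto
  also have "\<dots> \<le> 2 * 2\<^sup>2 + 2 * (2 * x\<^sup>2)\<^sup>2" by (rule *)
  finally show ?thesis by (simp add: power_mult_distrib flip: power_mult)
qed

lemma integral_norm_bound_integral':
  fixes f :: "'a \<Rightarrow> 'b::{banach, second_countable_topology}"
  assumes "integrable M g" "\<And>x. x \<in> space M \<Longrightarrow> norm (f x) \<le> g x"
  shows "norm (\<integral>x. f x \<partial>M) \<le> (\<integral>x. g x \<partial>M)"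
proof (cases "integrable M f")
  case True
  have "norm (\<integral>x. f x \<partial>M) \<le> (\<integral>x. norm (f x) \<partial>M)" by (rule integral_norm_bound)
  also have "\<dots> \<le> (\<integral>x. g x \<partial>M)"
    by (rule Bochner_Integration.integral_mono) (use True assms in auto)
  finally show ?thesis .
next
  case False
  have "0 \<le> (\<integral>x. g x \<partial>M)"
  proof (rule Bochner_Integration.integral_nonneg)
    show "0 \<le> g x" if "x \<in> space M" for x
      using assms(2)[OF that] norm_ge_zero[of "f x"] by linarith
  qed
  thus ?thesis using False by (simp add: not_integrable_integral_eq)
qed

lemma measurable_coordinate_update:
  assumes "f \<in> measurable (PiM (insert i I) (\<lambda>_. \<nu>)) N" "x \<in> space (PiM I (\<lambda>_. \<nu>))"
  shows "(\<lambda>y. f (x(i := y))) \<in> measurable \<nu> N"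
  using measurable_comp[OF measurable_comp[OF measurable_Pair1'[OF assms(2)] measurable_add_dim] assms(1)]
  by (simp add: o_def)

text \<open>A function with Lipschitz constant \<open>L\<close> in each of \<open>N\<close> independent variables has variance
  \<open>O(N L\<^sup>2)\<close> and fourth central moment \<open>O(N\<^sup>2 L\<^sup>4)\<close>: this is the martingale bound in inductive form.
  Averaging over the new variable gives a function \<open>g\<close> of the old ones, and the increment \<open>f - g\<close>
  has conditional mean zero and conditional moments bounded by those of \<open>L (\<bar>y\<bar> + E\<bar>y\<bar>)\<close>. The
  recursion for the fourth moment uses the one for the variance. Exponential
  inequalities would ask for bounded variables; this one asks for four moments.\<close>

lemma coordinate_lipschitz_moments:
  fixes \<nu> :: "real measure" and f :: "('i \<Rightarrow> real) \<Rightarrow> real" and c2 c4 :: real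
  assumes \<nu>: "real_distribution \<nu>" and m4: "integrable \<nu> (\<lambda>x. x ^ 4)" and L0: "0 \<le> L"
    and "finite I" and f: "f \<in> borel_measurable (PiM I (\<lambda>_. \<nu>))"
    and bdd: "\<And>x. \<bar>f x\<bar> \<le> K"
    and lip: "\<And>x i y. i \<in> I \<Longrightarrow> x \<in> space (PiM I (\<lambda>_. \<nu>)) \<Longrightarrow> \<bar>f (x(i := y)) - f x\<bar> \<le> L * \<bar>y - x i\<bar>"
  defines "c2 \<equiv> (\<integral>y. (\<bar>y\<bar> + (\<integral>x. \<bar>x\<bar> \<partial>\<nu>))\<^sup>2 \<partial>\<nu>)"
    and "c4 \<equiv> (\<integral>y. (\<bar>y\<bar> + (\<integral>x. \<bar>x\<bar> \<partial>\<nu>)) ^ 4 \<partial>\<nu>)"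
  shows "(\<integral>x. (f x - (\<integral>x. f x \<partial>PiM I (\<lambda>_. \<nu>)))\<^sup>2 \<partial>PiM I (\<lambda>_. \<nu>)) \<le> card I * (L\<^sup>2 * c2) \<and>
    (\<integral>x. (f x - (\<integral>x. f x \<partial>PiM I (\<lambda>_. \<nu>))) ^ 4 \<partial>PiM I (\<lambda>_. \<nu>))
      \<le> (card I)\<^sup>2 * (L ^ 4 * (4 * c2\<^sup>2 + 3 * c4))"
  using \<open>finite I\<close> f bdd lip
proof (induction I arbitrary: f rule: finite_induct)
  case empty
  have sp: "space (PiM {} (\<lambda>_. \<nu>)) = {\<lambda>_. undefined}" by (simp add: space_PiM)
  interpret E: prob_space "PiM {} (\<lambda>_::'i. \<nu>)"
    using \<nu> by (intro prob_space_PiM) (simp add: real_distribution_def)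
  have c: "(\<integral>x. h x \<partial>PiM {} (\<lambda>_. \<nu>)) = h (\<lambda>_. undefined)" for h :: "('i \<Rightarrow> real) \<Rightarrow> real"
  proof -
    have "(\<integral>x. h x \<partial>PiM {} (\<lambda>_. \<nu>)) = (\<integral>x. h (\<lambda>_. undefined) \<partial>PiM {} (\<lambda>_::'i. \<nu>))"
      by (intro Bochner_Integration.integral_cong) (auto simp: sp)
    thus ?thesis by (simp add: E.prob_space)
  qed
  show ?case by (simp add: c)
next
  case (insert i I)
  interpret N: real_distribution \<nu> by (rule \<nu>)
  interpret S: product_sigma_finite "\<lambda>_::'i. \<nu>" ..
  define P where "P = PiM I (\<lambda>_::'i. \<nu>)"
  define Q where "Q = PiM (insert i I) (\<lambda>_::'i. \<nu>)"
  interpret P: prob_space P unfolding P_def by (intro prob_space_PiM N.prob_space_axioms)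
  interpret Q: prob_space Q unfolding Q_def by (intro prob_space_PiM N.prob_space_axioms)
  have [simp]: "measure \<nu> UNIV = 1" using N.prob_space by simp
  have fm[measurable]: "f \<in> borel_measurable Q" using insert.prems(1) by (simp add: Q_def)
  have upd: "(\<lambda>y. f (x(i := y))) \<in> borel_measurable \<nu>" if "x \<in> space P" for x
    using measurable_coordinate_update[of f i I \<nu> borel x] that fm by (simp add: P_def Q_def)
  have updi: "integrable \<nu> (\<lambda>y. f (x(i := y)))" if "x \<in> space P" for x
    using upd[OF that] insert.prems(2) by (intro N.integrable_bounded) auto
  have xi: "x(i := t) \<in> space Q" if "x \<in> space P" for x t
    using that by (auto simp: P_def Q_def space_PiM PiE_def extensional_def)
  define g where "g x = (\<integral>y. f (x(i := y)) \<partial>\<nu>)" for x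
  have gm[measurable]: "g \<in> borel_measurable P"
  proof -
    have "(\<lambda>(x, y). f (x(i := y))) = f \<circ> (\<lambda>(x, y). x(i := y))" by auto
    moreover have "f \<circ> (\<lambda>(x, y). x(i := y)) \<in> borel_measurable (P \<Otimes>\<^sub>M \<nu>)"
      using measurable_comp[OF measurable_add_dim[of i I "\<lambda>_. \<nu>"] insert.prems(1)] by (simp add: P_def)
    ultimately show ?thesis unfolding g_def by (intro N.borel_measurable_lebesgue_integral) auto
  qed
  have gb: "\<bar>g x\<bar> \<le> K" for x
  proof -
    have "norm (\<integral>y. f (x(i := y)) \<partial>\<nu>) \<le> (\<integral>y. K \<partial>\<nu>)"
      by (rule integral_norm_bound_integral') (use insert.prems(2) in auto)
    thus ?thesis by (simp add: g_def N.prob_space)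
  qed
  define e where "e = (\<integral>x. f x \<partial>Q)"
  have eg: "e = (\<integral>x. g x \<partial>P)"
    unfolding e_def g_def P_def Q_def
    by (rule S.product_integral_insert) (use insert Q.integrable_bounded[OF fm, of K] in \<open>auto simp: Q_def\<close>)
  define d2 where "d2 = L\<^sup>2 * c2"
  define d4 where "d4 = L ^ 4 * c4"
  have glip: "\<bar>g (x(j := y)) - g x\<bar> \<le> L * \<bar>y - x j\<bar>" if "j \<in> I" "x \<in> space P" for x j y
  proof -
    have xj: "x(j := y) \<in> space P" using that by (auto simp: P_def space_PiM PiE_def extensional_def)
    have "g (x(j := y)) - g x = (\<integral>t. f (x(j := y, i := t)) - f (x(i := t)) \<partial>\<nu>)"
      unfolding g_def using updi[OF xj] updi[OF that(2)] by simp
    also have "norm \<dots> \<le> (\<integral>t. L * \<bar>y - x j\<bar> \<partial>\<nu>)"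
    proof (rule integral_norm_bound_integral')
      fix t
      have "j \<noteq> i" using that insert.hyps by auto
      hence eq: "x(j := y, i := t) = (x(i := t))(j := y)" "(x(i := t)) j = x j"
        by (auto simp: fun_upd_twist)
      have "\<bar>f ((x(i := t))(j := y)) - f (x(i := t))\<bar> \<le> L * \<bar>y - (x(i := t)) j\<bar>"
        by (rule insert.prems(3)[OF _ xi[OF that(2), unfolded Q_def]]) (use that in auto)
      thus "norm (f (x(j := y, i := t)) - f (x(i := t))) \<le> L * \<bar>y - x j\<bar>"
        unfolding eq real_norm_def .
    qed auto
    finally show ?thesis by (simp add: N.prob_space)
  qed
  define a where "a = (\<integral>x. \<bar>x\<bar> \<partial>\<nu>)"
  have i1: "integrable \<nu> (\<lambda>x. \<bar>x\<bar>)"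
    by (rule Bochner_Integration.integrable_bound[of _ "\<lambda>x. 1 + x ^ 4"]) (use m4 abs_le_one_plus_pow4 in auto)
  have icb: "integrable \<nu> (\<lambda>x. (\<bar>x\<bar> + a) ^ k)" if "k \<le> 4" for k
  proof (rule Bochner_Integration.integrable_bound[of _ "\<lambda>x. (1 + a) ^ 4 * (8 + x ^ 4 * 8)"])
    show "integrable \<nu> (\<lambda>x. (1 + a) ^ 4 * (8 + x ^ 4 * 8))" using m4 by auto
    have a0: "a \<ge> 0" by (simp add: a_def)
    have "(\<bar>x\<bar> + a) ^ k \<le> (1 + a) ^ 4 * (8 + x ^ 4 * 8)" for x
    proof -
      have "(\<bar>x\<bar> + a) ^ k \<le> ((1 + a) * (1 + \<bar>x\<bar>)) ^ k"
        using a0 by (intro power_mono) (auto simp: algebra_simps)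
      also have "\<dots> \<le> ((1 + a) * (1 + \<bar>x\<bar>)) ^ 4"
        using a0 that by (intro power_increasing) (auto simp: algebra_simps)
      also have "\<dots> = (1 + a) ^ 4 * (1 + \<bar>x\<bar>) ^ 4" by (simp add: power_mult_distrib)
      also have "(1 + a) ^ 4 * (1 + \<bar>x\<bar>) ^ 4 \<le> (1 + a) ^ 4 * (8 + x ^ 4 * 8)"
        using one_plus_pow4[of x] a0 by (intro mult_left_mono) auto
      finally show ?thesis .
    qed
    thus "AE x in \<nu>. norm ((\<bar>x\<bar> + a) ^ k) \<le> norm ((1 + a) ^ 4 * (8 + x ^ 4 * 8))"
      using a0 by (intro AE_I2) (simp add: abs_mult)
  qed auto
  have fD: "\<bar>f (x(i := y)) - g x\<bar> \<le> L * (\<bar>y\<bar> + a)" if "x \<in> space P" for x y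
  proof -
    have "f (x(i := y)) - g x = (\<integral>t. f (x(i := y)) - f (x(i := t)) \<partial>\<nu>)"
      using updi[OF that] by (simp add: g_def N.prob_space)
    also have "norm \<dots> \<le> (\<integral>t. L * (\<bar>y\<bar> + \<bar>t\<bar>) \<partial>\<nu>)"
    proof (rule integral_norm_bound_integral')
      fix t
      have "\<bar>f ((x(i := t))(i := y)) - f (x(i := t))\<bar> \<le> L * \<bar>y - (x(i := t)) i\<bar>"
        by (rule insert.prems(3)[OF _ xi[OF that, unfolded Q_def]]) auto
      also have "\<dots> = L * \<bar>y - t\<bar>" by simp
      also have "\<dots> \<le> L * (\<bar>y\<bar> + \<bar>t\<bar>)" by (intro mult_left_mono L0) auto
      finally show "norm (f (x(i := y)) - f (x(i := t))) \<le> L * (\<bar>y\<bar> + \<bar>t\<bar>)" by simp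
    qed (use i1 in auto)
    also have "\<dots> = L * (\<bar>y\<bar> + a)" using i1 by (simp add: N.prob_space a_def)
    finally show ?thesis by simp
  qed
  have Dk: "(\<integral>y. (f (x(i := y)) - g x) ^ k \<partial>\<nu>) \<le> L ^ k * (\<integral>y. (\<bar>y\<bar> + a) ^ k \<partial>\<nu>)"
    if "x \<in> space P" "k \<le> 4" "even k" for x k
  proof -
    have "(\<integral>y. (f (x(i := y)) - g x) ^ k \<partial>\<nu>) \<le> (\<integral>y. L ^ k * (\<bar>y\<bar> + a) ^ k \<partial>\<nu>)"
    proof (rule integral_mono')
      show "integrable \<nu> (\<lambda>y. L ^ k * (\<bar>y\<bar> + a) ^ k)" using icb[OF that(2)] by simp
      show "(f (x(i := y)) - g x) ^ k \<le> L ^ k * (\<bar>y\<bar> + a) ^ k" for y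
        using power_mono[OF fD[OF that(1), of y], of k] \<open>even k\<close>
        by (simp add: power_even_abs power_mult_distrib)
      show "0 \<le> L ^ k * (\<bar>y\<bar> + a) ^ k" for y using L0 by (simp add: a_def)
    qed
    thus ?thesis by simp
  qed
  let ?D = "\<lambda>x y. f (x(i := y)) - g x"
  have D2: "(\<integral>y. (?D x y)\<^sup>2 \<partial>\<nu>) \<le> d2" if "x \<in> space P" for x
    using Dk[OF that, of 2] by (simp add: d2_def c2_def a_def)
  have D4: "(\<integral>y. (?D x y) ^ 4 \<partial>\<nu>) \<le> d4" if "x \<in> space P" for x
    using Dk[OF that, of 4] by (simp add: d4_def c4_def a_def)
  have iD: "integrable \<nu> (\<lambda>y. (?D x y) ^ k)" if "x \<in> space P" for x k
  proof (rule N.integrable_bounded[of _ "(2 * K) ^ k"])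
    show "norm ((?D x y) ^ k) \<le> (2 * K) ^ k" for y
    proof -
      have "\<bar>f (x(i := y))\<bar> \<le> K" by (rule insert.prems(2))
      hence "\<bar>f (x(i := y)) - g x\<bar> \<le> 2 * K" using gb[of x] by linarith
      thus ?thesis unfolding norm_power by (intro power_mono) auto
    qed
  qed (use upd[OF that] in auto)
  have D1: "(\<integral>y. ?D x y \<partial>\<nu>) = 0" if "x \<in> space P" for x
    using updi[OF that] by (simp add: N.prob_space g_def)
  have bd: "\<bar>e\<bar> \<le> K"
  proof -
    have "norm e \<le> (\<integral>x. K \<partial>Q)" unfolding e_def
      by (rule integral_norm_bound_integral')
         (use insert.prems(2) in auto)
    thus ?thesis by (simp add: Q.prob_space)
  qed
  have split: "(\<integral>x. (f x - e) ^ k \<partial>Q) = (\<integral>x. (\<integral>y. (f (x(i := y)) - e) ^ k \<partial>\<nu>) \<partial>P)" for k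
    unfolding P_def Q_def
  proof (rule S.product_integral_insert)
    have "integrable Q (\<lambda>x. (f x - e) ^ k)"
    proof (rule Q.integrable_bounded[of _ "(2 * K) ^ k"])
      show "norm ((f x - e) ^ k) \<le> (2 * K) ^ k" for x
        unfolding norm_power using insert.prems(2)[of x] bd by (intro power_mono) auto
    qed simp
    thus "integrable (PiM (insert i I) (\<lambda>_. \<nu>)) (\<lambda>x. (f x - e) ^ k)" by (simp add: Q_def)
  qed (use insert in auto)
  have ige: "integrable P (\<lambda>x. (g x - e) ^ k)" for k
  proof (rule P.integrable_bounded[of _ "(2 * K) ^ k"])
    show "norm ((g x - e) ^ k) \<le> (2 * K) ^ k" for x
      unfolding norm_power using gb[of x] bd by (intro power_mono) auto
  qed simp
  have d_eq: "L ^ 4 * (4 * c2\<^sup>2 + 3 * c4) = 4 * d2\<^sup>2 + 3 * d4"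
    by (simp add: d2_def d4_def power_mult_distrib distrib_left flip: power_mult)
  have IH: "(\<integral>x. (g x - e)\<^sup>2 \<partial>P) \<le> card I * d2"
      "(\<integral>x. (g x - e) ^ 4 \<partial>P) \<le> (card I)\<^sup>2 * (4 * d2\<^sup>2 + 3 * d4)"
    using insert.IH[OF gm[unfolded P_def] gb glip[unfolded P_def]]
    unfolding eg d_eq[symmetric] unfolding P_def d2_def by blast+
  (* The cross terms integrate to zero by D1. *)
  have two: "(\<integral>x. (f x - e)\<^sup>2 \<partial>Q) \<le> (real (card I) + 1) * d2"
  proof -
    have "(\<integral>x. (f x - e)\<^sup>2 \<partial>Q) \<le> (\<integral>x. (g x - e)\<^sup>2 + d2 \<partial>P)"
      unfolding split
    proof (rule integral_mono')
      fix x assume x: "x \<in> space P"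
      have "(\<integral>y. (f (x(i := y)) - e)\<^sup>2 \<partial>\<nu>)
          = (\<integral>y. (g x - e)\<^sup>2 + 2 * (g x - e) * (?D x y) + (?D x y)\<^sup>2 \<partial>\<nu>)"
        by (intro Bochner_Integration.integral_cong refl) (simp add: power2_eq_square algebra_simps)
      also have "\<dots> = (g x - e)\<^sup>2 + (\<integral>y. (?D x y)\<^sup>2 \<partial>\<nu>)"
        using iD[OF x, of 1] iD[OF x, of 2] D1[OF x] by (simp add: N.prob_space)
      finally show "(\<integral>y. (f (x(i := y)) - e)\<^sup>2 \<partial>\<nu>) \<le> (g x - e)\<^sup>2 + d2"
        using D2[OF x] by simp
      show "0 \<le> (g x - e)\<^sup>2 + d2" by (simp add: d2_def c2_def)
    qed (use ige[of 2] in auto)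
    also have "\<dots> = (\<integral>x. (g x - e)\<^sup>2 \<partial>P) + d2" using ige[of 2] by (simp add: P.prob_space)
    finally show ?thesis using IH(1) by (simp add: algebra_simps)
  qed
  have c40: "c4 \<ge> 0" by (simp add: c4_def)
  have d40: "d4 \<ge> 0" using c40 by (simp add: d4_def)
  have d20: "d2 \<ge> 0" by (simp add: d2_def c2_def)
  have four: "(\<integral>x. (f x - e) ^ 4 \<partial>Q) \<le> (real (card I) + 1)\<^sup>2 * (4 * d2\<^sup>2 + 3 * d4)"
  proof -
    have "(\<integral>x. (f x - e) ^ 4 \<partial>Q) \<le> (\<integral>x. (g x - e) ^ 4 + 8 * (g x - e)\<^sup>2 * d2 + 3 * d4 \<partial>P)"
      unfolding split
    proof (rule integral_mono')
      fix x assume x: "x \<in> space P"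
      have "(\<integral>y. (f (x(i := y)) - e) ^ 4 \<partial>\<nu>)
          \<le> (\<integral>y. (g x - e) ^ 4 + 4 * (g x - e) ^ 3 * (?D x y)
               + 8 * (g x - e)\<^sup>2 * (?D x y)\<^sup>2 + 3 * (?D x y) ^ 4 \<partial>\<nu>)"
      proof (rule integral_mono')
        show "(f (x(i := y)) - e) ^ 4 \<le> (g x - e) ^ 4 + 4 * (g x - e) ^ 3 * (?D x y)
               + 8 * (g x - e)\<^sup>2 * (?D x y)\<^sup>2 + 3 * (?D x y) ^ 4" for y
          using fourth_power_add_le[of "g x - e" "?D x y"] by simp
        thus "0 \<le> (g x - e) ^ 4 + 4 * (g x - e) ^ 3 * (?D x y)
               + 8 * (g x - e)\<^sup>2 * (?D x y)\<^sup>2 + 3 * (?D x y) ^ 4" for y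
          by (rule order_trans[rotated]) simp
      qed (use iD[OF x, of 1] iD[OF x, of 2] iD[OF x, of 4] in auto)
      also have "\<dots> = (g x - e) ^ 4 + 8 * (g x - e)\<^sup>2 * (\<integral>y. (?D x y)\<^sup>2 \<partial>\<nu>)
          + 3 * (\<integral>y. (?D x y) ^ 4 \<partial>\<nu>)"
        using iD[OF x, of 1] iD[OF x, of 2] iD[OF x, of 4] D1[OF x] by (simp add: N.prob_space)
      also have "\<dots> \<le> (g x - e) ^ 4 + 8 * (g x - e)\<^sup>2 * d2 + 3 * d4"
        using D2[OF x] D4[OF x] by (intro add_mono mult_left_mono) auto
      finally show "(\<integral>y. (f (x(i := y)) - e) ^ 4 \<partial>\<nu>) \<le> (g x - e) ^ 4 + 8 * (g x - e)\<^sup>2 * d2 + 3 * d4" .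
      show "0 \<le> (g x - e) ^ 4 + 8 * (g x - e)\<^sup>2 * d2 + 3 * d4" using d20 d40 by simp
    qed (use ige[of 2] ige[of 4] in auto)
    also have "\<dots> = (\<integral>x. (g x - e) ^ 4 \<partial>P) + 8 * d2 * (\<integral>x. (g x - e)\<^sup>2 \<partial>P) + 3 * d4"
      using ige[of 2] ige[of 4] by (simp add: P.prob_space mult_ac)
    also have "\<dots> \<le> (card I)\<^sup>2 * (4 * d2\<^sup>2 + 3 * d4) + 8 * d2 * (card I * d2) + 3 * d4"
      using IH d20 by (intro add_mono mult_left_mono) auto
    also have "\<dots> \<le> (real (card I) + 1)\<^sup>2 * (4 * d2\<^sup>2 + 3 * d4)"
      using d40 by (simp add: power2_eq_square algebra_simps)
    finally show ?thesis .
  qed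
  have "card (insert i I) = card I + 1" using insert.hyps by simp
  hence ci: "real (card (insert i I)) = real (card I) + 1" by simp
  show ?case using two four unfolding d_eq d2_def[symmetric] of_nat_power ci e_def[symmetric] Q_def[symmetric]
    by simp
qed

text \<open>The substitute for Gaussian integration by parts: for a centred variable \<open>y\<close> of unit variance,
  \<open>E[y \<phi>(y)]\<close> and \<open>E[\<phi>'(y)]\<close> both equal \<open>\<phi>'(0)\<close> up to a remainder controlled by \<open>\<phi>''\<close> and the third
  absolute moment. Here \<open>\<psi>\<close> plays the role of the partial derivative of \<open>\<phi>\<close> in the coordinate \<open>i\<close>;
  only the two Taylor estimates at \<open>0\<close> enter, which for resolvents are algebraic identities.\<close>

lemma stein_coordinate:
  fixes \<nu> :: "real measure" and \<phi> \<psi> :: "('i \<Rightarrow> real) \<Rightarrow> complex"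
  assumes \<nu>: "real_distribution \<nu>" and m3: "integrable \<nu> (\<lambda>x. x ^ 4)"
    and mean: "(\<integral>x. x \<partial>\<nu>) = 0" and var: "(\<integral>x. x\<^sup>2 \<partial>\<nu>) = 1"
    and I: "finite I" "i \<in> I"
    and m: "\<phi> \<in> borel_measurable (PiM I (\<lambda>_. \<nu>))" "\<psi> \<in> borel_measurable (PiM I (\<lambda>_. \<nu>))"
    and bdd: "\<And>x. cmod (\<phi> x) \<le> C" "\<And>x. cmod (\<psi> x) \<le> C"
    and e1: "\<And>x y. cmod (\<phi> (x(i := y)) - \<phi> (x(i := 0)) - of_real y * \<psi> (x(i := 0))) \<le> K * y\<^sup>2"
    and e2: "\<And>x y. cmod (\<psi> (x(i := y)) - \<psi> (x(i := 0))) \<le> K * \<bar>y\<bar>"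
  shows "integrable (PiM I (\<lambda>_. \<nu>)) (\<lambda>x. of_real (x i) * \<phi> x - \<psi> x)"
    "cmod (\<integral>x. of_real (x i) * \<phi> x - \<psi> x \<partial>PiM I (\<lambda>_. \<nu>)) \<le> K * (\<integral>y. \<bar>y\<bar> ^ 3 + \<bar>y\<bar> \<partial>\<nu>)"
proof -
  interpret N: real_distribution \<nu> by (rule \<nu>)
  interpret S: product_sigma_finite "\<lambda>_::'i. \<nu>" ..
  have [simp]: "measure \<nu> UNIV = 1" using N.prob_space by simp
  interpret SP: product_prob_space "\<lambda>_::'i. \<nu>" I ..
  define J where "J = I - {i}"
  have IJ: "I = insert i J" "i \<notin> J" "finite J" using I by (auto simp: J_def)
  define P where "P = PiM J (\<lambda>_::'i. \<nu>)"
  define Q where "Q = PiM I (\<lambda>_::'i. \<nu>)"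
  interpret P: prob_space P unfolding P_def by (intro prob_space_PiM N.prob_space_axioms)
  interpret Q: prob_space Q unfolding Q_def by (intro prob_space_PiM N.prob_space_axioms)
  note [measurable] = m[folded Q_def]
  have pk: "\<bar>x\<bar> ^ k \<le> 1 + x ^ 4" if "k \<le> 4" for x :: real and k
  proof (cases "\<bar>x\<bar> \<le> 1")
    case True
    have "\<bar>x\<bar> ^ k \<le> 1" using True by (intro power_le_one) auto
    moreover have "0 \<le> x ^ 4" by (rule zero_le_even_power) simp
    ultimately show ?thesis by linarith
  next
    case False
    hence "\<bar>x\<bar> ^ k \<le> \<bar>x\<bar> ^ 4" using that by (intro power_increasing) auto
    thus ?thesis by simp
  qed
  have ik: "integrable \<nu> (\<lambda>x. \<bar>x\<bar> ^ k)" if "k \<le> 4" for k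
    by (rule Bochner_Integration.integrable_bound[of _ "\<lambda>x. 1 + x ^ 4"]) (use m3 pk[OF that] in \<open>auto\<close>)
  have i1: "integrable \<nu> (\<lambda>x. x)"
    by (rule Bochner_Integration.integrable_bound[OF ik[of 1]]) auto
  have i2: "integrable \<nu> (\<lambda>x. x\<^sup>2)" using ik[of 2] by simp
  have xi[measurable]: "(\<lambda>x. x i) \<in> borel_measurable Q"
    unfolding Q_def using I by (simp add: measurable_component_singleton cong: measurable_cong_sets)
  have dQ: "distr Q \<nu> (\<lambda>x. x i) = \<nu>" unfolding Q_def using I by (intro SP.PiM_component)
  have ixi: "integrable Q (\<lambda>x. x i)"
  proof -
    have "integrable (distr Q \<nu> (\<lambda>x. x i)) (\<lambda>x. x)" unfolding dQ by (rule i1)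
    thus ?thesis by (subst (asm) integrable_distr_eq) (auto simp: measurable_cong_sets[OF refl N.events_eq_borel])
  qed
  have C0: "C \<ge> 0" using bdd(1)[of undefined] norm_ge_zero[of "\<phi> undefined"] by linarith
  show int: "integrable (PiM I (\<lambda>_. \<nu>)) (\<lambda>x. of_real (x i) * \<phi> x - \<psi> x)"
    unfolding Q_def[symmetric]
  proof (intro Bochner_Integration.integrable_diff)
    show "integrable Q (\<lambda>x. complex_of_real (x i) * \<phi> x)"
    proof (rule Bochner_Integration.integrable_bound[of _ "\<lambda>x. C * x i"])
      show "AE x in Q. norm (complex_of_real (x i) * \<phi> x) \<le> norm (C * x i)"
        using bdd(1) C0 by (intro AE_I2) (auto simp: norm_mult abs_mult mult.commute[of C] intro!: mult_left_mono)
    qed (use ixi in auto)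
    show "integrable Q \<psi>" using bdd(2) by (intro Q.integrable_bounded) auto
  qed
  have "(\<integral>x. of_real (x i) * \<phi> x - \<psi> x \<partial>PiM I (\<lambda>_. \<nu>))
      = (\<integral>x. (\<integral>y. of_real y * \<phi> (x(i := y)) - \<psi> (x(i := y)) \<partial>\<nu>) \<partial>P)"
    unfolding P_def IJ(1) using S.product_integral_insert[OF IJ(3,2) int[unfolded IJ(1)]] by simp
  also have "cmod \<dots> \<le> (\<integral>x. K * (\<integral>y. \<bar>y\<bar> ^ 3 + \<bar>y\<bar> \<partial>\<nu>) \<partial>P)"
  proof (rule integral_norm_bound_integral')
    fix x assume x: "x \<in> space P"
    have mp: "(\<lambda>y. \<phi> (x(i := y))) \<in> borel_measurable \<nu>" "(\<lambda>y. \<psi> (x(i := y))) \<in> borel_measurable \<nu>"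
      using measurable_coordinate_update[of _ i J \<nu> borel x] x m by (simp_all add: P_def IJ(1)[symmetric])
    have ip: "integrable \<nu> (\<lambda>y. \<psi> (x(i := y)))"
      using mp bdd by (intro N.integrable_bounded) auto
    have iyp: "integrable \<nu> (\<lambda>y. of_real y * \<phi> (x(i := y)))"
    proof (rule Bochner_Integration.integrable_bound[of _ "\<lambda>y. C * y"])
      show "AE y in \<nu>. norm (complex_of_real y * \<phi> (x(i := y))) \<le> norm (C * y)"
        using bdd(1) C0 by (intro AE_I2) (auto simp: norm_mult abs_mult mult.commute[of C] intro!: mult_left_mono)
      show "(\<lambda>y. complex_of_real y * \<phi> (x(i := y))) \<in> borel_measurable \<nu>"
        by (rule borel_measurable_times[OF _ mp(1)]) simp
      show "integrable \<nu> (\<lambda>y. C * y)" using i1 by simp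
    qed
    define p where "p = \<phi> (x(i := 0))"
    define q where "q = \<psi> (x(i := 0))"
    have "(\<integral>y. of_real y * \<phi> (x(i := y)) - \<psi> (x(i := y)) \<partial>\<nu>)
       = (\<integral>y. of_real y * \<phi> (x(i := y)) - \<psi> (x(i := y)) - of_real y * p - of_real (y\<^sup>2) * q + q \<partial>\<nu>)"
    proof -
      have I1: "integrable \<nu> (\<lambda>y. of_real y * p)" "(\<integral>y. of_real y * p \<partial>\<nu>) = 0"
        using i1 mean by auto
      have I2: "integrable \<nu> (\<lambda>y. of_real (y\<^sup>2) * q)" "(\<integral>y. of_real (y\<^sup>2) * q \<partial>\<nu>) = q"
        using integrable_of_real[OF i2, where 'a = complex] var
          integral_complex_of_real[of \<nu> "\<lambda>y. y\<^sup>2"]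
        by (auto simp del: of_real_power)
      show ?thesis
        using iyp ip I1(1) I2(1) by (simp add: mean var del: of_real_power)
    qed
    also have "\<dots> = (\<integral>y. of_real y * (\<phi> (x(i := y)) - p - of_real y * q) - (\<psi> (x(i := y)) - q) \<partial>\<nu>)"
      by (intro Bochner_Integration.integral_cong refl) (simp add: algebra_simps power2_eq_square)
    also have "cmod \<dots> \<le> (\<integral>y. K * (\<bar>y\<bar> ^ 3 + \<bar>y\<bar>) \<partial>\<nu>)"
    proof (rule integral_norm_bound_integral')
      fix y
      have "cmod (of_real y * (\<phi> (x(i := y)) - p - of_real y * q) - (\<psi> (x(i := y)) - q))
        \<le> \<bar>y\<bar> * cmod (\<phi> (x(i := y)) - p - of_real y * q) + cmod (\<psi> (x(i := y)) - q)"
        by (rule order_trans[OF norm_triangle_ineq4]) (simp add: norm_mult)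
      also have "\<dots> \<le> \<bar>y\<bar> * (K * y\<^sup>2) + K * \<bar>y\<bar>"
        unfolding p_def q_def by (intro add_mono mult_left_mono e1 e2) auto
      also have "\<dots> = K * (\<bar>y\<bar> ^ 3 + \<bar>y\<bar>)"
      proof -
        have "u * (K * u\<^sup>2) + K * u = K * (u ^ 3 + u)" for u :: real
          by (simp add: power3_eq_cube power2_eq_square distrib_left)
        from this[of "\<bar>y\<bar>"] show ?thesis by simp
      qed
      finally show "cmod (of_real y * (\<phi> (x(i := y)) - p - of_real y * q) - (\<psi> (x(i := y)) - q)) \<le> K * (\<bar>y\<bar> ^ 3 + \<bar>y\<bar>)" .
    qed (use ik[of 3] ik[of 1] in auto)
    finally show "cmod (\<integral>y. of_real y * \<phi> (x(i := y)) - \<psi> (x(i := y)) \<partial>\<nu>) \<le> K * (\<integral>y. \<bar>y\<bar> ^ 3 + \<bar>y\<bar> \<partial>\<nu>)"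
      by simp
  qed auto
  finally show "cmod (\<integral>x. of_real (x i) * \<phi> x - \<psi> x \<partial>PiM I (\<lambda>_. \<nu>)) \<le> K * (\<integral>y. \<bar>y\<bar> ^ 3 + \<bar>y\<bar> \<partial>\<nu>)"
    by (simp add: P.prob_space)
qed

section \<open>Perturbation of a fixed matrix\<close>

text \<open>Index set of the independent entries of a symmetric matrix.\<close>

definition tri :: "nat \<Rightarrow> (nat \<times> nat) set" where
  "tri n = {(i, j). i \<le> j \<and> j < n}"

definition sym_mat :: "nat \<Rightarrow> (nat \<times> nat \<Rightarrow> real) \<Rightarrow> real mat" where
  "sym_mat n x = Matrix.mat n n (\<lambda>(i, j). x (min i j, max i j))"

lemma tri_subset: "tri n \<subseteq> {..<n} \<times> {..<n}"
  by (auto simp: tri_def)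

lemma finite_tri: "finite (tri n)"
  by (rule finite_subset[OF tri_subset]) simp

lemma card_tri: "card (tri n) \<le> n\<^sup>2"
  using card_mono[OF _ tri_subset, of n] by (simp add: card_cartesian_product power2_eq_square)

lemma sym_mat_carrier [simp]: "sym_mat n x \<in> carrier_mat n n"
  by (simp add: sym_mat_def)

lemma sym_mat_sym: "transpose_mat (sym_mat n x) = sym_mat n x"
  by (rule eq_matI) (auto simp: sym_mat_def min.commute max.commute)

lemma min_max_tri: "i < n \<Longrightarrow> j < n \<Longrightarrow> (min i j, max i j) \<in> tri n"
  by (auto simp: tri_def)

lemma sym_mat_update:
  assumes "(i, j) \<in> tri n"
  shows "cmat (sym_mat n (x((i, j) := y))) = cmat (sym_mat n x) + complex_of_real (y - x (i, j)) \<cdot>\<^sub>m sym_unit n i j"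
proof (rule eq_matI)
  fix a b assume "a < dim_row (cmat (sym_mat n x) + complex_of_real (y - x (i, j)) \<cdot>\<^sub>m sym_unit n i j)"
    "b < dim_col (cmat (sym_mat n x) + complex_of_real (y - x (i, j)) \<cdot>\<^sub>m sym_unit n i j)"
  hence ab: "a < n" "b < n" by (auto simp: sym_unit_def)
  have ij: "i \<le> j" using assms by (auto simp: tri_def)
  let ?p = "(min a b, max a b)"
  have "?p = (i, j) \<longleftrightarrow> (a = i \<and> b = j) \<or> (a = j \<and> b = i)"
    using ij by (auto simp: min_def max_def)
  hence D: "sym_unit n i j $$ (a, b) = (if ?p = (i, j) then 1 else 0)"
    using ab by (simp only: sym_unit_def index_mat split)
  have L: "sym_mat n f $$ (a, b) = f ?p" for f
    using ab by (simp add: sym_mat_def)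
  have "cmat (sym_mat n (x((i, j) := y))) $$ (a, b) = complex_of_real ((x((i, j) := y)) ?p)"
    using ab carrier_matD[OF sym_mat_carrier, of n] by (simp only: index_map_mat L)
  also have "\<dots> = of_real (x ?p) + complex_of_real (y - x (i, j)) * (if ?p = (i, j) then 1 else 0)"
  proof (cases "?p = (i, j)")
    case True
    show ?thesis unfolding True by simp
  next
    case False
    hence "(x((i, j) := y)) ?p = x ?p" by (metis fun_upd_other)
    thus ?thesis unfolding if_not_P[OF False] by (simp only: mult_zero_right add_0_right)
  qed
  also have "\<dots> = (cmat (sym_mat n x) + complex_of_real (y - x (i, j)) \<cdot>\<^sub>m sym_unit n i j) $$ (a, b)"
    using ab carrier_matD[OF sym_mat_carrier, of n] carrier_matD[OF sym_unit_carrier, of n i j]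
    by (simp only: index_map_mat index_add_mat index_smult_mat L D)
  finally show "cmat (sym_mat n (x((i, j) := y))) $$ (a, b)
      = (cmat (sym_mat n x) + complex_of_real (y - x (i, j)) \<cdot>\<^sub>m sym_unit n i j) $$ (a, b)" .
qed (auto simp: sym_mat_def sym_unit_def)

lemma norm_add_diff_le:
  fixes x y v :: complex
  assumes "cmod x \<le> a" "cmod y \<le> b" "cmod v \<le> c"
  shows "cmod (x + y - v) \<le> a + b + c"
  using norm_triangle_ineq4[of "x + y" v] norm_triangle_ineq[of x y] assms by linarith

text \<open>The matrix \<open>A\<close> and the two spectral parameters are fixed; the entries \<open>x\<close> of the noise vary. The
  aim is to control the quantity \<open>err\<close> by constants that do not depend on \<open>A\<close>. With
  \<open>\<omega> = z + \<sigma>\<^sup>2 m\<close> it is the normalized trace of \<open>B ((A - \<omega>) G - 1)\<close>, which would vanish if \<open>G\<close> were the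
  resolvent of \<open>A\<close> at \<open>\<omega>\<close>.\<close>

locale fixed_perturbation =
  fixes n :: nat and A :: "real mat" and \<sigma> :: real and z w :: complex
  assumes n: "n > 0" and A: "A \<in> carrier_mat n n" "transpose_mat A = A"
    and z: "Im z > 0" and w: "Im w \<noteq> 0"
begin

definition "s = \<sigma> / sqrt (real n)"
definition "c = 1 / Im z"
definition "b = 1 / \<bar>Im w\<bar>"
definition "pert x = A + s \<cdot>\<^sub>m sym_mat n x"
definition "G x = resolvent (pert x) z"
definition "B = resolvent A w"
definition "m x = mat_trace (G x) / of_nat n"
definition "t x = mat_trace (B * G x) / of_nat n"
definition "err x = m x + (w - z - of_real (\<sigma>\<^sup>2) * m x) * t x - mat_trace B / of_nat n"

lemma c0: "c > 0" and b0: "b > 0"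
  using z w by (auto simp: c_def b_def)

lemma s2: "s\<^sup>2 * n = \<sigma>\<^sup>2"
  using n by (simp add: s_def power_divide)

lemma pert: "pert x \<in> carrier_mat n n" "transpose_mat (pert x) = pert x"
proof -
  show "pert x \<in> carrier_mat n n" using A by (simp add: pert_def)
  hence dim: "dim_row (pert x) = n" "dim_col (pert x) = n" by auto
  have e: "pert x $$ (i, j) = A $$ (i, j) + s * sym_mat n x $$ (i, j)" if "i < n" "j < n" for i j
    using A that carrier_matD[OF sym_mat_carrier, of n x] by (simp add: pert_def)
  show "transpose_mat (pert x) = pert x"
  proof (rule eq_matI)
    fix i j assume "i < dim_row (pert x)" "j < dim_col (pert x)"
    hence ij: "i < n" "j < n" by (auto simp: dim)
    thus "transpose_mat (pert x) $$ (i, j) = pert x $$ (i, j)"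
      using sym_entry[OF A ij] sym_entry[OF sym_mat_carrier sym_mat_sym ij, of x]
      by (simp add: dim e)
  qed (auto simp: dim)
qed

lemma G: "op_bounded n c (G x)" "G x \<in> carrier_mat n n" "transpose_mat (G x) = G x"
proof -
  have z': "Im z \<noteq> 0" "\<bar>Im z\<bar> = Im z" using z by auto
  show "op_bounded n c (G x)" "G x \<in> carrier_mat n n" "transpose_mat (G x) = G x"
    using resolvent_bounded[OF pert z'(1)] resolvent_sym[OF pert z'(1)] resolvent_carrier[OF pert z'(1)]
    by (auto simp: G_def c_def z'(2))
qed

lemma B: "op_bounded n b B" "B \<in> carrier_mat n n"
  using resolvent_bounded[OF A w] resolvent_carrier[OF A w] by (auto simp: B_def b_def)

lemma G_update:
  assumes "(i, j) \<in> tri n"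
  shows "G (x((i, j) := y)) - G x = - (of_real s * of_real (y - x (i, j))) \<cdot>\<^sub>m (G (x((i, j) := y)) * sym_unit n i j * G x)"
proof -
  let ?x = "x((i, j) := y)" and ?r = "- (complex_of_real s * of_real (y - x (i, j)))"
  let ?X = "G ?x" and ?D = "sym_unit n i j"
  have "?X - G x = ?X * (cmat (pert x) - cmat (pert ?x) + (z - z) \<cdot>\<^sub>m 1\<^sub>m n) * G x"
    unfolding G_def by (rule resolvent_diff[OF pert pert]) (use z in auto)
  also have "cmat (pert x) - cmat (pert ?x) + (z - z) \<cdot>\<^sub>m 1\<^sub>m n = ?r \<cdot>\<^sub>m ?D"
  proof (rule eq_matI)
    fix a b assume "a < dim_row (?r \<cdot>\<^sub>m ?D)" "b < dim_col (?r \<cdot>\<^sub>m ?D)"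
    hence ab: "a < n" "b < n" by (auto simp: sym_unit_def)
    have e: "complex_of_real (sym_mat n ?x $$ (a, b)) = of_real (sym_mat n x $$ (a, b)) + of_real (y - x (i, j)) * ?D $$ (a, b)"
      using arg_cong[OF sym_mat_update[OF assms, of x y], of "\<lambda>X. X $$ (a, b)"] ab
      by (simp add: sym_unit_def sym_mat_def del: of_real_diff)
    thus "(cmat (pert x) - cmat (pert ?x) + (z - z) \<cdot>\<^sub>m 1\<^sub>m n) $$ (a, b) = (?r \<cdot>\<^sub>m ?D) $$ (a, b)"
      using ab A carrier_matD[OF sym_mat_carrier, of n] carrier_matD[OF sym_unit_carrier, of n i j]
      by (simp add: pert_def e) (simp add: algebra_simps)
  qed (use pert in \<open>auto simp: sym_unit_def\<close>)
  also have "?X * (?r \<cdot>\<^sub>m ?D) * G x = ?r \<cdot>\<^sub>m (?X * ?D * G x)"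
    using G(2) by (simp add: mult_smult_distrib[of _ n n _ n] mult_smult_assoc_mat[of _ n n _ n])
  finally show ?thesis .
qed

text \<open>By cyclicity the trace of \<open>K G' D G\<close> is the sum of two entries of \<open>G K G'\<close>. It is bounded by the
  operator norm and not by \<open>n\<close> times it: a unit change of one noise entry moves the normalized trace
  by \<open>O(n\<^sup>-\<^sup>3\<^sup>/\<^sup>2)\<close> only.\<close>

lemma trace_update:
  assumes p: "(i, j) \<in> tri n" and K: "op_bounded n k K"
  shows "cmod (mat_trace (K * G (x((i, j) := y))) - mat_trace (K * G x)) \<le> \<bar>s\<bar> * \<bar>y - x (i, j)\<bar> * (2 * (c * k * c))"
proof -
  note Kc = op_boundedD(1)[OF K]
  let ?X = "G (x((i, j) := y))" and ?D = "sym_unit n i j"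
  have ij: "i < n" "j < n" using p by (auto simp: tri_def)
  have "mat_trace (K * ?X) - mat_trace (K * G x) = mat_trace (K * (?X - G x))"
    using Kc G(2) by (simp add: mult_minus_distrib_mat[of _ n n _ n] mat_trace_diff[of _ n])
  also have "\<dots> = - (of_real s * of_real (y - x (i, j))) * mat_trace (K * (?X * ?D * G x))"
    using Kc G(2) by (simp add: G_update[OF p] mult_smult_distrib[of _ n n _ n] mat_trace_smult[of _ n])
  also have "mat_trace (K * (?X * ?D * G x)) = mat_trace ((K * ?X * ?D) * G x)"
    using Kc G(2) by (simp add: assoc_mult_mat[of _ n n _ n _ n])
  also have "\<dots> = mat_trace (G x * (K * ?X * ?D))"
    by (rule mat_trace_comm[of _ n]) (use Kc G(2) in auto)
  also have "\<dots> = mat_trace (G x * K * ?X * ?D)"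
    using Kc G(2) by (simp add: assoc_mult_mat[of _ n n _ n _ n])
  finally have eq: "mat_trace (K * ?X) - mat_trace (K * G x) = - (of_real s * of_real (y - x (i, j))) * mat_trace (G x * K * ?X * ?D)" .
  have E: "op_bounded n (c * k * c) (G x * K * ?X)"
    by (intro op_bounded_mult G K)
  have "cmod (mat_trace (G x * K * ?X * ?D)) \<le> 2 * (c * k * c)"
  proof -
    have e: "cmod ((G x * K * ?X) $$ (a, b)) \<le> c * k * c" if "a < n" "b < n" for a b
      by (rule op_bounded_entry[OF E that])
    have "0 \<le> c * k * c" using E op_boundedD(2) by blast
    thus ?thesis
      using e[OF ij] e[OF ij(2,1)] e[OF ij(1,1)] norm_triangle_ineq[of "(G x * K * ?X) $$ (i, j)" "(G x * K * ?X) $$ (j, i)"]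
      unfolding mat_trace_mult_sym_unit[OF op_boundedD(1)[OF E] ij] by auto
  qed
  thus ?thesis unfolding eq norm_mult norm_minus_cancel norm_of_real
    by (intro mult_left_mono) auto
qed

lemma m_bound: "cmod (m x) \<le> c" and t_bound: "cmod (t x) \<le> b * c"
proof -
  show "cmod (m x) \<le> c"
    using op_bounded_trace[OF G(1), of x] n by (simp add: m_def norm_divide field_simps)
  show "cmod (t x) \<le> b * c"
    using op_bounded_trace[OF op_bounded_mult[OF B(1) G(1)], of x] n by (simp add: t_def norm_divide field_simps)
qed

lemma err_bound: "cmod (err x) \<le> c + (cmod (w - z) + \<sigma>\<^sup>2 * c) * (b * c) + b"
proof -
  have B': "cmod (mat_trace B / of_nat n) \<le> b"
    using op_bounded_trace[OF B(1)] n by (simp add: norm_divide field_simps)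
  have "cmod (w - z - of_real (\<sigma>\<^sup>2) * m x) \<le> cmod (w - z) + \<sigma>\<^sup>2 * c"
    by (rule order_trans[OF norm_triangle_ineq4])
       (use m_bound[of x] in \<open>auto simp: norm_mult norm_power intro!: mult_left_mono\<close>)
  hence "cmod ((w - z - of_real (\<sigma>\<^sup>2) * m x) * t x) \<le> (cmod (w - z) + \<sigma>\<^sup>2 * c) * (b * c)"
    unfolding norm_mult using t_bound[of x] c0 by (intro mult_mono) auto
  with B' m_bound[of x] show ?thesis unfolding err_def
    by (intro norm_add_diff_le) auto
qed

definition "Lip = 2 * c\<^sup>2 * \<bar>\<sigma>\<bar> * (1 + cmod (w - z) * b + 2 * \<sigma>\<^sup>2 * b * c)"

lemma err_lipschitz:
  assumes p: "p \<in> tri n"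
  shows "cmod (err (x(p := y)) - err x) \<le> Lip / (n * sqrt n) * \<bar>y - x p\<bar>"
proof -
  obtain i j where p': "p = (i, j)" by (cases p)
  let ?x = "x((i, j) := y)"
  define h where "h = \<bar>s\<bar> * \<bar>y - x (i, j)\<bar> * 2 * c\<^sup>2 / n"
  have h0: "h \<ge> 0" by (simp add: h_def)
  have one: "op_bounded n 1 (1\<^sub>m n)" by (auto simp: op_bounded_def)
  have dm: "cmod (m ?x - m x) \<le> h"
  proof -
    have "m ?x - m x = (mat_trace (1\<^sub>m n * G ?x) - mat_trace (1\<^sub>m n * G x)) / n"
      using G(2) by (simp add: m_def diff_divide_distrib left_mult_one_mat[of _ n n])
    thus ?thesis using trace_update[OF p[unfolded p'] one, of x y] n
      by (simp add: norm_divide h_def divide_right_mono power2_eq_square mult_ac)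
  qed
  have dt: "cmod (t ?x - t x) \<le> b * h"
  proof -
    have "t ?x - t x = (mat_trace (B * G ?x) - mat_trace (B * G x)) / n"
      by (simp add: t_def diff_divide_distrib)
    thus ?thesis using trace_update[OF p[unfolded p'] B(1), of x y] n
      by (simp add: norm_divide h_def divide_right_mono power2_eq_square mult_ac)
  qed
  have "err ?x - err x = (m ?x - m x) + (w - z) * (t ?x - t x) - of_real (\<sigma>\<^sup>2) * ((m ?x - m x) * t ?x + m x * (t ?x - t x))"
    by (simp add: err_def algebra_simps)
  also have "cmod \<dots> \<le> h + cmod (w - z) * (b * h) + \<sigma>\<^sup>2 * (h * (b * c) + c * (b * h))"
  proof (intro norm_add_diff_le dm)
    show "cmod ((w - z) * (t ?x - t x)) \<le> cmod (w - z) * (b * h)"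
      unfolding norm_mult by (intro mult_left_mono dt) auto
    have "cmod ((m ?x - m x) * t ?x + m x * (t ?x - t x)) \<le> h * (b * c) + c * (b * h)"
      by (intro norm_triangle_le add_mono; unfold norm_mult; intro mult_mono dm dt m_bound t_bound)
         (use h0 c0 in auto)
    thus "cmod (of_real (\<sigma>\<^sup>2) * ((m ?x - m x) * t ?x + m x * (t ?x - t x))) \<le> \<sigma>\<^sup>2 * (h * (b * c) + c * (b * h))"
      unfolding norm_mult by (intro mult_mono) (auto simp: norm_power)
  qed
  also have "\<dots> = h * (1 + cmod (w - z) * b + 2 * \<sigma>\<^sup>2 * b * c)" by (simp add: algebra_simps)
  also have "\<dots> = Lip / (n * sqrt n) * \<bar>y - x p\<bar>"
    using n by (simp add: h_def Lip_def s_def p' abs_divide mult_ac)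
  finally show ?thesis by (simp add: p')
qed

text \<open>The next definitions prepare the mean of \<open>err\<close>: \<open>\<psi> i j\<close> is the partial derivative of \<open>\<phi> i j\<close> with
  respect to the noise entry at \<open>(i, j)\<close>, and \<open>R\<close> collects what the sum of these derivatives
  contains beyond the product of the traces of \<open>G\<close> and \<open>G B\<close>.\<close>

definition "\<phi> i j x = (G x * B) $$ (i, j)"
definition "\<psi> i j x = - of_real s * (G x * sym_unit n (min i j) (max i j) * (G x * B)) $$ (i, j)"

definition "R x = mat_trace (G x * (G x * B)) - (\<Sum>i<n. G x $$ (i, i) * (G x * B) $$ (i, i))"

text \<open>Multiply \<open>(A - w) + (w - z) + s Z\<close> by \<open>B\<close> on the left and by \<open>G\<close> on the right: the two inverses
  leave \<open>B = G + (w - z) B G + s B Z G\<close>, and \<open>A\<close> itself, whose size is not controlled, disappears.\<close>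

lemma err_eq_trace: "err x = - of_real (s / n) * (\<Sum>i<n. \<Sum>j<n. of_real (x (min i j, max i j)) * \<phi> i j x) - of_real (\<sigma>\<^sup>2) * m x * t x"
proof -
  note assoc = assoc_mult_mat[of _ n n _ n _ n]
  let ?A = "cmat A" and ?W = "cmat (sym_mat n x)" and ?I = "1\<^sub>m n :: complex mat" and ?s = "complex_of_real s"
  have cA: "?A \<in> carrier_mat n n" "?W \<in> carrier_mat n n" using A by auto
  have p: "cmat (pert x) - z \<cdot>\<^sub>m ?I = (?A - w \<cdot>\<^sub>m ?I) + (w - z) \<cdot>\<^sub>m ?I + ?s \<cdot>\<^sub>m ?W"
    using A by (intro eq_matI) (auto simp: pert_def sym_mat_def algebra_simps)
  let ?M = "?A - w \<cdot>\<^sub>m ?I"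
  have M: "?M \<in> carrier_mat n n" using A by auto
  have BM: "B * ?M = ?I" unfolding B_def by (rule resolvent_left[OF A w])
  have "B = B * ((cmat (pert x) - z \<cdot>\<^sub>m ?I) * G x)"
    unfolding G_def using resolvent_right[OF pert, of z x] z B(2) by simp
  also have "\<dots> = B * (?M + (w - z) \<cdot>\<^sub>m ?I + ?s \<cdot>\<^sub>m ?W) * G x"
    unfolding p using B(2) G(2) cA M by (simp add: assoc)
  also have "B * (?M + (w - z) \<cdot>\<^sub>m ?I + ?s \<cdot>\<^sub>m ?W) = B * ?M + (w - z) \<cdot>\<^sub>m B + ?s \<cdot>\<^sub>m (B * ?W)"
  proof -
    have "B * (?M + (w - z) \<cdot>\<^sub>m ?I + ?s \<cdot>\<^sub>m ?W) = B * (?M + (w - z) \<cdot>\<^sub>m ?I) + B * (?s \<cdot>\<^sub>m ?W)"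
      by (rule mult_add_distrib_mat[of _ n n _ n]) (use B(2) cA in auto)
    also have "B * (?M + (w - z) \<cdot>\<^sub>m ?I) = B * ?M + B * ((w - z) \<cdot>\<^sub>m ?I)"
      by (rule mult_add_distrib_mat[of _ n n _ n]) (use B(2) cA in auto)
    also have "B * ((w - z) \<cdot>\<^sub>m ?I) = (w - z) \<cdot>\<^sub>m B"
      using B(2) by (simp add: mult_smult_distrib[of _ n n _ n])
    also have "B * (?s \<cdot>\<^sub>m ?W) = ?s \<cdot>\<^sub>m (B * ?W)"
      using B(2) cA by (simp add: mult_smult_distrib[of _ n n _ n])
    finally show ?thesis .
  qed
  also have "\<dots> * G x = G x + (w - z) \<cdot>\<^sub>m (B * G x) + ?s \<cdot>\<^sub>m (B * ?W * G x)"
  proof -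
    have cB: "(w - z) \<cdot>\<^sub>m B \<in> carrier_mat n n" "?s \<cdot>\<^sub>m (B * ?W) \<in> carrier_mat n n" using B(2) cA by auto
    have "(?I + (w - z) \<cdot>\<^sub>m B + ?s \<cdot>\<^sub>m (B * ?W)) * G x = (?I + (w - z) \<cdot>\<^sub>m B) * G x + ?s \<cdot>\<^sub>m (B * ?W) * G x"
      by (rule add_mult_distrib_mat[of _ n n _ _ n]) (use cB G(2) in auto)
    also have "(?I + (w - z) \<cdot>\<^sub>m B) * G x = ?I * G x + (w - z) \<cdot>\<^sub>m B * G x"
      by (rule add_mult_distrib_mat[of _ n n _ _ n]) (use cB G(2) in auto)
    also have "?I * G x = G x" by (rule left_mult_one_mat[OF G(2)])
    also have "(w - z) \<cdot>\<^sub>m B * G x = (w - z) \<cdot>\<^sub>m (B * G x)"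
      by (rule mult_smult_assoc_mat[OF B(2) G(2)])
    also have "?s \<cdot>\<^sub>m (B * ?W) * G x = ?s \<cdot>\<^sub>m (B * ?W * G x)"
      by (rule mult_smult_assoc_mat[of _ n n _ n]) (use B(2) G(2) cA in auto)
    finally show ?thesis unfolding BM .
  qed
  finally have B': "B = G x + (w - z) \<cdot>\<^sub>m (B * G x) + ?s \<cdot>\<^sub>m (B * ?W * G x)" .
  have "mat_trace B = mat_trace (G x) + (w - z) * mat_trace (B * G x) + ?s * mat_trace (B * ?W * G x)"
  proof -
    have cc: "B * G x \<in> carrier_mat n n" "B * ?W * G x \<in> carrier_mat n n" using B(2) G(2) cA by auto
    have "mat_trace B = mat_trace (G x + (w - z) \<cdot>\<^sub>m (B * G x) + ?s \<cdot>\<^sub>m (B * ?W * G x))"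
      using B' by (rule arg_cong)
    also have "\<dots> = mat_trace (G x + (w - z) \<cdot>\<^sub>m (B * G x)) + mat_trace (?s \<cdot>\<^sub>m (B * ?W * G x))"
      by (rule mat_trace_add[of _ n]) (use cc G(2) in auto)
    also have "mat_trace (G x + (w - z) \<cdot>\<^sub>m (B * G x)) = mat_trace (G x) + mat_trace ((w - z) \<cdot>\<^sub>m (B * G x))"
      by (rule mat_trace_add[of _ n]) (use cc G(2) in auto)
    finally show ?thesis unfolding mat_trace_smult[OF cc(1)] mat_trace_smult[OF cc(2)] .
  qed
  hence 0: "mat_trace (G x) + (w - z) * mat_trace (B * G x) - mat_trace B = - (?s * mat_trace (B * ?W * G x))"
    by simp
  have "err x = (mat_trace (G x) + (w - z) * mat_trace (B * G x) - mat_trace B) / n - of_real (\<sigma>\<^sup>2) * m x * t x"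
    by (simp add: err_def m_def t_def add_divide_distrib diff_divide_distrib left_diff_distrib)
  hence 1: "err x = - (?s * mat_trace (B * ?W * G x)) / n - of_real (\<sigma>\<^sup>2) * m x * t x"
    unfolding 0 .
  have "mat_trace (B * ?W * G x) = mat_trace (G x * (B * ?W))"
    by (rule mat_trace_comm[of _ n]) (use B(2) G(2) cA in auto)
  also have "G x * (B * ?W) = (G x * B) * ?W"
    using B(2) G(2)[of x] cA by (simp add: assoc)
  also have "mat_trace \<dots> = (\<Sum>i<n. \<Sum>j<n. of_real (x (min i j, max i j)) * \<phi> i j x)"
    by (subst mat_trace_mult[of _ n]) (use B(2) G(2)[of x] cA in \<open>auto simp: \<phi>_def sym_mat_def min.commute max.commute intro!: sum.cong simp del: index_mult_mat\<close>)
  finally show ?thesis unfolding 1 by simp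
qed

lemma sum_psi: "(\<Sum>i<n. \<Sum>j<n. \<psi> i j x) = - of_real s * ((of_nat n)\<^sup>2 * m x * t x + R x)"
proof -
  let ?g = "G x" and ?h = "G x * B"
  have h: "?h \<in> carrier_mat n n" using G(2) B(2) by simp
  have e: "\<psi> i j x = - of_real s * (?g $$ (i, i) * ?h $$ (j, j) + (if i = j then 0 else ?g $$ (j, i) * ?h $$ (i, j)))"
    if "i < n" "j < n" for i j
  proof -
    have "?g $$ (i, j) = ?g $$ (j, i)" using sym_entry[OF G(2,3)] that by auto
    thus ?thesis unfolding \<psi>_def
      by (subst mult_sym_unit_entry[OF G(2) h]) (use that in \<open>auto simp: min_def max_def simp del: index_mult_mat\<close>)
  qed
  have "(\<Sum>i<n. \<Sum>j<n. \<psi> i j x) = - of_real s * (\<Sum>i<n. \<Sum>j<n. ?g $$ (i, i) * ?h $$ (j, j) + (if i = j then 0 else ?g $$ (j, i) * ?h $$ (i, j)))"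
    unfolding sum_distrib_left by (intro sum.cong refl e) auto
  also have "(\<Sum>i<n. \<Sum>j<n. ?g $$ (i, i) * ?h $$ (j, j) + (if i = j then 0 else ?g $$ (j, i) * ?h $$ (i, j)))
      = (\<Sum>i<n. \<Sum>j<n. ?g $$ (i, i) * ?h $$ (j, j)) + (\<Sum>i<n. \<Sum>j<n. (?g $$ (j, i) * ?h $$ (i, j)) - (if j = i then ?g $$ (i, i) * ?h $$ (i, i) else 0))"
    unfolding sum.distrib[symmetric] by (intro sum.cong refl) (auto simp del: index_mult_mat)
  also have "(\<Sum>i<n. \<Sum>j<n. ?g $$ (i, i) * ?h $$ (j, j)) = mat_trace ?g * mat_trace ?h"
    using G(2)[of x] h by (simp add: mat_trace_def sum_product del: index_mult_mat)
  also have "mat_trace ?h = mat_trace (B * G x)" by (rule mat_trace_comm[OF G(2) B(2)])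
  also have "(\<Sum>i<n. \<Sum>j<n. (?g $$ (j, i) * ?h $$ (i, j)) - (if j = i then ?g $$ (i, i) * ?h $$ (i, i) else 0)) = R x"
    unfolding R_def mat_trace_mult[OF G(2) h]
    by (subst (2) sum.swap) (simp add: sum_subtractf del: index_mult_mat)
  finally show ?thesis using n by (simp add: m_def t_def power2_eq_square)
qed

lemma R_bound: "cmod (R x) \<le> 2 * n * (c * (c * b))"
proof -
  have h: "op_bounded n (c * b) (G x * B)" by (intro op_bounded_mult G B)
  have "cmod (mat_trace (G x * (G x * B))) \<le> n * (c * (c * b))"
    by (intro op_bounded_trace op_bounded_mult G h)
  moreover have "cmod (\<Sum>i<n. G x $$ (i, i) * (G x * B) $$ (i, i)) \<le> (\<Sum>i<n. c * (c * b))"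
    by (rule order_trans[OF norm_sum], rule sum_mono, unfold norm_mult, rule mult_mono)
       (use op_bounded_entry[OF G(1)] op_bounded_entry[OF h] c0 in \<open>auto simp del: index_mult_mat\<close>)
  ultimately show ?thesis unfolding R_def
    by (intro norm_triangle_le_diff) simp
qed

text \<open>The main part of the sum of the derivatives is \<open>n\<^sup>2 m t\<close>, and it cancels against the term
  \<open>\<sigma>\<^sup>2 m t\<close> of \<open>err\<close>. This cancellation is the reason for the choice \<open>\<omega> = z + \<sigma>\<^sup>2 m\<close>.\<close>

lemma err_decomp:
  "err x = - of_real (s / n) * (\<Sum>i<n. \<Sum>j<n. of_real (x (min i j, max i j)) * \<phi> i j x - \<psi> i j x) + of_real (s\<^sup>2 / n) * R x"
proof -
  define k P Q S T where "k = complex_of_real (s / n)"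
    and "P = (\<Sum>i<n. \<Sum>j<n. of_real (x (min i j, max i j)) * \<phi> i j x)"
    and "Q = (\<Sum>i<n. \<Sum>j<n. \<psi> i j x)"
    and "S = of_real (\<sigma>\<^sup>2) * m x * t x" and "T = of_real (s\<^sup>2 / n) * R x"
  have "k * Q = - (of_real (s\<^sup>2 * n) * m x * t x + T)"
    unfolding k_def Q_def sum_psi T_def using n by (simp add: field_simps power2_eq_square)
  hence kQ: "k * Q = - (S + T)" unfolding s2 S_def .
  have "- k * (P - Q) + T = - k * P + k * Q + T" by (simp add: algebra_simps)
  also have "\<dots> = - k * P - S" by (simp add: kQ)
  also have "\<dots> = err x" unfolding err_eq_trace k_def P_def S_def ..
  finally show ?thesis unfolding k_def P_def Q_def T_def by (simp add: sum_subtractf)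
qed

lemma phi_bound: "i < n \<Longrightarrow> j < n \<Longrightarrow> cmod (\<phi> i j x) \<le> c * b"
  unfolding \<phi>_def by (intro op_bounded_entry[where n=n] op_bounded_mult G B)

lemma psi_bound: "i < n \<Longrightarrow> j < n \<Longrightarrow> cmod (\<psi> i j x) \<le> \<bar>s\<bar> * (c * 1 * (c * b))"
  unfolding \<psi>_def norm_mult norm_minus_cancel norm_of_real
  by (intro mult_left_mono op_bounded_entry[where n=n] op_bounded_mult G B op_bounded_sym_unit) auto

text \<open>The resolvent identity, applied once more to each remainder, gives the second order Taylor bounds
  without any differentiation. Each factor \<open>s\<close> is \<open>O(n\<^sup>-\<^sup>1\<^sup>/\<^sup>2)\<close>.\<close>

lemma phi_psi_expand:
  assumes ij: "i < n" "j < n" and p: "p = (min i j, max i j)"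
  shows "cmod (\<phi> i j (x(p := y)) - \<phi> i j (x(p := 0)) - of_real y * \<psi> i j (x(p := 0))) \<le> 2 * s\<^sup>2 * c ^ 3 * b * y\<^sup>2" (is "cmod ?u \<le> _")
    and "cmod (\<psi> i j (x(p := y)) - \<psi> i j (x(p := 0))) \<le> 2 * s\<^sup>2 * c ^ 3 * b * \<bar>y\<bar>" (is "cmod ?v \<le> _")
proof -
  note assoc = assoc_mult_mat[of _ n n _ n _ n]
  let ?g = "G (x(p := y))" and ?k = "G (x(p := 0))" and ?D = "sym_unit n (min i j) (max i j)"
  have D: "op_bounded n 1 ?D" using ij by (intro op_bounded_sym_unit) auto
  note bnd = op_bounded_mult G(1) B(1) D
  have pt: "(min i j, max i j) \<in> tri n" using min_max_tri[OF ij] .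
  have gk: "?g - ?k = - (of_real s * of_real y) \<cdot>\<^sub>m (?g * ?D * ?k)"
    using G_update[OF pt, of "x(p := 0)" y] by (simp add: p)
  have right: "(?g * Y) $$ (i, j) - (?k * Y) $$ (i, j) = - (of_real s * of_real y) * (?g * ?D * (?k * Y)) $$ (i, j)"
    if "Y \<in> carrier_mat n n" for Y
  proof -
    have "(?g * Y) - (?k * Y) = - (of_real s * of_real y) \<cdot>\<^sub>m (?g * ?D * (?k * Y))"
      using that G(2) by (simp add: minus_mult_distrib_mat[of _ n n _ _ n, symmetric] gk mult_smult_assoc_mat[of _ n n _ n] assoc)
    from arg_cong[OF this, of "\<lambda>X. X $$ (i, j)"] show ?thesis
      using ij that carrier_matD[OF mult_carrier_square[OF G(2) that]]
        carrier_matD[OF mult_carrier_square[OF mult_carrier_square[OF G(2) sym_unit_carrier] mult_carrier_square[OF G(2) that]]]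
      by (simp del: index_mult_mat)
  qed
  have left: "(?k * ?D * (?g * B)) $$ (i, j) - (?k * ?D * (?k * B)) $$ (i, j) = - (of_real s * of_real y) * (?k * ?D * (?g * ?D * (?k * B))) $$ (i, j)"
  proof -
    have "(?k * ?D * (?g * B)) - (?k * ?D * (?k * B)) = (?k * ?D) * ((?g - ?k) * B)"
      using G(2) B(2) by (simp add: minus_mult_distrib_mat[of _ n n _ _ n] mult_minus_distrib_mat[of _ n n _ n])
    also have "\<dots> = - (of_real s * of_real y) \<cdot>\<^sub>m (?k * ?D * (?g * ?D * (?k * B)))"
      using G(2) B(2) by (simp add: gk mult_smult_assoc_mat[of _ n n _ n] mult_smult_distrib[of _ n n _ n] assoc)
    finally have "(?k * ?D * (?g * B)) - (?k * ?D * (?k * B)) = - (of_real s * of_real y) \<cdot>\<^sub>m (?k * ?D * (?g * ?D * (?k * B)))" .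
    moreover have "(?k * ?D * (?g * B)) \<in> carrier_mat n n" "(?k * ?D * (?k * B)) \<in> carrier_mat n n"
      "(?k * ?D * (?g * ?D * (?k * B))) \<in> carrier_mat n n" using G(2) B(2) by auto
    ultimately show ?thesis using ij by (metis (no_types, lifting) carrier_matD index_minus_mat(1) index_smult_mat(1))
  qed
  have bd3: "cmod ((?g * ?D * (?k * ?D * (?k * B))) $$ (i, j)) \<le> c * 1 * (c * 1 * (c * b))"
    by (intro op_bounded_entry[where n=n] bnd ij)
  have bd3': "cmod ((?g * ?D * (?k * (?D * (?g * B)))) $$ (i, j)) \<le> c * 1 * (c * (1 * (c * b)))"
    by (intro op_bounded_entry[where n=n] bnd ij)
  have bd3'': "cmod ((?k * ?D * (?g * ?D * (?k * B))) $$ (i, j)) \<le> c * 1 * (c * 1 * (c * b))"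
    by (intro op_bounded_entry[where n=n] bnd ij)
  have c3: "c * 1 * (c * 1 * (c * b)) = c ^ 3 * b" "c * 1 * (c * (1 * (c * b))) = c ^ 3 * b"
    by (simp_all add: power3_eq_cube)
  have nn: "0 \<le> s\<^sup>2 * y\<^sup>2 * (c ^ 3 * b)" using c0 b0 by simp
  have "?u
     = - (of_real s * of_real y) * ((?g * (?D * (?k * B))) $$ (i, j) - (?k * (?D * (?k * B))) $$ (i, j))"
    unfolding \<phi>_def \<psi>_def right[OF B(2)] using G(2) B(2) by (simp add: algebra_simps assoc del: index_mult_mat)
  also have "\<dots> = of_real (s\<^sup>2 * y\<^sup>2) * (?g * ?D * (?k * (?D * (?k * B)))) $$ (i, j)"
    by (subst right) (use G(2) B(2) in \<open>auto simp: power2_eq_square algebra_simps simp del: index_mult_mat\<close>)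
  also have "?g * ?D * (?k * (?D * (?k * B))) = ?g * ?D * (?k * ?D * (?k * B))"
    using G(2) B(2) by (simp add: assoc)
  finally have E: "?u
      = of_real (s\<^sup>2 * y\<^sup>2) * (?g * ?D * (?k * ?D * (?k * B))) $$ (i, j)" .
  have "cmod ?u
      = s\<^sup>2 * y\<^sup>2 * cmod ((?g * ?D * (?k * ?D * (?k * B))) $$ (i, j))"
    unfolding E norm_mult norm_of_real abs_mult by simp
  also have "\<dots> \<le> s\<^sup>2 * y\<^sup>2 * (c ^ 3 * b)"
    by (rule mult_left_mono[OF bd3[unfolded c3]]) simp
  finally have "cmod ?u \<le> s\<^sup>2 * y\<^sup>2 * (c ^ 3 * b)" .
  thus "cmod ?u \<le> 2 * s\<^sup>2 * c ^ 3 * b * y\<^sup>2"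
    using nn by (simp add: mult_ac)
  have "?v
    = - of_real s * (((?g * (?D * (?g * B))) $$ (i, j) - (?k * (?D * (?g * B))) $$ (i, j)) + ((?k * ?D * (?g * B)) $$ (i, j) - (?k * ?D * (?k * B)) $$ (i, j)))"
    unfolding \<psi>_def using G(2) B(2) by (simp add: algebra_simps assoc del: index_mult_mat)
  also have "\<dots> = of_real (s\<^sup>2 * y) * ((?g * ?D * (?k * (?D * (?g * B)))) $$ (i, j) + (?k * ?D * (?g * ?D * (?k * B))) $$ (i, j))"
    unfolding left by (subst right) (use G(2) B(2) in \<open>auto simp: power2_eq_square algebra_simps simp del: index_mult_mat\<close>)
  finally have E': "?v = of_real (s\<^sup>2 * y) *
      ((?g * ?D * (?k * (?D * (?g * B)))) $$ (i, j) + (?k * ?D * (?g * ?D * (?k * B))) $$ (i, j))" .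
  have "cmod ?v
     = s\<^sup>2 * \<bar>y\<bar> * cmod ((?g * ?D * (?k * (?D * (?g * B)))) $$ (i, j) + (?k * ?D * (?g * ?D * (?k * B))) $$ (i, j))"
    unfolding E' norm_mult norm_of_real abs_mult by simp
  also have "\<dots> \<le> s\<^sup>2 * \<bar>y\<bar> * (c ^ 3 * b + c ^ 3 * b)"
    using bd3'[unfolded c3] bd3''[unfolded c3]
    by (intro mult_left_mono norm_triangle_le add_mono) (auto simp del: index_mult_mat)
  finally show "cmod ?v \<le> 2 * s\<^sup>2 * c ^ 3 * b * \<bar>y\<bar>"
    by (simp add: mult_ac)
qed

end

section \<open>Mean and fluctuation of the defect\<close>

lemma measurable_det:
  fixes f :: "'a \<Rightarrow> nat \<Rightarrow> nat \<Rightarrow> complex"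
  assumes "\<And>i j. i < n \<Longrightarrow> j < n \<Longrightarrow> (\<lambda>\<omega>. f \<omega> i j) \<in> borel_measurable N"
  shows "(\<lambda>\<omega>. Determinant.det (Matrix.mat n n (\<lambda>(i, j). f \<omega> i j))) \<in> borel_measurable N"
proof -
  have pl: "p i < n" if "p permutes {0..<n}" "i < n" for p i
    using permutes_in_image[of p "{0..<n}" i] that by simp
  have "Determinant.det (Matrix.mat n n (\<lambda>(i, j). f \<omega> i j))
      = (\<Sum>p | p permutes {0..<n}. signof p * (\<Prod>i = 0..<n. f \<omega> i (p i)))" for \<omega>
    unfolding Determinant.det_def by (auto intro!: sum.cong prod.cong simp: pl)
  moreover have "(\<lambda>\<omega>. \<Sum>p | p permutes {0..<n}. signof p * (\<Prod>i = 0..<n. f \<omega> i (p i))) \<in> borel_measurable N"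
    by (intro borel_measurable_sum borel_measurable_times borel_measurable_prod assms borel_measurable_const)
       (auto simp: pl)
  ultimately show ?thesis by simp
qed

lemma measurable_resolvent_entry:
  assumes X: "\<And>\<omega>. X \<omega> \<in> carrier_mat n n" "\<And>\<omega>. transpose_mat (X \<omega>) = X \<omega>" and z: "Im z \<noteq> 0"
    and m: "\<And>i j. i < n \<Longrightarrow> j < n \<Longrightarrow> (\<lambda>\<omega>. X \<omega> $$ (i, j)) \<in> borel_measurable N"
    and ij: "i < n" "j < n"
  shows "(\<lambda>\<omega>. resolvent (X \<omega>) z $$ (i, j)) \<in> borel_measurable N"
proof -
  define f where "f \<omega> i j = complex_of_real (X \<omega> $$ (i, j)) - z * (if i = j then 1 else 0)" for \<omega> i j
  have fm: "(\<lambda>\<omega>. f \<omega> i j) \<in> borel_measurable N" if "i < n" "j < n" for i j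
    unfolding f_def using m[OF that] by measurable
  have M: "cmat (X \<omega>) - z \<cdot>\<^sub>m 1\<^sub>m n = Matrix.mat n n (\<lambda>(i, j). f \<omega> i j)" for \<omega>
    by (rule eq_matI) (use X(1)[of \<omega>] in \<open>auto simp: f_def\<close>)
  define g where "g a = (if a < j then a else Suc a)" for a
  define h where "h a = (if a < i then a else Suc a)" for a
  have del: "mat_delete (Matrix.mat n n (\<lambda>(i, j). f \<omega> i j)) j i = Matrix.mat (n - 1) (n - 1) (\<lambda>(a, b). f \<omega> (g a) (h b))" for \<omega>
    unfolding mat_delete_def by (rule eq_matI) (auto simp: g_def h_def)
  have "resolvent (X \<omega>) z $$ (i, j) = 1 / Determinant.det (Matrix.mat n n (\<lambda>(i, j). f \<omega> i j)) *
      ((- 1) ^ (j + i) * Determinant.det (Matrix.mat (n - 1) (n - 1) (\<lambda>(a, b). f \<omega> (g a) (h b))))" for \<omega>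
    unfolding resolvent_adj[OF X z] M using ij by (simp add: adj_mat_def cofactor_def del)
  moreover have "(\<lambda>\<omega>. 1 / Determinant.det (Matrix.mat n n (\<lambda>(i, j). f \<omega> i j)) *
      ((- 1) ^ (j + i) * Determinant.det (Matrix.mat (n - 1) (n - 1) (\<lambda>(a, b). f \<omega> (g a) (h b))))) \<in> borel_measurable N"
  proof (intro borel_measurable_times borel_measurable_divide borel_measurable_const measurable_det fm)
    fix a b assume "a < n - 1" "b < n - 1"
    thus "g a < n" "h b < n" by (auto simp: g_def h_def)
  qed
  ultimately show ?thesis by simp
qed

lemma measurable_mult_entry:
  fixes X Y :: "'a \<Rightarrow> complex mat"
  assumes "\<And>\<omega>. X \<omega> \<in> carrier_mat n n" "\<And>\<omega>. Y \<omega> \<in> carrier_mat n n"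
    and "\<And>i j. i < n \<Longrightarrow> j < n \<Longrightarrow> (\<lambda>\<omega>. X \<omega> $$ (i, j)) \<in> borel_measurable N"
    and "\<And>i j. i < n \<Longrightarrow> j < n \<Longrightarrow> (\<lambda>\<omega>. Y \<omega> $$ (i, j)) \<in> borel_measurable N"
    and "i < n" "j < n"
  shows "(\<lambda>\<omega>. (X \<omega> * Y \<omega>) $$ (i, j)) \<in> borel_measurable N"
proof -
  have "(X \<omega> * Y \<omega>) $$ (i, j) = (\<Sum>k<n. X \<omega> $$ (i, k) * Y \<omega> $$ (k, j))" for \<omega>
    using assms(1)[of \<omega>] assms(2)[of \<omega>] assms(5,6) by (auto simp: scalar_prod_def lessThan_atLeast0 intro!: sum.cong)
  moreover have "(\<lambda>\<omega>. \<Sum>k<n. X \<omega> $$ (i, k) * Y \<omega> $$ (k, j)) \<in> borel_measurable N"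
    using assms by (intro borel_measurable_sum borel_measurable_times) auto
  ultimately show ?thesis by simp
qed

lemma measurable_mat_trace:
  fixes X :: "'a \<Rightarrow> complex mat"
  assumes "\<And>\<omega>. X \<omega> \<in> carrier_mat n n"
    and "\<And>i j. i < n \<Longrightarrow> j < n \<Longrightarrow> (\<lambda>\<omega>. X \<omega> $$ (i, j)) \<in> borel_measurable N"
  shows "(\<lambda>\<omega>. mat_trace (X \<omega>)) \<in> borel_measurable N"
proof -
  have "mat_trace (X \<omega>) = (\<Sum>i<n. X \<omega> $$ (i, i))" for \<omega>
    using assms(1)[of \<omega>] by (auto simp: mat_trace_def)
  thus ?thesis using assms(2) by simp
qed

text \<open>The normalized trace of \<open>R\<^sub>A(w) ((A - \<omega>) R\<^sub>P(z) - 1)\<close>, where \<open>R\<close> denotes resolvents, \<open>m\<close> is the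
  normalized trace of \<open>R\<^sub>P(z)\<close> and \<open>\<omega> = z + v m\<close>; here \<open>A - \<omega>\<close> has been written as
  \<open>(A - w) + (w - \<omega>)\<close>, so that only resolvents occur.\<close>

definition defect :: "complex \<Rightarrow> complex \<Rightarrow> complex \<Rightarrow> real mat \<Rightarrow> real mat \<Rightarrow> complex" where
  "defect v z w A P = (let n = of_nat (dim_row A); m = mat_trace (resolvent P z) / n in
     m + (w - z - v * m) * (mat_trace (resolvent A w * resolvent P z) / n) - mat_trace (resolvent A w) / n)"

lemma measurable_defect:
  assumes A: "\<And>\<omega>. A \<omega> \<in> carrier_mat n n" "\<And>\<omega>. transpose_mat (A \<omega>) = A \<omega>" and z: "Im z \<noteq> 0"
    and P: "\<And>\<omega>. P \<omega> \<in> carrier_mat n n" "\<And>\<omega>. transpose_mat (P \<omega>) = P \<omega>" and w: "Im w \<noteq> 0"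
    and m: "\<And>i j. i < n \<Longrightarrow> j < n \<Longrightarrow> (\<lambda>\<omega>. A \<omega> $$ (i, j)) \<in> borel_measurable N"
      "\<And>i j. i < n \<Longrightarrow> j < n \<Longrightarrow> (\<lambda>\<omega>. P \<omega> $$ (i, j)) \<in> borel_measurable N"
  shows "(\<lambda>\<omega>. defect v z w (A \<omega>) (P \<omega>)) \<in> borel_measurable N"
proof -
  have dim: "dim_row (A \<omega>) = n" for \<omega> using A(1)[of \<omega>] by simp
  have 1: "(\<lambda>\<omega>. resolvent (A \<omega>) w $$ (i, j)) \<in> borel_measurable N" if "i < n" "j < n" for i j
    by (rule measurable_resolvent_entry[OF A w m(1) that])
  have 2: "(\<lambda>\<omega>. resolvent (P \<omega>) z $$ (i, j)) \<in> borel_measurable N" if "i < n" "j < n" for i j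
    by (rule measurable_resolvent_entry[OF P z m(2) that])
  note c = resolvent_carrier[OF A w] resolvent_carrier[OF P z]
  have [measurable]: "(\<lambda>\<omega>. mat_trace (resolvent (A \<omega>) w)) \<in> borel_measurable N"
    "(\<lambda>\<omega>. mat_trace (resolvent (P \<omega>) z)) \<in> borel_measurable N"
    "(\<lambda>\<omega>. mat_trace (resolvent (A \<omega>) w * resolvent (P \<omega>) z)) \<in> borel_measurable N"
    by (rule measurable_mat_trace[OF c(1) 1], assumption+,
        rule measurable_mat_trace[OF c(2) 2], assumption+,
        rule measurable_mat_trace[of _ n], rule mult_carrier_square[OF c(1) c(2)],
        rule measurable_mult_entry[OF c(1) c(2) 1 2])
  show ?thesis unfolding defect_def dim Let_def by measurable
qed

context fixed_perturbation
begin

lemma err_defect: "err x = defect (of_real (\<sigma>\<^sup>2)) z w A (pert x)"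
  using A by (simp add: err_def defect_def m_def t_def G_def B_def Let_def)

lemma pert_entry: "i < n \<Longrightarrow> j < n \<Longrightarrow> pert x $$ (i, j) = A $$ (i, j) + s * x (min i j, max i j)"
  using A by (simp add: pert_def sym_mat_def)

end

locale wigner_perturbation = fixed_perturbation + 
  fixes \<nu> :: "real measure"
  assumes \<nu>: "real_distribution \<nu>" and m4: "integrable \<nu> (\<lambda>x. x ^ 4)"
    and mean: "(\<integral>x. x \<partial>\<nu>) = 0" and var: "(\<integral>x. x\<^sup>2 \<partial>\<nu>) = 1"
begin

definition "P = PiM (tri n) (\<lambda>_. \<nu>)"

sublocale N: real_distribution \<nu> by (rule \<nu>)
sublocale P: prob_space P unfolding P_def by (intro prob_space_PiM N.prob_space_axioms)

lemma measurable_coord: "p \<in> tri n \<Longrightarrow> (\<lambda>x. x p) \<in> borel_measurable P"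
  unfolding P_def by (simp add: measurable_component_singleton cong: measurable_cong_sets)

lemma measurable_pert: "i < n \<Longrightarrow> j < n \<Longrightarrow> (\<lambda>x. pert x $$ (i, j)) \<in> borel_measurable P"
  using measurable_coord[OF min_max_tri[of i n j]] by (simp add: pert_entry)

lemma measurable_G: "i < n \<Longrightarrow> j < n \<Longrightarrow> (\<lambda>x. G x $$ (i, j)) \<in> borel_measurable P"
  unfolding G_def by (rule measurable_resolvent_entry[OF pert _ measurable_pert]) (use z in auto)

lemma measurable_GB: "i < n \<Longrightarrow> j < n \<Longrightarrow> (\<lambda>x. (G x * B) $$ (i, j)) \<in> borel_measurable P"
  by (rule measurable_mult_entry[OF G(2) B(2) measurable_G]) auto

lemma measurable_err: "err \<in> borel_measurable P"
  unfolding err_defect by (rule measurable_defect[OF A _ pert w _ measurable_pert]) (use z in auto)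

lemma measurable_phi: "i < n \<Longrightarrow> j < n \<Longrightarrow> \<phi> i j \<in> borel_measurable P"
  unfolding \<phi>_def by (rule measurable_GB)

lemma measurable_psi: "i < n \<Longrightarrow> j < n \<Longrightarrow> \<psi> i j \<in> borel_measurable P"
  unfolding \<psi>_def
  by (intro borel_measurable_times borel_measurable_const
      measurable_mult_entry[where X="\<lambda>x. G x * sym_unit n (min i j) (max i j)" and Y="\<lambda>x. G x * B" and n=n]
      measurable_mult_entry[where X=G and Y="\<lambda>x. sym_unit n (min i j) (max i j)" and n=n]
      measurable_G measurable_GB mult_carrier_square sym_unit_carrier G B)

lemma measurable_R: "R \<in> borel_measurable P"
  unfolding R_def
  by (intro borel_measurable_diff borel_measurable_sum borel_measurable_times measurable_mat_trace[where n=n]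
      measurable_mult_entry[where X=G and Y="\<lambda>x. G x * B" and n=n]
      measurable_G measurable_GB mult_carrier_square G B) auto

definition "\<kappa> = (\<integral>y. \<bar>y\<bar> ^ 3 + \<bar>y\<bar> \<partial>\<nu>)"

text \<open>Each of the \<open>n\<^sup>2\<close> terms of \<open>err_decomp\<close> carries the factor \<open>s / n\<close> and has mean \<open>O(s\<^sup>2)\<close>, so their
  sum is of order \<open>n s\<^sup>3\<close>, that is \<open>n\<^sup>-\<^sup>1\<^sup>/\<^sup>2\<close>. The term with \<open>R\<close> is of order \<open>n\<^sup>-\<^sup>1\<close>.\<close>

lemma mean_err: "cmod (\<integral>x. err x \<partial>P) \<le> (2 * \<bar>\<sigma>\<bar> ^ 3 * c ^ 3 * b * \<kappa> + 2 * \<sigma>\<^sup>2 * c\<^sup>2 * b) / sqrt n"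
proof -
  define K where "K = 2 * s\<^sup>2 * c ^ 3 * b"
  have st: "integrable P (\<lambda>x. of_real (x (min i j, max i j)) * \<phi> i j x - \<psi> i j x)"
      "cmod (\<integral>x. of_real (x (min i j, max i j)) * \<phi> i j x - \<psi> i j x \<partial>P) \<le> K * \<kappa>"
    if ij: "i < n" "j < n" for i j
  proof -
    have bd: "cmod (\<phi> i j x) \<le> c * b + \<bar>s\<bar> * (c * 1 * (c * b))" "cmod (\<psi> i j x) \<le> c * b + \<bar>s\<bar> * (c * 1 * (c * b))" for x
      using phi_bound[OF ij, of x] psi_bound[OF ij, of x] c0 b0 by (auto intro: order_trans)
    note S = stein_coordinate[OF \<nu> m4 mean var finite_tri min_max_tri[OF ij]
        measurable_phi[OF ij, unfolded P_def] measurable_psi[OF ij, unfolded P_def] bd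
        phi_psi_expand[OF ij refl, folded K_def]]
    show "integrable P (\<lambda>x. of_real (x (min i j, max i j)) * \<phi> i j x - \<psi> i j x)"
      using S(1) unfolding P_def .
    show "cmod (\<integral>x. of_real (x (min i j, max i j)) * \<phi> i j x - \<psi> i j x \<partial>P) \<le> K * \<kappa>"
      using S(2) unfolding P_def \<kappa>_def .
  qed
  have iR: "integrable P R" by (rule P.integrable_bounded[OF measurable_R R_bound])
  have "(\<integral>x. err x \<partial>P) = - of_real (s / n) * (\<Sum>i<n. \<Sum>j<n. (\<integral>x. of_real (x (min i j, max i j)) * \<phi> i j x - \<psi> i j x \<partial>P))
      + of_real (s\<^sup>2 / n) * (\<integral>x. R x \<partial>P)"
  proof -
    let ?f = "\<lambda>i j x. of_real (x (min i j, max i j)) * \<phi> i j x - \<psi> i j x"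
    have S: "integrable P (\<lambda>x. \<Sum>i<n. \<Sum>j<n. ?f i j x)"
      using st(1) by (intro Bochner_Integration.integrable_sum) auto
    have "(\<integral>x. (\<Sum>i<n. \<Sum>j<n. ?f i j x) \<partial>P) = (\<Sum>i<n. \<integral>x. (\<Sum>j<n. ?f i j x) \<partial>P)"
      using st(1) by (intro Bochner_Integration.integral_sum Bochner_Integration.integrable_sum) auto
    also have "\<dots> = (\<Sum>i<n. \<Sum>j<n. (\<integral>x. ?f i j x \<partial>P))"
      using st(1) by (intro sum.cong refl Bochner_Integration.integral_sum) auto
    finally have E: "(\<integral>x. (\<Sum>i<n. \<Sum>j<n. ?f i j x) \<partial>P) = (\<Sum>i<n. \<Sum>j<n. (\<integral>x. ?f i j x \<partial>P))" .
    have "(\<integral>x. err x \<partial>P) = (\<integral>x. - of_real (s / n) * (\<Sum>i<n. \<Sum>j<n. ?f i j x) \<partial>P) + (\<integral>x. of_real (s\<^sup>2 / n) * R x \<partial>P)"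
      unfolding err_decomp by (rule Bochner_Integration.integral_add; rule integrable_mult_right) (use S iR in auto)
    thus ?thesis unfolding E[symmetric] integral_mult_right_zero .
  qed
  also have "cmod \<dots> \<le> \<bar>s\<bar> / n * (\<Sum>i<n. \<Sum>j<n. K * \<kappa>) + s\<^sup>2 / n * (2 * n * (c * (c * b)))"
  proof (intro norm_triangle_le add_mono)
    show "cmod (- of_real (s / n) * (\<Sum>i<n. \<Sum>j<n. (\<integral>x. of_real (x (min i j, max i j)) * \<phi> i j x - \<psi> i j x \<partial>P)))
      \<le> \<bar>s\<bar> / n * (\<Sum>i<n. \<Sum>j<n. K * \<kappa>)"
      unfolding norm_mult
      by (intro mult_mono order_trans[OF norm_sum] sum_mono st(2)) (auto simp: norm_divide intro!: sum_nonneg)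
    have "cmod (\<integral>x. R x \<partial>P) \<le> (\<integral>x. 2 * n * (c * (c * b)) \<partial>P)"
      by (rule integral_norm_bound_integral') (use R_bound in auto)
    hence "cmod (\<integral>x. R x \<partial>P) \<le> 2 * n * (c * (c * b))" by (simp add: P.prob_space)
    thus "cmod (of_real (s\<^sup>2 / n) * (\<integral>x. R x \<partial>P)) \<le> s\<^sup>2 / n * (2 * n * (c * (c * b)))"
      unfolding norm_mult by (intro mult_mono) (auto simp: norm_divide norm_power)
  qed
  also have "\<dots> = 2 * (\<bar>s\<bar> ^ 3 * n) * c ^ 3 * b * \<kappa> + 2 * s\<^sup>2 * c\<^sup>2 * b"
    using n by (simp add: K_def power2_eq_square power3_eq_cube field_simps)
  also have "\<bar>s\<bar> ^ 3 * n = \<bar>\<sigma>\<bar> ^ 3 / sqrt n"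
  proof -
    have "\<bar>s\<bar> ^ 3 * n = \<bar>s\<bar> * (s\<^sup>2 * n)" by (simp add: power3_eq_cube power2_eq_square)
    also have "\<dots> = \<bar>\<sigma>\<bar> / sqrt n * \<sigma>\<^sup>2" unfolding s2 by (simp add: s_def abs_divide)
    finally show ?thesis by (simp add: power3_eq_cube power2_eq_square)
  qed
  also have "2 * s\<^sup>2 * c\<^sup>2 * b \<le> 2 * (\<sigma>\<^sup>2 / sqrt n) * c\<^sup>2 * b"
  proof -
    have "sqrt n \<le> n" using n by (simp add: real_le_lsqrt sqrt_le_D real_sqrt_le_iff' power2_eq_square)
    hence "\<sigma>\<^sup>2 / n \<le> \<sigma>\<^sup>2 / sqrt n" using n by (intro divide_left_mono) auto
    thus ?thesis using b0 c0 n by (intro mult_right_mono) (auto simp: s_def power_divide)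
  qed
  finally show ?thesis by (simp add: add_divide_distrib mult_ac)
qed

definition "C4 = 4 * (\<integral>y. (\<bar>y\<bar> + (\<integral>x. \<bar>x\<bar> \<partial>\<nu>))\<^sup>2 \<partial>\<nu>)\<^sup>2 + 3 * (\<integral>y. (\<bar>y\<bar> + (\<integral>x. \<bar>x\<bar> \<partial>\<nu>)) ^ 4 \<partial>\<nu>)"

text \<open>There are at most \<open>n\<^sup>2\<close> variables and the Lipschitz constant is \<open>O(n\<^sup>-\<^sup>3\<^sup>/\<^sup>2)\<close>, so the bound is of order
  \<open>n\<^sup>4 n\<^sup>-\<^sup>6\<close>, which is summable.\<close>

lemma fourth_moment:
  assumes f: "f \<in> borel_measurable P" "\<And>x. \<bar>f x\<bar> \<le> K"
    and l: "\<And>x p y. p \<in> tri n \<Longrightarrow> \<bar>f (x(p := y)) - f x\<bar> \<le> cmod (err (x(p := y)) - err x)"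
  shows "(\<integral>x. (f x - (\<integral>x. f x \<partial>P)) ^ 4 \<partial>P) \<le> Lip ^ 4 * C4 / n\<^sup>2"
proof -
  have L0: "0 \<le> Lip / (n * sqrt n)" using c0 b0 by (simp add: Lip_def)
  have "(\<integral>x. (f x - (\<integral>x. f x \<partial>P)) ^ 4 \<partial>P) \<le> (card (tri n))\<^sup>2 * ((Lip / (n * sqrt n)) ^ 4 * C4)"
    unfolding P_def C4_def
    by (rule coordinate_lipschitz_moments[THEN conjunct2, OF \<nu> m4 L0 finite_tri f(1)[unfolded P_def] f(2)],
        rule order_trans[OF l err_lipschitz])
  also have "\<dots> \<le> (real n ^ 2)\<^sup>2 * ((Lip / (n * sqrt n)) ^ 4 * C4)"
  proof -
    have "real ((card (tri n))\<^sup>2) \<le> (real n ^ 2)\<^sup>2"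
      using card_tri[of n] by (metis of_nat_le_iff of_nat_power power_mono zero_le)
    thus ?thesis by (intro mult_right_mono) (auto simp: C4_def)
  qed
  also have "\<dots> = Lip ^ 4 * C4 / n\<^sup>2"
  proof -
    have "sqrt n ^ 4 = (real n)\<^sup>2" using n by (simp add: power4_eq_xxxx power2_eq_square)
    thus ?thesis using n by (simp add: power_divide power_mult_distrib field_simps power2_eq_square power4_eq_xxxx)
  qed
  finally show ?thesis .
qed

text \<open>Once the mean is below \<open>\<epsilon> / 2\<close>, a value of modulus \<open>\<epsilon>\<close> forces the real or the imaginary part
  to deviate from its mean by \<open>\<epsilon> / 4\<close>; then Markov's inequality for the fourth moment applies.\<close>

lemma tail_err:
  assumes e: "\<epsilon> > 0" and small: "(2 * \<bar>\<sigma>\<bar> ^ 3 * c ^ 3 * b * \<kappa> + 2 * \<sigma>\<^sup>2 * c\<^sup>2 * b) / sqrt n \<le> \<epsilon> / 2"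
  shows "measure P {x \<in> space P. \<epsilon> \<le> cmod (err x)} \<le> 512 * Lip ^ 4 * C4 / \<epsilon> ^ 4 / n\<^sup>2"
proof -
  define K where "K = c + (cmod (w - z) + \<sigma>\<^sup>2 * c) * (b * c) + b"
  define e0 where "e0 = (\<integral>x. err x \<partial>P)"
  note [measurable] = measurable_err
  have ie: "integrable P err" by (rule P.integrable_bounded[OF measurable_err err_bound])
  have eR: "Re e0 = (\<integral>x. Re (err x) \<partial>P)" and eI: "Im e0 = (\<integral>x. Im (err x) \<partial>P)"
    unfolding e0_def using integral_bounded_linear[OF bounded_linear_Re ie] integral_bounded_linear[OF bounded_linear_Im ie] by simp_all
  have R4: "(\<integral>x. (Re (err x) - Re e0) ^ 4 \<partial>P) \<le> Lip ^ 4 * C4 / n\<^sup>2"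
    unfolding eR
  proof (rule fourth_moment)
    show "\<bar>Re (err x)\<bar> \<le> K" for x
      using abs_Re_le_cmod[of "err x"] err_bound[of x] unfolding K_def by linarith
    show "\<bar>Re (err (x(p := y))) - Re (err x)\<bar> \<le> cmod (err (x(p := y)) - err x)" for x p y
      using abs_Re_le_cmod[of "err (x(p := y)) - err x"] by simp
  qed simp
  have I4: "(\<integral>x. (Im (err x) - Im e0) ^ 4 \<partial>P) \<le> Lip ^ 4 * C4 / n\<^sup>2"
    unfolding eI
  proof (rule fourth_moment)
    show "\<bar>Im (err x)\<bar> \<le> K" for x
      using abs_Im_le_cmod[of "err x"] err_bound[of x] unfolding K_def by linarith
    show "\<bar>Im (err (x(p := y))) - Im (err x)\<bar> \<le> cmod (err (x(p := y)) - err x)" for x p y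
      using abs_Im_le_cmod[of "err (x(p := y)) - err x"] by simp
  qed simp
  have iR: "integrable P (\<lambda>x. (Re (err x) - Re e0) ^ 4)" and iI: "integrable P (\<lambda>x. (Im (err x) - Im e0) ^ 4)"
  proof -
    have "\<bar>Re (err x) - Re e0\<bar> \<le> K + cmod e0" "\<bar>Im (err x) - Im e0\<bar> \<le> K + cmod e0" for x
      using abs_Re_le_cmod[of "err x"] abs_Im_le_cmod[of "err x"] err_bound[of x] abs_Re_le_cmod[of e0] abs_Im_le_cmod[of e0]
      unfolding K_def by linarith+
    hence "norm ((Re (err x) - Re e0) ^ 4) \<le> (K + cmod e0) ^ 4" "norm ((Im (err x) - Im e0) ^ 4) \<le> (K + cmod e0) ^ 4" for x
      unfolding real_norm_def power_abs by (intro power_mono; simp)+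
    thus "integrable P (\<lambda>x. (Re (err x) - Re e0) ^ 4)" "integrable P (\<lambda>x. (Im (err x) - Im e0) ^ 4)"
      by (auto intro!: P.integrable_bounded)
  qed
  have m0: "cmod e0 \<le> \<epsilon> / 2" using mean_err small unfolding e0_def by linarith
  let ?S = "{x \<in> space P. \<epsilon> \<le> cmod (err x)}" and ?q = "\<lambda>x. (Re (err x) - Re e0) ^ 4 + (Im (err x) - Im e0) ^ 4"
  have S[measurable]: "?S \<in> sets P" by measurable
  have "measure P ?S = (\<integral>x. indicator ?S x \<partial>P)" by simp
  also have "\<dots> \<le> (\<integral>x. (4 / \<epsilon>) ^ 4 * ?q x \<partial>P)"
  proof (rule integral_mono')
    show "integrable P (\<lambda>x. (4 / \<epsilon>) ^ 4 * ?q x)"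
      using iR iI by simp
    show nn: "0 \<le> (4 / \<epsilon>) ^ 4 * ?q x" for x by simp
    show "indicator ?S x \<le> (4 / \<epsilon>) ^ 4 * ?q x" for x
    proof (cases "x \<in> ?S")
      case True
      have "\<epsilon> / 2 \<le> cmod (err x - e0)"
        using True m0 norm_triangle_ineq2[of "err x" e0] by auto
      also have "\<dots> \<le> \<bar>Re (err x) - Re e0\<bar> + \<bar>Im (err x) - Im e0\<bar>"
        using cmod_le[of "err x - e0"] by simp
      finally have "\<epsilon> / 4 \<le> \<bar>Re (err x) - Re e0\<bar> \<or> \<epsilon> / 4 \<le> \<bar>Im (err x) - Im e0\<bar>" by linarith
      hence "(\<epsilon> / 4) ^ 4 \<le> \<bar>Re (err x) - Re e0\<bar> ^ 4 + \<bar>Im (err x) - Im e0\<bar> ^ 4"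
      proof
        assume "\<epsilon> / 4 \<le> \<bar>Re (err x) - Re e0\<bar>"
        hence "(\<epsilon> / 4) ^ 4 \<le> \<bar>Re (err x) - Re e0\<bar> ^ 4" using e by (intro power_mono) auto
        moreover have "0 \<le> \<bar>Im (err x) - Im e0\<bar> ^ 4" by simp
        ultimately show ?thesis by linarith
      next
        assume "\<epsilon> / 4 \<le> \<bar>Im (err x) - Im e0\<bar>"
        hence "(\<epsilon> / 4) ^ 4 \<le> \<bar>Im (err x) - Im e0\<bar> ^ 4" using e by (intro power_mono) auto
        moreover have "0 \<le> \<bar>Re (err x) - Re e0\<bar> ^ 4" by simp
        ultimately show ?thesis by linarith
      qed
      hence "(4 / \<epsilon>) ^ 4 * (\<epsilon> / 4) ^ 4 \<le> (4 / \<epsilon>) ^ 4 * ?q x"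
        by (intro mult_left_mono) auto
      moreover have "(4 / \<epsilon>) ^ 4 * (\<epsilon> / 4) ^ 4 = 1" using e by (simp add: flip: power_mult_distrib)
      ultimately show ?thesis using True by simp
    qed (use nn in auto)
  qed
  also have "\<dots> = (4 / \<epsilon>) ^ 4 * ((\<integral>x. (Re (err x) - Re e0) ^ 4 \<partial>P) + (\<integral>x. (Im (err x) - Im e0) ^ 4 \<partial>P))"
    using iR iI by simp
  also have "\<dots> \<le> (4 / \<epsilon>) ^ 4 * (Lip ^ 4 * C4 / n\<^sup>2 + Lip ^ 4 * C4 / n\<^sup>2)"
    using R4 I4 by (intro mult_left_mono add_mono) auto
  also have "\<dots> = 512 * Lip ^ 4 * C4 / \<epsilon> ^ 4 / n\<^sup>2" by (simp add: power_divide)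
  finally show ?thesis .
qed

end

text \<open>For each \<open>n\<close> the joint law of \<open>A n\<close> and the noise is a product, so the tail bound, which is
  uniform in the fixed matrix, integrates to a tail bound for the random one. The bounds are
  summable, whatever the dependence between different \<open>n\<close>, and Borel-Cantelli applies. The
  symmetric matrices are encoded by their entries in \<open>tri n\<close>: then every point of the product
  space defines a symmetric matrix, and the defect is measurable on all of it.\<close>

lemma AE_defect_tendsto_0:
  fixes M :: "'w measure" and A :: "nat \<Rightarrow> 'w \<Rightarrow> real mat" and Z :: "nat \<Rightarrow> nat \<Rightarrow> 'w \<Rightarrow> real"
  assumes "prob_space M"
    and A_dim: "\<And>n \<omega>. \<omega> \<in> space M \<Longrightarrow> A n \<omega> \<in> carrier_mat n n"
    and A_sym: "\<And>n \<omega>. \<omega> \<in> space M \<Longrightarrow> transpose_mat (A n \<omega>) = A n \<omega>"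
    and Z_sym: "\<And>i j \<omega>. \<omega> \<in> space M \<Longrightarrow> Z i j \<omega> = Z j i \<omega>"
    and Z_indep: "prob_space.indep_vars M (\<lambda>_. borel) (\<lambda>(i, j). Z i j) {(i, j). i \<le> j}"
    and Z_distr: "\<And>i j. i \<le> j \<Longrightarrow> distr M borel (Z i j) = distr M borel (Z 0 0)"
    and Z_mean: "prob_space.expectation M (Z 0 0) = 0"
    and Z_var: "prob_space.variance M (Z 0 0) = 1"
    and Z_fourth: "integrable M (\<lambda>\<omega>. Z 0 0 \<omega> ^ 4)"
    and AZ_indep: "\<And>n. prob_space.indep_var M
          (\<Pi>\<^sub>M p\<in>{..<n} \<times> {..<n}. borel) (\<lambda>\<omega>. \<lambda>p\<in>{..<n} \<times> {..<n}. A n \<omega> $$ p)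
          (\<Pi>\<^sub>M p\<in>{..<n} \<times> {..<n}. borel) (\<lambda>\<omega>. \<lambda>p\<in>{..<n} \<times> {..<n}. Z (fst p) (snd p) \<omega>)"
    and z: "Im z > 0" and w: "Im w \<noteq> 0"
  shows "AE \<omega> in M. (\<lambda>n. defect (of_real (\<sigma>\<^sup>2)) z w (A n \<omega>) (perturbed \<sigma> (A n \<omega>) (\<lambda>i j. Z i j \<omega>))) \<longlonglongrightarrow> 0"
proof -
  interpret prob_space M by fact
  define \<nu> where "\<nu> = distr M borel (Z 0 0)"
  have Zm[measurable]: "Z i j \<in> borel_measurable M" if "i \<le> j" for i j
    using Z_indep that unfolding indep_vars_def by force
  have nu: "real_distribution \<nu>" unfolding \<nu>_def by simp
  have m4: "integrable \<nu> (\<lambda>x. x ^ 4)" using Z_fourth unfolding \<nu>_def by (subst integrable_distr_eq) auto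
  have mean: "(\<integral>x. x \<partial>\<nu>) = 0" using Z_mean unfolding \<nu>_def by (subst integral_distr) auto
  have var: "(\<integral>x. x\<^sup>2 \<partial>\<nu>) = 1" using Z_var Z_mean unfolding \<nu>_def by (subst integral_distr) auto
  define a where "a n \<omega> = (\<lambda>p\<in>tri n. A n \<omega> $$ p)" for n \<omega>
  define x where "x n \<omega> = (\<lambda>p\<in>tri n. Z (fst p) (snd p) \<omega>)" for n \<omega>
  let ?B = "\<lambda>n. PiM (tri n) (\<lambda>_. borel :: real measure)"
  let ?D = "\<lambda>n (a, x). defect (of_real (\<sigma>\<^sup>2)) z w (sym_mat n a) (sym_mat n a + (\<sigma> / sqrt n) \<cdot>\<^sub>m sym_mat n x)"
  have ind: "indep_var (?B n) (a n) (?B n) (x n)" for n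
  proof -
    have r: "(\<lambda>f. restrict f (tri n)) \<in> measurable (\<Pi>\<^sub>M p\<in>{..<n} \<times> {..<n}. borel) (?B n)"
      by (rule measurable_restrict_subset[OF tri_subset])
    have "indep_var (?B n) ((\<lambda>f. restrict f (tri n)) \<circ> (\<lambda>\<omega>. \<lambda>p\<in>{..<n} \<times> {..<n}. A n \<omega> $$ p))
       (?B n) ((\<lambda>f. restrict f (tri n)) \<circ> (\<lambda>\<omega>. \<lambda>p\<in>{..<n} \<times> {..<n}. Z (fst p) (snd p) \<omega>))"
      by (rule indep_var_compose[OF AZ_indep r r])
    moreover have "restrict (restrict f ({..<n} \<times> {..<n})) (tri n) = restrict f (tri n)" for f :: "nat \<times> nat \<Rightarrow> real"
      using tri_subset[of n] by (auto simp: restrict_def fun_eq_iff)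
    ultimately show ?thesis by (simp add: o_def a_def[abs_def] x_def[abs_def])
  qed
  have am[measurable]: "a n \<in> measurable M (?B n)" and xm[measurable]: "x n \<in> measurable M (?B n)" for n
    using indep_var_rv1[OF ind[of n]] indep_var_rv2[OF ind[of n]] by auto
  have dx: "distr M (?B n) (x n) = PiM (tri n) (\<lambda>_. \<nu>)" if "n > 0" for n
  proof -
    have ne: "tri n \<noteq> {}" using that by (auto simp: tri_def)
    have sub: "tri n \<subseteq> {(i, j). i \<le> j}" by (auto simp: tri_def)
    have "distr M (?B n) (\<lambda>\<omega>. \<lambda>p\<in>tri n. (case p of (i, j) \<Rightarrow> Z i j) \<omega>) = PiM (tri n) (\<lambda>p. distr M borel (case p of (i, j) \<Rightarrow> Z i j))"
      by (subst indep_vars_iff_distr_eq_PiM'[symmetric, OF ne])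
         (use indep_vars_subset[OF Z_indep sub] in \<open>auto simp: tri_def\<close>)
    also have "\<dots> = PiM (tri n) (\<lambda>_. \<nu>)"
    proof (rule PiM_cong[OF refl])
      fix p assume "p \<in> tri n"
      then obtain i j where p: "p = (i, j)" "i \<le> j" by (cases p) (auto simp: tri_def)
      show "distr M borel (case p of (i, j) \<Rightarrow> Z i j) = \<nu>"
        unfolding p(1) prod.case \<nu>_def by (rule Z_distr[OF p(2)])
    qed
    finally show ?thesis by (simp add: x_def[abs_def] case_prod_beta)
  qed
  have Dm: "?D n \<in> borel_measurable (?B n \<Otimes>\<^sub>M ?B n)" for n
  proof -
    have "(\<lambda>p. defect (of_real (\<sigma>\<^sup>2)) z w (sym_mat n (fst p)) (sym_mat n (fst p) + (\<sigma> / sqrt n) \<cdot>\<^sub>m sym_mat n (snd p)))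
        \<in> borel_measurable (?B n \<Otimes>\<^sub>M ?B n)"
    proof (rule measurable_defect[where n=n])
      have e: "(sym_mat n a + t \<cdot>\<^sub>m sym_mat n x) $$ (i, j) = a (min i j, max i j) + t * x (min i j, max i j)"
        if "i < n" "j < n" for i j a x t using that by (simp add: sym_mat_def)
      show "transpose_mat (sym_mat n (fst p) + (\<sigma> / sqrt n) \<cdot>\<^sub>m sym_mat n (snd p)) = sym_mat n (fst p) + (\<sigma> / sqrt n) \<cdot>\<^sub>m sym_mat n (snd p)"
        for p :: "(nat \<times> nat \<Rightarrow> real) \<times> (nat \<times> nat \<Rightarrow> real)"
        by (rule eq_matI) (auto simp: sym_mat_def min.commute max.commute)
      show "sym_mat n (fst p) + (\<sigma> / sqrt n) \<cdot>\<^sub>m sym_mat n (snd p) \<in> carrier_mat n n"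
        for p :: "(nat \<times> nat \<Rightarrow> real) \<times> (nat \<times> nat \<Rightarrow> real)" by simp
      fix i j assume ij: "i < n" "j < n"
      have [measurable]: "(\<lambda>f. f (min i j, max i j)) \<in> borel_measurable (?B n)"
        using min_max_tri[OF ij] by simp
      show "(\<lambda>p. sym_mat n (fst p) $$ (i, j)) \<in> borel_measurable (?B n \<Otimes>\<^sub>M ?B n)"
        using ij by (simp add: sym_mat_def)
      show "(\<lambda>p. (sym_mat n (fst p) + (\<sigma> / sqrt n) \<cdot>\<^sub>m sym_mat n (snd p)) $$ (i, j)) \<in> borel_measurable (?B n \<Otimes>\<^sub>M ?B n)"
        unfolding e[OF ij] by measurable
    qed (use z w sym_mat_sym in auto)
    thus ?thesis by (simp add: case_prod_beta')
  qed
  have D_eq: "?D n (a n \<omega>, x n \<omega>) = defect (of_real (\<sigma>\<^sup>2)) z w (A n \<omega>) (perturbed \<sigma> (A n \<omega>) (\<lambda>i j. Z i j \<omega>))"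
    if "\<omega> \<in> space M" for n \<omega>
  proof -
    have 1: "sym_mat n (a n \<omega>) = A n \<omega>"
      using A_dim[OF that, of n] sym_entry[OF A_dim A_sym, OF that that, of _ n]
      by (intro eq_matI) (auto simp: sym_mat_def a_def min_def max_def tri_def)
    have 2: "sym_mat n (x n \<omega>) = Matrix.mat n n (\<lambda>(i, j). Z i j \<omega>)"
      using Z_sym[OF that] by (intro eq_matI) (auto simp: sym_mat_def x_def min_def max_def tri_def)
    show ?thesis using A_dim[OF that, of n] by (simp add: 1 2 perturbed_def)
  qed
  define C1 C2 where "C1 = 2 * \<bar>\<sigma>\<bar> ^ 3 * fixed_perturbation.c z ^ 3 * fixed_perturbation.b w * wigner_perturbation.\<kappa> \<nu> + 2 * \<sigma>\<^sup>2 * (fixed_perturbation.c z)\<^sup>2 * fixed_perturbation.b w"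
    and "C2 = 512 * fixed_perturbation.Lip \<sigma> z w ^ 4 * wigner_perturbation.C4 \<nu>"
  have tail: "measure M {\<omega> \<in> space M. \<epsilon> \<le> cmod (?D n (a n \<omega>, x n \<omega>))} \<le> C2 / \<epsilon> ^ 4 / n\<^sup>2"
    if n: "n > 0" and e: "\<epsilon> > 0" and small: "C1 / sqrt n \<le> \<epsilon> / 2" for n \<epsilon>
  proof -
    let ?Da = "distr M (?B n) (a n)" and ?P = "PiM (tri n) (\<lambda>_. \<nu>)"
    have W: "wigner_perturbation n (sym_mat n a') z w \<nu>" for a'
      by (intro wigner_perturbation.intro fixed_perturbation.intro wigner_perturbation_axioms.intro)
         (rule n sym_mat_carrier sym_mat_sym z w nu m4 mean var)+
    interpret Da: prob_space ?Da by (rule prob_space_distr) measurable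
    interpret Q: prob_space ?P using nu by (intro prob_space_PiM) (simp add: real_distribution_def)
    have sP[measurable_cong]: "sets ?P = sets (?B n)"
      by (rule sets_PiM_cong) (auto simp: \<nu>_def)
    let ?E = "{p \<in> space (?B n \<Otimes>\<^sub>M ?B n). \<epsilon> \<le> cmod (?D n p)}"
    have E: "?E \<in> sets (?B n \<Otimes>\<^sub>M ?B n)" using Dm[of n] by measurable
    have E': "?E \<in> sets (?Da \<Otimes>\<^sub>M ?P)"
      using E by (simp add: sP cong: sets_pair_measure_cong)
    have joint: "distr M (?B n \<Otimes>\<^sub>M ?B n) (\<lambda>\<omega>. (a n \<omega>, x n \<omega>)) = ?Da \<Otimes>\<^sub>M ?P"
      using ind[of n] unfolding indep_var_distribution_eq dx[OF n] by simp
    have C20: "0 \<le> C2 / \<epsilon> ^ 4 / n\<^sup>2"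
    proof -
      interpret wigner_perturbation n "sym_mat n (\<lambda>_. 0)" \<sigma> z w \<nu>
        by (rule W)
      show ?thesis using e by (simp add: C2_def C4_def)
    qed
    have "emeasure M {\<omega> \<in> space M. \<epsilon> \<le> cmod (?D n (a n \<omega>, x n \<omega>))}
        = emeasure (distr M (?B n \<Otimes>\<^sub>M ?B n) (\<lambda>\<omega>. (a n \<omega>, x n \<omega>))) ?E"
      using E measurable_space[OF am[of n]] measurable_space[OF xm[of n]]
      by (subst emeasure_distr) (auto intro!: arg_cong[where f="emeasure M"] simp: space_pair_measure)
    also have "\<dots> = (\<integral>\<^sup>+ a. emeasure ?P (Pair a -` ?E) \<partial>?Da)"
      unfolding joint by (rule Q.emeasure_pair_measure_alt[OF E'])
    also have "\<dots> \<le> (\<integral>\<^sup>+ a. ennreal (C2 / \<epsilon> ^ 4 / n\<^sup>2) \<partial>?Da)"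
    proof (rule nn_integral_mono)
      fix a' assume a': "a' \<in> space ?Da"
      interpret W: wigner_perturbation n "sym_mat n a'" \<sigma> z w \<nu>
        by (rule W)
      have "Pair a' -` ?E = {x \<in> space ?P. \<epsilon> \<le> cmod (W.err x)}"
        using a' sets_eq_imp_space_eq[OF sP] unfolding W.err_defect W.pert_def W.s_def
        by (auto simp: space_pair_measure)
      hence "measure ?P (Pair a' -` ?E) \<le> C2 / \<epsilon> ^ 4 / n\<^sup>2"
        using W.tail_err[OF e] small unfolding C1_def C2_def W.P_def by simp
      thus "emeasure ?P (Pair a' -` ?E) \<le> ennreal (C2 / \<epsilon> ^ 4 / n\<^sup>2)"
        unfolding Q.emeasure_eq_measure by (rule ennreal_leI)
    qed
    also have "\<dots> = ennreal (C2 / \<epsilon> ^ 4 / n\<^sup>2)"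
      using Da.emeasure_space_1 by (simp add: nn_integral_const)
    finally show ?thesis
      using C20 by (simp add: emeasure_eq_measure)
  qed
  have ev: "AE \<omega> in M. \<forall>\<^sub>F n in sequentially. cmod (?D n (a n \<omega>, x n \<omega>)) < \<epsilon>" if e: "\<epsilon> > 0" for \<epsilon>
  proof -
    let ?F = "\<lambda>n. {\<omega> \<in> space M. \<epsilon> \<le> cmod (?D n (a n \<omega>, x n \<omega>))}"
    have F: "?F n \<in> sets M" for n
    proof -
      have "(\<lambda>\<omega>. ?D n (a n \<omega>, x n \<omega>)) \<in> borel_measurable M"
        using measurable_compose[OF measurable_Pair[OF am[of n] xm[of n]] Dm[of n]] .
      thus ?thesis by measurable
    qed
    have "(\<lambda>n. C1 / sqrt (real n)) \<longlonglongrightarrow> 0"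
      by (rule tendsto_divide_0[OF tendsto_const]) (rule filterlim_at_top_imp_at_infinity, rule filterlim_compose[OF sqrt_at_top filterlim_real_sequentially])
    hence "\<forall>\<^sub>F n in sequentially. C1 / sqrt (real n) < \<epsilon> / 2"
      by (rule order_tendstoD) (use e in simp)
    hence "\<forall>\<^sub>F n in sequentially. norm (measure M (?F n)) \<le> C2 / \<epsilon> ^ 4 * (1 / (real n)\<^sup>2)"
      using eventually_gt_at_top[of 0]
    proof eventually_elim
      case (elim n)
      have "measure M (?F n) \<le> C2 / \<epsilon> ^ 4 / (real n)\<^sup>2" using tail[OF elim(2) e] elim(1) by linarith
      thus ?case by simp
    qed
    hence "summable (\<lambda>n. measure M (?F n))"
      by (rule summable_comparison_test_ev)
         (intro summable_mult, use inverse_power_summable[of 2, where 'a = real] in \<open>simp add: inverse_eq_divide\<close>)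
    hence "AE \<omega> in M. \<forall>\<^sub>F n in sequentially. \<omega> \<in> space M - ?F n"
      by (intro borel_cantelli_AE1 F) (auto simp: emeasure_eq_measure)
    thus ?thesis by eventually_elim (auto elim!: eventually_mono)
  qed
  have "AE \<omega> in M. \<forall>k. \<forall>\<^sub>F n in sequentially. cmod (?D n (a n \<omega>, x n \<omega>)) < 1 / Suc k"
    unfolding AE_all_countable by (intro allI ev) simp
  with AE_space show ?thesis
  proof eventually_elim
    case (elim \<omega>)
    show ?case
    proof (rule tendstoI)
      fix e :: real assume "e > 0"
      then obtain k where k: "1 / Suc k < e" using nat_approx_posE by metis
      from elim(2) have "\<forall>\<^sub>F n in sequentially. cmod (?D n (a n \<omega>, x n \<omega>)) < 1 / Suc k" by blast
      thus "\<forall>\<^sub>F n in sequentially. dist (defect (of_real (\<sigma>\<^sup>2)) z w (A n \<omega>) (perturbed \<sigma> (A n \<omega>) (\<lambda>i j. Z i j \<omega>))) 0 < e"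
        unfolding D_eq[OF elim(1)] by eventually_elim (use k in simp)
    qed
  qed
qed

section \<open>Stieltjes transforms and the subordination equation\<close>

lemma cmod_diff_real_ge: "\<bar>Im z\<bar> \<le> cmod (of_real x - z)"
  using abs_Im_le_cmod[of "of_real x - z"] by simp

lemma inverse_cmod_diff_le: "Im z \<noteq> 0 \<Longrightarrow> 1 / cmod (of_real x - z) \<le> 1 / \<bar>Im z\<bar>"
  by (rule frac_le) (use cmod_diff_real_ge[of z x] in auto)

context real_distribution
begin

lemma integrable_cauchy_kernel:
  assumes "Im z \<noteq> 0" shows "integrable M (\<lambda>x. 1 / (of_real x - z))"
proof (rule integrable_const_bound[of _ "1 / \<bar>Im z\<bar>"])
  show "AE x in M. norm (1 / (of_real x - z)) \<le> 1 / \<bar>Im z\<bar>"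
    using inverse_cmod_diff_le[OF assms] by (simp add: norm_divide)
qed simp

lemma integrable_cauchy_kernel2:
  assumes "Im z \<noteq> 0" "Im w \<noteq> 0" shows "integrable M (\<lambda>x. 1 / ((of_real x - z) * (of_real x - w)))"
proof (rule integrable_const_bound[of _ "1 / (\<bar>Im z\<bar> * \<bar>Im w\<bar>)"])
  show "AE x in M. norm (1 / ((of_real x - z) * (of_real x - w))) \<le> 1 / (\<bar>Im z\<bar> * \<bar>Im w\<bar>)"
  proof (rule AE_I2)
    fix x
    have "\<bar>Im z\<bar> * \<bar>Im w\<bar> \<le> cmod (of_real x - z) * cmod (of_real x - w)"
      by (intro mult_mono cmod_diff_real_ge) auto
    thus "norm (1 / ((of_real x - z) * (of_real x - w))) \<le> 1 / (\<bar>Im z\<bar> * \<bar>Im w\<bar>)"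
      unfolding norm_divide norm_mult norm_one using assms by (intro frac_le) auto
  qed
qed simp

lemma integrable_cauchy_kernel_norm2:
  assumes "Im z \<noteq> 0" shows "integrable M (\<lambda>x. 1 / (cmod (of_real x - z))\<^sup>2)"
proof (rule integrable_const_bound[of _ "1 / \<bar>Im z\<bar>\<^sup>2"])
  show "AE x in M. norm (1 / (cmod (of_real x - z))\<^sup>2) \<le> 1 / \<bar>Im z\<bar>\<^sup>2"
  proof (rule AE_I2)
    fix x
    have "\<bar>Im z\<bar>\<^sup>2 \<le> (cmod (of_real x - z))\<^sup>2" by (intro power_mono cmod_diff_real_ge) auto
    moreover have "0 < \<bar>Im z\<bar>\<^sup>2" using assms by simp
    ultimately have "1 / (cmod (of_real x - z))\<^sup>2 \<le> 1 / \<bar>Im z\<bar>\<^sup>2" by (intro frac_le) auto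
    thus "norm (1 / (cmod (of_real x - z))\<^sup>2) \<le> 1 / \<bar>Im z\<bar>\<^sup>2" by simp
  qed
qed simp

lemma stieltjes_diff:
  assumes "Im z \<noteq> 0" "Im w \<noteq> 0"
  shows "stieltjes M z - stieltjes M w = (z - w) * (\<integral>x. 1 / ((of_real x - z) * (of_real x - w)) \<partial>M)"
proof -
  have ne: "of_real x \<noteq> z" "of_real x \<noteq> w" for x using assms by auto
  have "stieltjes M z - stieltjes M w = (\<integral>x. 1 / (of_real x - z) - 1 / (of_real x - w) \<partial>M)"
    unfolding stieltjes_def using assms integrable_cauchy_kernel by simp
  also have "\<dots> = (\<integral>x. (z - w) * (1 / ((of_real x - z) * (of_real x - w))) \<partial>M)"
    using ne by (intro Bochner_Integration.integral_cong refl) (simp add: divide_simps)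
  also have "\<dots> = (z - w) * (\<integral>x. 1 / ((of_real x - z) * (of_real x - w)) \<partial>M)"
    by (rule integral_mult_right_zero)
  finally show ?thesis .
qed

lemma Im_stieltjes:
  assumes "Im z \<noteq> 0"
  shows "Im (stieltjes M z) = Im z * (\<integral>x. 1 / (cmod (of_real x - z))\<^sup>2 \<partial>M)"
proof -
  have "Im (stieltjes M z) = (\<integral>x. Im (1 / (of_real x - z)) \<partial>M)"
    unfolding stieltjes_def using integral_bounded_linear[OF bounded_linear_Im integrable_cauchy_kernel[OF assms]] by simp
  also have "\<dots> = (\<integral>x. Im z * (1 / (cmod (of_real x - z))\<^sup>2) \<partial>M)"
    by (intro Bochner_Integration.integral_cong refl) (simp add: Im_divide cmod_power2)
  also have "\<dots> = Im z * (\<integral>x. 1 / (cmod (of_real x - z))\<^sup>2 \<partial>M)"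
    by (rule integral_mult_right_zero)
  finally show ?thesis .
qed

lemma Im_stieltjes_nonneg: "Im z > 0 \<Longrightarrow> Im (stieltjes M z) \<ge> 0"
  using Im_stieltjes[of z] by simp

lemma holomorphic_stieltjes: "stieltjes M holomorphic_on {z. Im z > 0}"
proof (rule holomorphic_onI)
  fix z assume z: "z \<in> {z. Im z > 0}"
  hence z0: "Im z > 0" by simp
  define D where "D = (\<integral>x. 1 / ((of_real x - z) * (of_real x - z)) \<partial>M)"
  have bound: "cmod ((stieltjes M u - stieltjes M z) / (u - z) - D) \<le> 2 / (Im z) ^ 3 * cmod (u - z)"
    if u: "u \<noteq> z" "dist u z < Im z / 2" for u
  proof -
    have "\<bar>Im u - Im z\<bar> < Im z / 2"
      using u(2) abs_Im_le_cmod[of "u - z"] by (simp add: dist_norm)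
    hence iu: "Im u > Im z / 2" by linarith
    hence iu0: "Im u > 0" using z0 by linarith
    have ne: "of_real x \<noteq> z" "of_real x \<noteq> u" for x using z0 iu0 by auto
    have "(stieltjes M u - stieltjes M z) / (u - z) - D
        = (\<integral>x. 1 / ((of_real x - u) * (of_real x - z)) - 1 / ((of_real x - z) * (of_real x - z)) \<partial>M)"
      unfolding D_def using stieltjes_diff[of u z] u z0 iu0 integrable_cauchy_kernel2 by simp
    also have "\<dots> = (\<integral>x. (u - z) * (1 / ((of_real x - u) * (of_real x - z) * (of_real x - z))) \<partial>M)"
    proof (intro Bochner_Integration.integral_cong refl)
      fix x
      have *: "1 / (a * b) - 1 / (b * b) = (b - a) * (1 / (a * b * b))" if "a \<noteq> 0" "b \<noteq> 0" for a b :: complex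
        using that by (simp add: field_simps)
      show "1 / ((of_real x - u) * (of_real x - z)) - 1 / ((of_real x - z) * (of_real x - z))
        = (u - z) * (1 / ((of_real x - u) * (of_real x - z) * (of_real x - z)))"
        using *[of "of_real x - u" "of_real x - z"] ne[of x] by simp
    qed
    also have "cmod \<dots> \<le> (\<integral>x. cmod (u - z) * (2 / (Im z) ^ 3) \<partial>M)"
    proof (rule integral_norm_bound_integral')
      fix x
      have "Im z / 2 * Im z * Im z \<le> cmod (of_real x - u) * cmod (of_real x - z) * cmod (of_real x - z)"
        using cmod_diff_real_ge[of u x] cmod_diff_real_ge[of z x] iu z0 by (intro mult_mono) auto
      hence "1 / (cmod (of_real x - u) * cmod (of_real x - z) * cmod (of_real x - z)) \<le> 1 / (Im z / 2 * Im z * Im z)"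
        using z0 by (intro frac_le) auto
      also have "1 / (Im z / 2 * Im z * Im z) = 2 / (Im z) ^ 3" by (simp add: power3_eq_cube)
      finally have le: "1 / (cmod (of_real x - u) * cmod (of_real x - z) * cmod (of_real x - z)) \<le> 2 / (Im z) ^ 3" .
      show "cmod ((u - z) * (1 / ((of_real x - u) * (of_real x - z) * (of_real x - z)))) \<le> cmod (u - z) * (2 / (Im z) ^ 3)"
        unfolding norm_mult norm_divide norm_one by (rule mult_left_mono[OF le]) simp
    qed simp
    finally show ?thesis using prob_space by (simp add: mult.commute)
  qed
  have "((\<lambda>u. (stieltjes M u - stieltjes M z) / (u - z) - D) \<longlongrightarrow> 0) (at z)"
  proof (rule Lim_null_comparison)
    show "\<forall>\<^sub>F u in at z. norm ((stieltjes M u - stieltjes M z) / (u - z) - D) \<le> 2 / (Im z) ^ 3 * cmod (u - z)"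
      unfolding eventually_at using bound z0 by (intro exI[of _ "Im z / 2"]) auto
    show "((\<lambda>u. 2 / (Im z) ^ 3 * cmod (u - z)) \<longlongrightarrow> 0) (at z)"
      using z0 by (auto intro!: tendsto_eq_intros)
  qed
  hence "(stieltjes M has_field_derivative D) (at z)"
    unfolding has_field_derivative_iff by (rule Lim_null[THEN iffD2])
  thus "stieltjes M field_differentiable at z within {z. Im z > 0}"
    using field_differentiable_at_within field_differentiable_def by blast
qed

text \<open>Two solutions satisfy \<open>s - s' = v (s - s') I\<close> with \<open>I\<close> the integral of
  \<open>1 / ((t - w) (t - w'))\<close>, which is at most the mean of the integrals of \<open>1 / \<bar>t - w\<bar>\<^sup>2\<close> and
  \<open>1 / \<bar>t - w'\<bar>\<^sup>2\<close>. The first is \<open>Im s / Im w\<close>, where \<open>Im w = Im z + v Im s\<close>, so that \<open>v\<close> times it is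
  less than \<open>1\<close>, and likewise for the second.\<close>

lemma stieltjes_fixed_point_unique:
  assumes z: "Im z > 0" and v: "v > 0"
    and s: "s = stieltjes M (z + of_real v * s)" "Im s \<ge> 0"
    and s': "s' = stieltjes M (z + of_real v * s')" "Im s' \<ge> 0"
  shows "s = s'"
proof (rule ccontr)
  assume ne: "s \<noteq> s'"
  define w where "w = z + of_real v * s"
  define w' where "w' = z + of_real v * s'"
  define J where "J u = (\<integral>x. 1 / (cmod (of_real x - u))\<^sup>2 \<partial>M)" for u
  have w0: "Im w > 0" "Im w' > 0" using z v s s' by (auto simp: w_def w'_def add_pos_nonneg)
  have J: "v * J u < 1" if "u = z + of_real v * t" "t = stieltjes M u" "Im t \<ge> 0" for u t
  proof -
    have iu: "Im u = Im z + v * Im t" using that(1) by (simp add: arg_cong[OF that(1), of Im])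
    have "v * Im t \<ge> 0" using v that by simp
    hence u0: "Im u > 0" using iu z by linarith
    have "Im t = Im u * J u" using Im_stieltjes[of u] u0 that(2) unfolding J_def by simp
    hence "Im u * (v * J u) = v * Im t" by simp
    also have "\<dots> < Im u * 1" using iu z by simp
    finally have "Im u * (v * J u) < Im u * 1" .
    thus ?thesis using u0 by (simp only: mult_less_cancel_left_pos)
  qed
  define I where "I = (\<integral>x. 1 / ((of_real x - w) * (of_real x - w')) \<partial>M)"
  have "s - s' = (w - w') * I"
    unfolding I_def using stieltjes_diff[of w w'] w0 s(1) s'(1) by (simp add: w_def w'_def)
  also have "w - w' = of_real v * (s - s')" by (simp add: w_def w'_def algebra_simps)
  finally have "(s - s') * (of_real v * I) = (s - s') * 1" by (simp add: algebra_simps)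
  hence "of_real v * I = 1" using ne by simp
  hence "v * cmod I = 1" using v by (metis norm_mult norm_of_real norm_one abs_of_pos)
  moreover have "cmod I \<le> (J w + J w') / 2"
  proof -
    have "cmod I \<le> (\<integral>x. (1 / (cmod (of_real x - w))\<^sup>2 + 1 / (cmod (of_real x - w'))\<^sup>2) / 2 \<partial>M)"
      unfolding I_def
    proof (rule order_trans[OF integral_norm_bound], rule Bochner_Integration.integral_mono)
      fix x
      have "0 \<le> (1 / cmod (of_real x - w) - 1 / cmod (of_real x - w'))\<^sup>2" by simp
      thus "cmod (1 / ((of_real x - w) * (of_real x - w'))) \<le> (1 / (cmod (of_real x - w))\<^sup>2 + 1 / (cmod (of_real x - w'))\<^sup>2) / 2"
        by (simp add: norm_divide norm_mult power2_diff power_divide)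
    qed (use w0 integrable_cauchy_kernel_norm2 integrable_cauchy_kernel2 in auto)
    also have "\<dots> = (J w + J w') / 2"
      unfolding J_def using w0 integrable_cauchy_kernel_norm2 by simp
    finally show ?thesis .
  qed
  hence "v * cmod I \<le> v * ((J w + J w') / 2)" using v by (intro mult_left_mono) auto
  hence "v * cmod I \<le> (v * J w + v * J w') / 2" by (simp add: algebra_simps)
  moreover have "v * J w < 1" "v * J w' < 1"
    using J[OF w_def] J[OF w'_def] s s' by (auto simp: w_def w'_def)
  ultimately show False by argo
qed

end

text \<open>The finite form of \<open>sin t / (1 - 2 u cos t + u\<^sup>2) = (\<Sum>k. u ^ k sin ((k + 1) t))\<close>.\<close>

lemma sin_geometric_identity:
  fixes u :: complex
  shows "(1 - 2 * u * of_real (cos t) + u\<^sup>2) * (\<Sum>k<N. u ^ k * of_real (sin (real (Suc k) * t)))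
     = of_real (sin t) - u ^ N * of_real (sin (real (Suc N) * t)) + u ^ Suc N * of_real (sin (real N * t))"
proof (induction N)
  case (Suc N)
  have "2 * cos t * sin (real (Suc N) * t) = sin (real (Suc (Suc N)) * t) + sin (real N * t)"
  proof -
    have "sin (real (Suc N) * t + t) + sin (real (Suc N) * t - t) = 2 * cos t * sin (real (Suc N) * t)"
      by (simp add: sin_add sin_diff)
    thus ?thesis by (simp add: algebra_simps)
  qed
  hence "complex_of_real (2 * cos t * sin (real (Suc N) * t)) = of_real (sin (real (Suc (Suc N)) * t) + sin (real N * t))"
    by (rule arg_cong)
  hence *: "2 * of_real (cos t) * complex_of_real (sin (real (Suc N) * t)) = of_real (sin (real (Suc (Suc N)) * t)) + of_real (sin (real N * t))"
    by (simp only: of_real_mult of_real_add of_real_numeral)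
  define p q r where "p = complex_of_real (sin (real (Suc N) * t))" and "q = complex_of_real (sin (real (Suc (Suc N)) * t))"
    and "r = complex_of_real (sin (real N * t))"
  have "(1 - 2 * u * of_real (cos t) + u\<^sup>2) * (\<Sum>k<Suc N. u ^ k * of_real (sin (real (Suc k) * t)))
     = of_real (sin t) - u ^ N * p + u ^ Suc N * r + (1 - 2 * u * of_real (cos t) + u\<^sup>2) * (u ^ N * p)"
    by (simp only: sum.lessThan_Suc distrib_left Suc.IH p_def r_def)
  also have "\<dots> = of_real (sin t) + u ^ Suc N * r - u ^ Suc N * (2 * of_real (cos t) * p) + u ^ Suc (Suc N) * p"
    by (simp add: algebra_simps power2_eq_square)
  also have "\<dots> = of_real (sin t) - u ^ Suc N * q + u ^ Suc (Suc N) * p"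
    using * unfolding p_def[symmetric] q_def[symmetric] r_def[symmetric] by (simp add: algebra_simps)
  finally show ?case unfolding p_def q_def .
qed simp

lemma has_integral_sin_sin:
  "((\<lambda>t. sin t * sin (real (Suc k) * t)) has_integral (if k = 0 then pi / 2 else 0)) {0..pi}"
proof (cases "k = 0")
  case True
  have "((\<lambda>t. (1 - cos (2 * t)) / 2) has_integral ((pi / 2 - sin (2 * pi) / 4) - (0 / 2 - sin (2 * 0) / 4))) {0..pi}"
    by (rule fundamental_theorem_of_calculus)
       (auto intro!: derivative_eq_intros simp flip: has_real_derivative_iff_has_vector_derivative)
  moreover have "(1 - cos (2 * t)) / 2 = sin t * sin t" for t :: real
    using cos_double_sin[of t] by (simp add: power2_eq_square)
  ultimately show ?thesis using True by simp
next
  case False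
  define F where "F t = (sin (real k * t) / real k - sin (real (k + 2) * t) / real (k + 2)) / 2" for t
  have "((\<lambda>t. (cos (real k * t) - cos (real (k + 2) * t)) / 2) has_integral (F pi - F 0)) {0..pi}"
    unfolding F_def using False
    by (intro fundamental_theorem_of_calculus)
       (auto intro!: derivative_eq_intros simp flip: has_real_derivative_iff_has_vector_derivative)
  moreover have "F pi - F 0 = 0"
    by (simp add: F_def sin_npi2[of "k + 2", simplified] del: of_nat_add of_nat_Suc)
  moreover have "(cos (real k * t) - cos (real (k + 2) * t)) / 2 = sin t * sin (real (Suc k) * t)" for t
  proof -
    have "cos (real (Suc k) * t - t) - cos (real (Suc k) * t + t) = 2 * sin t * sin (real (Suc k) * t)"
      by (simp add: cos_add cos_diff)
    thus ?thesis by (simp add: algebra_simps)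
  qed
  ultimately show ?thesis using False by simp
qed

text \<open>Only the first term of the sine expansion is not orthogonal to \<open>sin t\<close>, and the remainder tends
  to \<open>0\<close> geometrically.\<close>

lemma sin2_poisson_integral:
  fixes u :: complex
  assumes u: "cmod u < 1"
  shows "((\<lambda>t. of_real ((sin t)\<^sup>2) / (1 - 2 * u * of_real (cos t) + u\<^sup>2)) has_integral of_real (pi / 2)) {0..pi}"
proof -
  let ?d = "\<lambda>t. 1 - 2 * u * complex_of_real (cos t) + u\<^sup>2"
  have d: "(1 - cmod u)\<^sup>2 \<le> cmod (?d t)" for t
  proof -
    have cc: "cis t * cis (- t) = 1" "cis t + cis (- t) = 2 * of_real (cos t)"
      by (auto simp: cis_mult complex_eq_iff)
    have "(1 - u * cis t) * (1 - u * cis (- t)) = 1 - u * (cis t + cis (- t)) + u\<^sup>2 * (cis t * cis (- t))"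
      by (simp add: algebra_simps power2_eq_square)
    hence "?d t = (1 - u * cis t) * (1 - u * cis (- t))" unfolding cc by simp
    moreover have "1 - cmod u \<le> cmod (1 - u * cis x)" for x
      using norm_triangle_ineq2[of 1 "u * cis x"] by (simp add: norm_mult)
    ultimately show ?thesis unfolding norm_mult power2_eq_square
      using u by (simp only: norm_mult) (intro mult_mono, auto)
  qed
  hence d0: "?d t \<noteq> 0" for t
    using u by (metis diff_gt_0_iff_gt norm_zero not_le zero_less_power)
  define f where "f t = of_real ((sin t)\<^sup>2) / ?d t" for t
  have fi: "f integrable_on {0..pi}"
    unfolding f_def by (intro integrable_continuous_interval continuous_intros) (use d0 in auto)
  define g where "g N t = (\<Sum>k<N. u ^ k * of_real (sin t * sin (real (Suc k) * t)))" for N t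
  have gi: "(g (Suc N) has_integral of_real (pi / 2)) {0..pi}" for N
  proof -
    have "((\<lambda>t. \<Sum>k<Suc N. u ^ k * complex_of_real (sin t * sin (real (Suc k) * t))) has_integral
       (\<Sum>k<Suc N. u ^ k * of_real (if k = 0 then pi / 2 else 0))) {0..pi}"
      by (intro has_integral_sum has_integral_mult_right has_integral_of_real has_integral_sin_sin) auto
    also have "(\<Sum>k<Suc N. u ^ k * complex_of_real (if k = 0 then pi / 2 else 0)) = of_real (pi / 2)"
      by (simp add: sum.lessThan_Suc_shift del: sum.lessThan_Suc)
    finally show ?thesis unfolding g_def[abs_def] .
  qed
  have diff: "cmod (f t - g N t) \<le> cmod u ^ N * (2 / (1 - cmod u)\<^sup>2)" for N t
  proof -
    have gN: "g N t = of_real (sin t) * (\<Sum>k<N. u ^ k * of_real (sin (real (Suc k) * t)))"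
      by (simp add: g_def sum_distrib_left mult_ac)
    have "?d t * (f t - g N t) = of_real (sin t) * (of_real (sin t) - ?d t * (\<Sum>k<N. u ^ k * of_real (sin (real (Suc k) * t))))"
      using d0[of t] by (simp add: f_def gN right_diff_distrib power2_eq_square)
    also have "\<dots> = of_real (sin t) * (u ^ N * (of_real (sin (real (Suc N) * t)) - u * of_real (sin (real N * t))))"
      unfolding sin_geometric_identity by (simp add: algebra_simps)
    finally have "cmod (?d t) * cmod (f t - g N t) = \<bar>sin t\<bar> * (cmod u ^ N * cmod (of_real (sin (real (Suc N) * t)) - u * of_real (sin (real N * t))))"
      by (metis norm_mult norm_of_real norm_power)
    also have "\<dots> \<le> 1 * (cmod u ^ N * (1 + 1 * 1))"
    proof (intro mult_mono order_trans[OF norm_triangle_ineq4] add_mono)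
      show "cmod (u * complex_of_real (sin (real N * t))) \<le> 1 * 1"
        unfolding norm_mult by (intro mult_mono) (use u in auto)
    qed auto
    finally have "cmod (?d t) * cmod (f t - g N t) \<le> 2 * cmod u ^ N" by simp
    moreover have "(1 - cmod u)\<^sup>2 * cmod (f t - g N t) \<le> cmod (?d t) * cmod (f t - g N t)"
      by (intro mult_right_mono d) auto
    ultimately have "(1 - cmod u)\<^sup>2 * cmod (f t - g N t) \<le> 2 * cmod u ^ N" by linarith
    thus ?thesis using u by (simp add: field_simps)
  qed
  have "cmod (integral {0..pi} f - of_real (pi / 2)) \<le> cmod u ^ Suc N * (2 / (1 - cmod u)\<^sup>2) * pi" for N
  proof -
    have "((\<lambda>t. f t - g (Suc N) t) has_integral (integral {0..pi} f - of_real (pi / 2))) {0..pi}"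
      by (intro has_integral_diff gi integrable_integral fi)
    hence "cmod (integral {0..pi} f - of_real (pi / 2)) \<le> cmod u ^ Suc N * (2 / (1 - cmod u)\<^sup>2) * measure lborel {0..pi}"
      by (rule has_integral_bound_real[where S="{}", rotated 2]) (use diff[of _ "Suc N"] in auto)
    thus ?thesis by simp
  qed
  moreover have "(\<lambda>N. cmod u ^ Suc N * (2 / (1 - cmod u)\<^sup>2) * pi) \<longlonglongrightarrow> 0"
    using LIMSEQ_Suc[OF LIMSEQ_realpow_zero[of "cmod u"]] u by (intro tendsto_mult_left_zero) auto
  ultimately have "cmod (integral {0..pi} f - of_real (pi / 2)) \<le> 0"
    by (intro LIMSEQ_le_const) auto
  hence int: "integral {0..pi} f = of_real (pi / 2)" by simp
  have "(f has_integral of_real (pi / 2)) {0..pi}" using integrable_integral[OF fi] unfolding int .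
  thus ?thesis unfolding f_def[abs_def] .
qed

text \<open>The two roots of \<open>u\<^sup>2 + (z / r) u + 1\<close> have product \<open>1\<close>; if both had modulus \<open>1\<close> they would be
  conjugate and \<open>z\<close> would be real.\<close>

lemma joukowski_inverse:
  fixes z :: complex
  assumes z: "Im z > 0" and r: "r > 0"
  obtains u where "u \<noteq> 0" "cmod u < 1" "z = - of_real r * (u + 1 / u)"
proof -
  note result = that
  define w where "w = z / of_real r"
  define p where "p = (- w + csqrt (w\<^sup>2 - 4)) / 2"
  define q where "q = (- w - csqrt (w\<^sup>2 - 4)) / 2"
  have pq: "p * q = 1" "p + q = - w"
  proof -
    have "p * q = (w\<^sup>2 - (csqrt (w\<^sup>2 - 4))\<^sup>2) / 4" by (simp add: p_def q_def power2_eq_square algebra_simps)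
    thus "p * q = 1" by simp
    show "p + q = - w" by (simp add: p_def q_def field_simps)
  qed
  have Imw: "Im w \<noteq> 0" using z r by (simp add: w_def Im_divide_of_real)
  have ne1: "cmod u \<noteq> 1" if "u * v = 1" "u + v = - w" for u v
  proof
    assume "cmod u = 1"
    hence "u * cnj u = 1" by (simp add: complex_norm_square[symmetric])
    hence "u * (v - cnj u) = 0" using that(1) by (simp add: right_diff_distrib)
    moreover have "u \<noteq> 0" using that(1) by auto
    ultimately have "v = cnj u" by simp
    hence "Im (u + v) = 0" by simp
    thus False using Imw unfolding that(2) by simp
  qed
  have fin: thesis if uv: "u * v = 1" "u + v = - w" "cmod u < 1" for u v
  proof -
    have u0: "u \<noteq> 0" using uv by auto
    hence "v = 1 / u" using uv(1) by (simp add: field_simps)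
    hence "z = - of_real r * (u + 1 / u)" using uv(2) r by (simp add: w_def field_simps)
    with u0 uv(3) show thesis by (rule result)
  qed
  have "cmod p * cmod q = 1" using pq(1) by (metis norm_mult norm_one)
  hence "\<not> (1 \<le> cmod p \<and> 1 < cmod q)"
    using mult_right_mono[of 1 "cmod p" "cmod q"] by auto
  hence "cmod p < 1 \<or> cmod q < 1"
    using ne1[of q p] pq by (auto simp: mult.commute add.commute)
  thus thesis
  proof
    assume "cmod p < 1"
    thus thesis using fin[OF pq] by blast
  next
    assume "cmod q < 1"
    moreover have "q * p = 1" "q + p = - w" using pq by (simp_all add: mult.commute add.commute)
    ultimately show thesis using fin by blast
  qed
qed

text \<open>With \<open>r = sqrt v\<close> and \<open>z = - r (u + 1 / u)\<close> the substitution \<open>x = - 2 r cos t\<close> turns the transform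
  into the integral of \<open>sin2_poisson_integral\<close> and yields \<open>g = u / r\<close>.\<close>

lemma semicircle_stieltjes_quadratic:
  assumes z: "Im z > 0" and v: "v > 0"
  defines "g \<equiv> stieltjes (semicircle v) z"
  shows "of_real v * g\<^sup>2 + z * g + 1 = 0"
proof -
  define r where "r = sqrt v"
  have r: "r > 0" "r\<^sup>2 = v" using v by (auto simp: r_def)
  obtain u where u: "u \<noteq> 0" "cmod u < 1" "z = - of_real r * (u + 1 / u)"
    using joukowski_inverse[OF z r(1)] .
  have ne: "of_real x \<noteq> z" for x using z by auto
  define \<rho> where "\<rho> x = indicator {- 2 * r..2 * r} x * sqrt (4 * v - x\<^sup>2) / (2 * pi * v)" for x
  define F where "F x = (sqrt (4 * v - x\<^sup>2) / (2 * pi * v)) *\<^sub>R (1 / (complex_of_real x - z))" for x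
  have pos: "0 \<le> 4 * v - x\<^sup>2" if "x \<in> {- 2 * r..2 * r}" for x
  proof -
    have "x\<^sup>2 \<le> (2 * r)\<^sup>2" using that by (intro power2_le_iff_abs_le[THEN iffD2]) auto
    thus ?thesis by (simp add: power_mult_distrib r)
  qed
  have \<rho>0: "0 \<le> \<rho> x" for x using pos[of x] v by (auto simp: \<rho>_def indicator_def)
  have cF: "continuous_on A F" for A
    unfolding F_def using ne v by (intro continuous_intros) auto
  have "g = (\<integral>x. \<rho> x *\<^sub>R (1 / (complex_of_real x - z)) \<partial>lborel)"
    unfolding g_def stieltjes_def semicircle_def r_def[symmetric] \<rho>_def[symmetric]
    by (rule integral_density) (use \<rho>0 in \<open>auto simp: \<rho>_def\<close>)
  also have "\<dots> = (LINT x:{- 2 * r..2 * r}|lborel. F x)"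
    unfolding set_lebesgue_integral_def
    by (intro Bochner_Integration.integral_cong refl) (auto simp: \<rho>_def F_def indicator_def)
  also have "\<dots> = integral {- 2 * r..2 * r} F"
    by (rule set_borel_integral_eq_integral(2)[OF borel_integrable_atLeastAtMost'[OF cF]])
  finally have gF: "g = integral {- 2 * r..2 * r} F" .
  have "((\<lambda>t. (2 * r * sin t) *\<^sub>R F (- 2 * r * cos t)) has_integral integral {- 2 * r * cos 0..- 2 * r * cos pi} F) {0..pi}"
  proof (rule has_integral_substitution[where c = "- 2 * r" and d = "2 * r"])
    show "(\<lambda>t. - 2 * r * cos t) ` {0..pi} \<subseteq> {- 2 * r..2 * r}"
    proof safe
      fix t
      have "\<bar>2 * r * cos t\<bar> \<le> 2 * r * 1"
        unfolding abs_mult using r by (intro mult_mono) auto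
      thus "- 2 * r * cos t \<in> {- 2 * r..2 * r}" by (auto simp: abs_le_iff)
    qed
  qed (use r cF in \<open>auto intro!: derivative_eq_intros\<close>)
  hence I1: "((\<lambda>t. (2 * r * sin t) *\<^sub>R F (- 2 * r * cos t)) has_integral g) {0..pi}"
    by (simp add: gF)
  have eq: "(2 * r * sin t) *\<^sub>R F (- 2 * r * cos t)
      = (2 * u / (of_real pi * of_real r)) * (of_real ((sin t)\<^sup>2) / (1 - 2 * u * of_real (cos t) + u\<^sup>2))"
    if t: "t \<in> {0..pi}" for t
  proof -
    have "4 * v - (- 2 * r * cos t)\<^sup>2 = (2 * r * sin t)\<^sup>2"
      unfolding power_mult_distrib sin_squared_eq by (simp add: r algebra_simps)
    hence sq: "sqrt (4 * v - (- 2 * r * cos t)\<^sup>2) = 2 * r * sin t"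
      using r t sin_ge_zero[of t] by simp
    have den: "complex_of_real (- 2 * r * cos t) - z = (of_real r / u) * (1 - 2 * u * of_real (cos t) + u\<^sup>2)"
      using u(1) unfolding u(3) by (simp add: field_simps power2_eq_square)
    have "(2 * r * sin t) *\<^sub>R F (- 2 * r * cos t) = of_real (2 * r * sin t * (2 * r * sin t) / (2 * pi * v)) * (1 / ((of_real r / u) * (1 - 2 * u * of_real (cos t) + u\<^sup>2)))"
      unfolding F_def sq den by (simp add: scaleR_conv_of_real)
    also have "2 * r * sin t * (2 * r * sin t) / (2 * pi * v) = 2 * (sin t)\<^sup>2 / pi"
      using r v by (simp add: power2_eq_square field_simps flip: r(2))
    finally show ?thesis by (simp add: mult_ac)
  qed
  have "((\<lambda>t. (2 * r * sin t) *\<^sub>R F (- 2 * r * cos t)) has_integral (2 * u / (of_real pi * of_real r)) * of_real (pi / 2)) {0..pi}"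
    using has_integral_mult_right[OF sin2_poisson_integral[OF u(2)], of "2 * u / (of_real pi * of_real r)"]
    by (rule has_integral_eq[rotated]) (use eq in auto)
  hence "g = (2 * u / (of_real pi * of_real r)) * of_real (pi / 2)"
    using I1 by (rule has_integral_unique[symmetric])
  hence g: "g = u / of_real r" by simp
  have "of_real v * g\<^sup>2 = u\<^sup>2" using r by (simp add: g power_divide flip: r(2))
  moreover have "z * g = - u\<^sup>2 - 1" using r u by (simp add: g u(3) field_simps power2_eq_square)
  ultimately show ?thesis by simp
qed

text \<open>By the quadratic equation the R-transform of the semicircle distribution is \<open>v w\<close>. Thus, with
  \<open>Z = R\<^sub>1 w + v w + 1 / w\<close>, the transform of \<open>\<kappa>\<close> at \<open>Z\<close> is \<open>- w\<close>, and that of \<open>H\<close> at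
  \<open>Z - v w = Z + v (- w)\<close> is \<open>- w\<close> as well: the equation holds at such points \<open>Z\<close>. For \<open>w\<close> on a short
  segment of the negative imaginary axis they lie in the upper half-plane and accumulate there,
  because \<open>Z\<close> depends continuously and, being inverted by the transform, injectively on \<open>w\<close>. Both
  sides are holomorphic on the upper half-plane.\<close>

theorem free_convolution_semicircle_subordination:
  assumes H: "real_distribution H" and v: "v > 0"
    and conv: "is_free_additive_convolution H (semicircle v) \<kappa>" and z: "Im z > 0"
  shows "stieltjes \<kappa> z = stieltjes H (z + of_real v * stieltjes \<kappa> z)"
proof -
  interpret H: real_distribution H by (rule H)
  interpret K: real_distribution \<kappa> using conv by (simp add: is_free_additive_convolution_def)
  obtain R1 R2 where R: "has_R_transform H R1" "has_R_transform (semicircle v) R2" "has_R_transform \<kappa> (\<lambda>w. R1 w + R2 w)"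
    using conv unfolding is_free_additive_convolution_def by auto
  let ?U = "{z. Im z > 0}"
  define f where "f z = stieltjes \<kappa> z - stieltjes H (z + of_real v * stieltjes \<kappa> z)" for z
  have shift: "Im (z + of_real v * stieltjes \<kappa> z) > 0" if "Im z > 0" for z
    using that K.Im_stieltjes_nonneg[OF that] v by (simp add: add_pos_nonneg)
  have hol: "f holomorphic_on ?U"
    unfolding f_def
    by (intro holomorphic_intros K.holomorphic_stieltjes holomorphic_on_compose_gen[OF _ H.holomorphic_stieltjes, unfolded o_def])
       (use shift in auto)
  have an: "R1 analytic_on {0}" "R2 analytic_on {0}" using R by (auto simp: has_R_transform_def)
  obtain e1 where e1: "e1 > 0" "R1 holomorphic_on ball 0 e1" using an(1) by (auto simp: analytic_on_def)
  obtain e2 where e2: "e2 > 0" "R2 holomorphic_on ball 0 e2" using an(2) by (auto simp: analytic_on_def)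
  have ev: "\<forall>\<^sub>F w in at 0. - stieltjes H (R1 w + 1 / w) = w \<and> - stieltjes (semicircle v) (R2 w + 1 / w) = w
      \<and> - stieltjes \<kappa> (R1 w + R2 w + 1 / w) = w"
    using R unfolding has_R_transform_def by (auto intro: eventually_conj)
  have c1: "isCont R1 0" and c2: "isCont R2 0"
    using e1 e2 by (auto intro!: continuous_on_interior[OF holomorphic_on_imp_continuous_on])
  have ev2: "\<forall>\<^sub>F w in at 0. cmod (R1 w - R1 0) < 1 \<and> cmod (R2 w - R2 0) < 1"
    using tendstoD[OF c1[unfolded isCont_def], of 1] tendstoD[OF c2[unfolded isCont_def], of 1]
    by (auto simp: dist_norm intro: eventually_conj)
  define K where "K = cmod (R1 0) + cmod (R2 0) + 3"
  have K: "K > 0" by (simp add: K_def add_nonneg_pos)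
  obtain d where d: "d > 0" and D: "\<And>w. w \<noteq> 0 \<Longrightarrow> cmod w < d \<Longrightarrow>
      (- stieltjes H (R1 w + 1 / w) = w \<and> - stieltjes (semicircle v) (R2 w + 1 / w) = w
      \<and> - stieltjes \<kappa> (R1 w + R2 w + 1 / w) = w) \<and> (cmod (R1 w - R1 0) < 1 \<and> cmod (R2 w - R2 0) < 1)"
    using eventually_conj[OF ev ev2] unfolding eventually_at dist_norm by auto
  (* The bound 1 / K keeps Im (1 / w) above the imaginary parts of the R-transforms. *)
  define T where "T = min (min d e1) (1 / K)"
  have T: "T > 0" using d e1 K by (simp add: T_def)
  define p where "p t = - \<i> * complex_of_real t" for t
  define Zt where "Zt t = R1 (p t) + of_real v * p t + 1 / p t" for t
  have step: "stieltjes \<kappa> (Zt t) = - p t" "Im (Zt t) > 0" "f (Zt t) = 0" if t: "0 < t" "t < T" for t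
  proof -
    have pt: "p t \<noteq> 0" "cmod (p t) = t" using t by (auto simp: p_def norm_mult)
    have ip: "1 / p t = \<i> / of_real t" using t by (simp add: p_def field_simps)
    have td: "cmod (p t) < d" using t pt by (simp add: T_def)
    note Dt = D[OF pt(1) td]
    have it: "1 / t > K" using t K by (simp add: T_def field_simps)
    have b: "\<bar>Im (R1 (p t))\<bar> + \<bar>Im (R2 (p t))\<bar> < K"
    proof -
      have "cmod (R1 (p t)) < cmod (R1 0) + 1" "cmod (R2 (p t)) < cmod (R2 0) + 1"
        using Dt norm_triangle_sub[of "R1 (p t)" "R1 0"] norm_triangle_sub[of "R2 (p t)" "R2 0"] by auto
      thus ?thesis using abs_Im_le_cmod[of "R1 (p t)"] abs_Im_le_cmod[of "R2 (p t)"] by (simp add: K_def)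
    qed
    have ii: "Im (1 / p t) = 1 / t" unfolding ip by simp
    have I2: "Im (R2 (p t) + 1 / p t) > 0" using ii it b by simp
    have g: "stieltjes (semicircle v) (R2 (p t) + 1 / p t) = - p t" using Dt by (metis add.inverse_inverse)
    from semicircle_stieltjes_quadratic[OF I2 v] have "of_real v * (p t)\<^sup>2 - (R2 (p t) + 1 / p t) * p t + 1 = 0"
      unfolding g by simp
    hence "p t * (of_real v * p t - R2 (p t)) = 0" using pt(1) by (simp add: field_simps power2_eq_square)
    hence R2: "R2 (p t) = of_real v * p t" using pt(1) by simp
    have "R1 (p t) + R2 (p t) + 1 / p t = Zt t" by (simp add: Zt_def R2)
    thus mk: "stieltjes \<kappa> (Zt t) = - p t" using Dt by (metis add.inverse_inverse)
    show "Im (Zt t) > 0" using ii it b by (simp add: Zt_def flip: R2)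
    have "Zt t + of_real v * stieltjes \<kappa> (Zt t) = R1 (p t) + 1 / p t" unfolding mk by (simp add: Zt_def)
    thus "f (Zt t) = 0" unfolding f_def mk using Dt by (metis add.inverse_inverse cancel_comm_monoid_add_class.diff_cancel)
  qed
  define t0 where "t0 = T / 2"
  have t0: "0 < t0" "t0 < T" using T by (auto simp: t0_def)
  have lim: "Zt t0 islimpt (Zt ` {0<..<T})"
  proof -
    have "isCont R1 (p t0)"
    proof (rule continuous_on_interior[OF holomorphic_on_imp_continuous_on[OF e1(2)]])
      show "p t0 \<in> interior (ball 0 e1)" using t0 by (simp add: p_def norm_mult T_def)
    qed
    moreover have cp: "isCont p t0" unfolding p_def by (intro continuous_intros)
    ultimately have "isCont (\<lambda>t. R1 (p t)) t0" by (rule isCont_o2[rotated])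
    moreover have "p t0 \<noteq> 0" using t0 by (simp add: p_def)
    ultimately have cont: "isCont Zt t0"
      unfolding Zt_def using cp by (intro continuous_intros) auto
    define q where "q n = t0 - t0 / (real n + 2)" for n
    have q: "0 < q n" "q n < T" "q n \<noteq> t0" for n
    proof -
      have "0 < t0 / (real n + 2)" "t0 / (real n + 2) < t0"
        using t0 by (auto simp: divide_less_eq)
      hence "0 < q n" "q n < t0" unfolding q_def by linarith+
      thus "0 < q n" "q n < T" "q n \<noteq> t0" using t0 by linarith+
    qed
    have "q \<longlonglongrightarrow> t0 - 0"
      unfolding q_def
      by (intro tendsto_diff tendsto_const tendsto_divide_0[OF tendsto_const] filterlim_at_top_imp_at_infinity
          filterlim_tendsto_add_at_top[OF tendsto_const, of _ _ 2, simplified add.commute] filterlim_real_sequentially)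
    hence "(\<lambda>n. Zt (q n)) \<longlonglongrightarrow> Zt t0" by (intro isCont_tendsto_compose[OF cont]) simp
    moreover have "Zt (q n) \<noteq> Zt t0" for n
      using step(1)[OF t0] step(1)[OF q(1,2)[of n]] q(3)[of n] by (auto simp: p_def)
    ultimately show ?thesis
      unfolding islimpt_sequential using q by (intro exI[of _ "\<lambda>n. Zt (q n)"]) auto
  qed
  have "f z = 0"
    by (rule analytic_continuation[OF hol open_halfspace_Im_gt convex_connected[OF convex_halfspace_Im_gt] _ _ lim])
       (use step t0 z in auto)
  thus ?thesis by (simp add: f_def)
qed

section \<open>From almost sure identities to the limit\<close>

text \<open>Write \<open>\<Lambda>\<^sub>n f\<close> for the normalized weighted sum and \<open>w = \<i> k\<close>. As \<open>k\<close> grows, \<open>- w t\<^sup>j / (t - w)\<close> tends to \<open>t\<^sup>j\<close> uniformly on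
  the interval, so vanishing on the functions \<open>t\<^sup>j / (t - w)\<close> implies vanishing on \<open>t\<^sup>j\<close>; and
  \<open>t\<^sup>j\<^sup>+\<^sup>1 / (t - w) = t\<^sup>j + w t\<^sup>j / (t - w)\<close> carries this to the next power. Polynomials are dense.
  Countably many points \<open>w\<close> thus suffice, which is what an almost sure statement can provide.\<close>

lemma weighted_sums_vanish:
  fixes d :: "nat \<Rightarrow> nat \<Rightarrow> real" and b :: "nat \<Rightarrow> nat \<Rightarrow> complex" and f :: "real \<Rightarrow> complex"
  assumes bd: "\<forall>\<^sub>F n in sequentially. \<forall>i<n. d n i \<in> {l..u} \<and> cmod (b n i) \<le> C"
    and res: "\<And>k. (\<lambda>n. (\<Sum>i<n. 1 / (of_real (d n i) - \<i> * of_nat (Suc k)) * b n i) / of_nat n) \<longlonglongrightarrow> 0"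
    and f: "continuous_on {l..u} f"
  shows "(\<lambda>n. (\<Sum>i<n. f (d n i) * b n i) / of_nat n) \<longlonglongrightarrow> 0"
proof -
  define L where "L f n = (\<Sum>i<n. f (d n i) * b n i) / of_nat n" for f :: "real \<Rightarrow> complex" and n
  define V where "V f \<longleftrightarrow> L f \<longlonglongrightarrow> 0" for f
  have approx: "V f" if a: "\<And>e. e > 0 \<Longrightarrow> \<exists>g. V g \<and> (\<forall>t\<in>{l..u}. cmod (f t - g t) \<le> e)" for f
    unfolding V_def
  proof (rule tendstoI)
    fix e :: real assume e: "e > 0"
    define e' where "e' = e / (2 * (\<bar>C\<bar> + 1))"
    have e': "e' > 0" using e by (simp add: e'_def)
    obtain g where g: "V g" "\<forall>t\<in>{l..u}. cmod (f t - g t) \<le> e'" using a[OF e'] by auto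
    have "\<forall>\<^sub>F n in sequentially. dist (L g n) 0 < e / 2"
      using g(1) e unfolding V_def by (intro tendstoD) auto
    with bd eventually_gt_at_top[of 0] show "\<forall>\<^sub>F n in sequentially. dist (L f n) 0 < e"
    proof eventually_elim
      case (elim n)
      have "L f n - L g n = (\<Sum>i<n. (f (d n i) - g (d n i)) * b n i) / of_nat n"
        by (simp add: L_def diff_divide_distrib sum_subtractf left_diff_distrib)
      also have "cmod \<dots> \<le> (\<Sum>i<n. e' * \<bar>C\<bar>) / n"
        unfolding norm_divide norm_of_nat
      proof (intro divide_right_mono order_trans[OF norm_sum] sum_mono)
        fix i assume "i \<in> {..<n}"
        hence "d n i \<in> {l..u}" "cmod (b n i) \<le> \<bar>C\<bar>" using elim(1) by force+
        thus "cmod ((f (d n i) - g (d n i)) * b n i) \<le> e' * \<bar>C\<bar>"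
          unfolding norm_mult using g(2) e' by (intro mult_mono) auto
      qed simp
      also have "\<dots> = e' * \<bar>C\<bar>" using elim(2) by simp
      also have "\<dots> \<le> e / 2" using e by (simp add: e'_def field_simps)
      finally have "cmod (L f n - L g n) \<le> e / 2" .
      thus ?case using elim(3) norm_triangle_sub[of "L f n" "L g n"] by (simp add: dist_norm)
    qed
  qed
  have Vadd: "V (\<lambda>t. f t + g t)" if "V f" "V g" for f g
    using tendsto_add[OF that[unfolded V_def]] unfolding V_def L_def
    by (simp add: sum.distrib add_divide_distrib distrib_right)
  have Vmult: "V (\<lambda>t. c * f t)" if "V f" for c f
    using tendsto_mult_right[OF that[unfolded V_def], of c] unfolding V_def L_def
    by (simp add: sum_distrib_left mult_ac)
  define w where "w k = \<i> * complex_of_nat (Suc k)" for k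
  have wne: "of_real t \<noteq> w k" for t k by (auto simp: w_def complex_eq_iff)
  define D where "D = max \<bar>l\<bar> \<bar>u\<bar>"
  have mono: "V (\<lambda>t. of_real t ^ j)" if Q: "\<And>k. V (\<lambda>t. of_real t ^ j / (of_real t - w k))" for j
  proof (rule approx)
    fix e :: real assume e: "e > 0"
    obtain k where k: "D ^ Suc j / e < real k" using reals_Archimedean2 by blast
    let ?g = "\<lambda>t. - w k * (of_real t ^ j / (of_real t - w k))"
    show "\<exists>g. V g \<and> (\<forall>t\<in>{l..u}. cmod (of_real t ^ j - g t) \<le> e)"
    proof (intro exI[of _ ?g] conjI ballI Vmult Q)
      fix t assume t: "t \<in> {l..u}"
      have "of_real t ^ j - ?g t = of_real t ^ Suc j / (of_real t - w k)"
        using wne[of t k] by (simp add: field_simps)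
      also have "cmod \<dots> \<le> D ^ Suc j / Suc k"
      proof -
        have "real (Suc k) \<le> cmod (of_real t - w k)"
          using cmod_diff_real_ge[of "w k" t] by (simp add: w_def)
        moreover have "\<bar>t\<bar> ^ Suc j \<le> D ^ Suc j"
          using t by (intro power_mono) (auto simp: D_def)
        moreover have "0 \<le> D ^ Suc j" by (intro zero_le_power) (simp add: D_def)
        ultimately show ?thesis unfolding norm_divide norm_power norm_of_real
          by (intro frac_le) auto
      qed
      also have "\<dots> \<le> e" using k e by (simp add: field_simps)
      finally show "cmod (of_real t ^ j - ?g t) \<le> e" .
    qed
  qed
  have Q: "\<forall>k. V (\<lambda>t. of_real t ^ j / (of_real t - w k))" for j
  proof (induction j)
    case 0
    show ?case using res unfolding V_def L_def w_def by simp
  next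
    case (Suc j)
    show ?case
    proof
      fix k
      have "V (\<lambda>t. of_real t ^ j + w k * (of_real t ^ j / (of_real t - w k)))"
        using Suc by (intro Vadd Vmult mono) auto
      also have "(\<lambda>t. of_real t ^ j + w k * (of_real t ^ j / (of_real t - w k))) = (\<lambda>t. of_real t ^ Suc j / (of_real t - w k))"
        using wne by (auto simp: fun_eq_iff field_simps)
      finally show "V (\<lambda>t. of_real t ^ Suc j / (of_real t - w k))" .
    qed
  qed
  have Vpow: "V (\<lambda>t. of_real t ^ j)" for j using mono Q by blast
  have Vpoly: "V (\<lambda>t. of_real (\<Sum>i\<le>N. a i * t ^ i))" for a :: "nat \<Rightarrow> real" and N
  proof (induction N)
    case 0
    show ?case using Vmult[OF Vpow[of 0], of "of_real (a 0)"] by simp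
  next
    case (Suc N)
    have "V (\<lambda>t. of_real (\<Sum>i\<le>N. a i * t ^ i) + of_real (a (Suc N)) * of_real t ^ Suc N)"
      by (intro Vadd Vmult Vpow Suc)
    thus ?case by simp
  qed
  have Vreal: "V (\<lambda>t. of_real (p t))" if p: "continuous_on {l..u} p" for p :: "real \<Rightarrow> real"
  proof (rule approx)
    fix e :: real assume e: "e > 0"
    obtain q where q: "real_polynomial_function q" "\<And>t. t \<in> {l..u} \<Longrightarrow> \<bar>p t - q t\<bar> < e"
      using Stone_Weierstrass_real_polynomial_function[OF compact_Icc p e] by blast
    obtain a N where "q = (\<lambda>t. \<Sum>i\<le>N. a i * t ^ i)" using q(1) unfolding real_polynomial_function_iff_sum by auto
    hence "V (\<lambda>t. of_real (q t))" using Vpoly by simp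
    thus "\<exists>g. V g \<and> (\<forall>t\<in>{l..u}. cmod (of_real (p t) - g t) \<le> e)"
      using q(2) by (intro exI[of _ "\<lambda>t. of_real (q t)"]) (auto simp: less_imp_le simp flip: of_real_diff)
  qed
  have "V (\<lambda>t. of_real (Re (f t)) + \<i> * of_real (Im (f t)))"
    using f by (intro Vadd Vmult Vreal continuous_intros)
  thus ?thesis unfolding V_def L_def by (simp add: complex_eq[symmetric])
qed

text \<open>For the support, integrate the bounded continuous function \<open>min 1 \<bar>t - clip t\<bar>\<close>, where \<open>clip t\<close>
  is the point of the interval closest to \<open>t\<close>: its integrals vanish eventually, hence so does their
  limit.\<close>

lemma esd_limit_support:
  assumes A: "\<And>n. A n \<in> carrier_mat n n" "\<And>n. transpose_mat (A n) = A n"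
    and H: "real_distribution H" and conv: "weak_conv_m (\<lambda>n. esd (A n)) H"
    and eig: "\<forall>\<^sub>F n in sequentially. \<forall>x. eigenvalue (A n) x \<longrightarrow> x \<in> {l..u}"
  shows "l \<le> u"
    and "AE t in H. t \<in> {l..u}"
    and "\<And>f :: real \<Rightarrow> complex. continuous_on UNIV f \<Longrightarrow> (\<And>t. cmod (f t) \<le> K) \<Longrightarrow>
       (\<lambda>n. \<integral>t. f t \<partial>esd (A n)) \<longlonglongrightarrow> (\<integral>t. f t \<partial>H)"
proof -
  interpret H: real_distribution H by (rule H)
  have spec: "\<exists>d. \<exists>Q. similar_mat_wit (A n) (mat_diag n d) Q (transpose_mat Q)" for n
    using real_spectral_theorem[OF A] by blast
  (* The spectral distribution of the empty matrix is the zero measure, so index 0 is skipped. *)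
  have conv': "weak_conv_m (\<lambda>n. esd (A (Suc n))) H"
    using conv unfolding weak_conv_m_def weak_conv_def by (auto intro: LIMSEQ_Suc)
  show lim: "(\<lambda>n. \<integral>t. f t \<partial>esd (A n)) \<longlonglongrightarrow> (\<integral>t. f t \<partial>H)"
    if f: "continuous_on UNIV f" "\<And>t. cmod (f t) \<le> K" for f :: "real \<Rightarrow> complex" and K
  proof -
    have "(\<lambda>n. \<integral>t. f t \<partial>esd (A (Suc n))) \<longlonglongrightarrow> (\<integral>t. f t \<partial>H)"
      by (rule weak_conv_imp_integral_bdd_continuous_conv[OF _ H conv' _ f(2)])
         (use f esd_prob[OF A(1)] in \<open>auto simp: continuous_on_eq_continuous_at\<close>)
    thus ?thesis by (rule LIMSEQ_imp_Suc)
  qed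
  have "\<forall>\<^sub>F n in sequentially. n > 0 \<and> (\<forall>x. eigenvalue (A n) x \<longrightarrow> x \<in> {l..u})"
    using eig eventually_gt_at_top[of 0] by eventually_elim auto
  then obtain n where n: "n > 0" "\<forall>x. eigenvalue (A n) x \<longrightarrow> x \<in> {l..u}"
    using eventually_happens' sequentially_bot by blast
  show lu: "l \<le> u" using sym_real_eigenvalue[OF A n(1)] n(2) by force
  define f where "f t = min 1 \<bar>t - max l (min u t)\<bar>" for t
  have f: "continuous_on UNIV f" unfolding f_def by (intro continuous_intros)
  have fb: "cmod (complex_of_real (f t)) \<le> 1" for t by (auto simp: f_def)
  have "\<forall>\<^sub>F n in sequentially. (\<integral>t. complex_of_real (f t) \<partial>esd (A n)) = 0"
    using eig
  proof eventually_elim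
    case (elim n)
    obtain d Q where w: "similar_mat_wit (A n) (mat_diag n d) Q (transpose_mat Q)" using spec by blast
    have "f (d i) = 0" if "i < n" for i
      using elim sym_eigvals_diag(2)[OF A(1) w that] by (auto simp: f_def)
    moreover have "(\<lambda>t. complex_of_real (f t)) \<in> borel_measurable borel"
      using borel_measurable_continuous_onI[OF f] by measurable
    ultimately show ?case using esd_integral[OF A(1) w, of "\<lambda>t. complex_of_real (f t)"] by simp
  qed
  hence "(\<lambda>n. \<integral>t. complex_of_real (f t) \<partial>esd (A n)) \<longlonglongrightarrow> 0" by (rule tendsto_eventually)
  moreover have "(\<lambda>n. \<integral>t. complex_of_real (f t) \<partial>esd (A n)) \<longlonglongrightarrow> (\<integral>t. complex_of_real (f t) \<partial>H)"
    by (rule lim[OF _ fb]) (intro continuous_intros f)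
  ultimately have "(\<integral>t. complex_of_real (f t) \<partial>H) = 0" using LIMSEQ_unique by blast
  hence "(\<integral>t. f t \<partial>H) = 0" by simp
  moreover have fm: "f \<in> borel_measurable H" using borel_measurable_continuous_onI[OF f] by simp
  moreover have "integrable H f" using fb by (intro H.integrable_const_bound[of _ 1] fm) simp
  ultimately have "AE t in H. f t = 0"
    by (subst (asm) integral_nonneg_eq_0_iff_AE) (auto simp: f_def)
  thus "AE t in H. t \<in> {l..u}"
    by eventually_elim (use lu in \<open>auto simp: f_def min_def max_def split: if_splits\<close>)
qed

lemma trace_orthogonal_conj:
  assumes Q: "Q \<in> carrier_mat n n" "transpose_mat Q * Q = 1\<^sub>m n" "Q * transpose_mat Q = 1\<^sub>m n"
    and X: "X \<in> carrier_mat n n"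
  shows "mat_trace X = (\<Sum>i<n. (cmat (transpose_mat Q) * X * cmat Q) $$ (i, i))"
    and "mat_trace (cmat Q * mat_diag n f * cmat (transpose_mat Q)) = (\<Sum>i<n. f i)"
proof -
  have cQ: "cmat Q \<in> carrier_mat n n" "cmat (transpose_mat Q) \<in> carrier_mat n n" using Q by auto
  have QQ: "cmat Q * cmat (transpose_mat Q) = 1\<^sub>m n" "cmat (transpose_mat Q) * cmat Q = 1\<^sub>m n"
    using Q by (simp_all add: of_real_hom.mat_hom_one flip: of_real_hom.mat_hom_mult[of _ n n _ n])
  have "cmat Q * mat_diag n (\<lambda>_. 1) * cmat (transpose_mat Q) = 1\<^sub>m n"
    using cQ QQ by simp
  thus "mat_trace X = (\<Sum>i<n. (cmat (transpose_mat Q) * X * cmat Q) $$ (i, i))"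
    using trace_diag_conj[OF Q(1) X, of "\<lambda>_. 1"] X by simp
  have "cmat (transpose_mat Q) * 1\<^sub>m n * cmat Q = 1\<^sub>m n" using cQ QQ by simp
  thus "mat_trace (cmat Q * mat_diag n f * cmat (transpose_mat Q)) = (\<Sum>i<n. f i)"
    using trace_diag_conj[OF Q(1) one_carrier_mat, of f] cQ by simp
qed

text \<open>Let \<open>d i\<close> be the eigenvalues of \<open>A n\<close> and \<open>g i\<close> the diagonal entries of the resolvent of \<open>P n\<close> in the
  eigenbasis of \<open>A n\<close>, so that \<open>tr (f(A) G) = (\<Sum>i. f (d i) g i)\<close>. The defect at \<open>w\<close> is the weighted sum
  of \<open>1 / (d i - w)\<close> with the bounded weights \<open>b i = (d i - \<omega>) g i - 1\<close>. As the defects vanish in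
  the limit, so do the weighted sums of all continuous functions, and dividing by \<open>t - \<omega>\<close> gives
  \<open>tr (f(A) G) / n = (\<integral>t. f t / (t - \<omega>) \<partial>esd A) + o(1)\<close>. Here \<open>\<omega> = z + v m\<close> still depends on \<open>n\<close>; but
  \<open>f = 1\<close> shows that each limit point of the bounded sequence \<open>m\<close> solves the fixed point equation,
  whose solution \<open>s\<close> is unique, so \<open>m\<close> converges to \<open>s\<close>. Then \<open>f = h\<close> gives the claim.\<close>

theorem trace_limit:
  fixes A P :: "nat \<Rightarrow> real mat" and h :: "real \<Rightarrow> complex"
  assumes A: "\<And>n. A n \<in> carrier_mat n n" "\<And>n. transpose_mat (A n) = A n"
    and P: "\<And>n. P n \<in> carrier_mat n n" "\<And>n. transpose_mat (P n) = P n"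
    and H: "real_distribution H" and conv: "weak_conv_m (\<lambda>n. esd (A n)) H"
    and eig: "\<forall>\<^sub>F n in sequentially. \<forall>x. eigenvalue (A n) x \<longrightarrow> x \<in> {l..u}"
    and z: "Im z > 0" and v: "v > 0"
    and def0: "\<And>k. (\<lambda>n. defect (of_real v) z (\<i> * of_nat (Suc k)) (A n) (P n)) \<longlonglongrightarrow> 0"
    and s: "s = stieltjes H (z + of_real v * s)" "Im s \<ge> 0"
    and S: "open S" "{l..u} \<subseteq> S" "continuous_on S h"
  shows "(\<lambda>n. 1 / of_nat n * mat_trace (mat_fun h (A n) * resolvent (P n) z))
    \<longlonglongrightarrow> (LINT t:S|H. h t / (of_real t - z - of_real v * s))"
proof -
  interpret H: real_distribution H by (rule H)
  note supp = esd_limit_support[OF A H conv eig]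
  note lu = supp(1)
  define c where "c = 1 / Im z"
  have c: "c > 0" using z by (simp add: c_def)
  have "\<forall>n. \<exists>d Q. similar_mat_wit (A n) (mat_diag n d) Q (transpose_mat Q)"
    using real_spectral_theorem[OF A] by blast
  then obtain d Q where w: "\<And>n. similar_mat_wit (A n) (mat_diag n (d n)) (Q n) (transpose_mat (Q n))"
    by metis
  have Q: "Q n \<in> carrier_mat n n" "transpose_mat (Q n) * Q n = 1\<^sub>m n" "Q n * transpose_mat (Q n) = 1\<^sub>m n" for n
    using similar_mat_witD2[OF A(1) w[of n]] by auto
  let ?G = "\<lambda>n. resolvent (P n) z"
  have G: "op_bounded n c (?G n)" "?G n \<in> carrier_mat n n" for n
    using resolvent_bounded[OF P, of z n] resolvent_carrier[OF P, of z n] z by (auto simp: c_def)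
  define g where "g n i = (cmat (transpose_mat (Q n)) * ?G n * cmat (Q n)) $$ (i, i)" for n i
  have gb: "cmod (g n i) \<le> c" if "i < n" for n i
    unfolding g_def by (rule op_bounded_entry[OF op_bounded_conjugate[OF Q G(1)] that that])
  have trf: "mat_trace (mat_fun f (A n) * ?G n) = (\<Sum>i<n. f (d n i) * g n i)" for f n
    unfolding mat_fun_diag[OF A(1) w] g_def by (rule trace_diag_conj[OF Q(1) G(2)])
  define m where "m n = mat_trace (?G n) / of_nat n" for n
  have mg: "m n = (\<Sum>i<n. g n i) / of_nat n" for n
    unfolding m_def g_def by (simp only: trace_orthogonal_conj(1)[OF Q G(2)])
  have mb: "cmod (m n) \<le> c" for n
  proof (cases "n = 0")
    case False
    have "cmod (mat_trace (?G n)) \<le> n * c" by (rule op_bounded_trace[OF G(1)])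
    thus ?thesis using False by (simp add: m_def norm_divide field_simps)
  qed (use c in \<open>simp add: m_def\<close>)
  have Imm: "Im (m n) \<ge> 0" for n
  proof -
    obtain d' Q' where w': "similar_mat_wit (P n) (mat_diag n d') Q' (transpose_mat Q')"
      using real_spectral_theorem[OF P] by blast
    have "mat_trace (?G n) = (\<Sum>i<n. 1 / (of_real (d' i) - z))"
      unfolding resolvent_diag[OF P w', of z, OF order.strict_implies_not_eq[OF z, symmetric]]
      by (rule trace_orthogonal_conj(2)[of _ _ "1\<^sub>m n"]) (use similar_mat_witD2[OF P(1) w'] in auto)
    moreover have "Im (1 / (of_real x - z)) \<ge> 0" for x
      using z by (simp add: Im_divide)
    ultimately have "Im (mat_trace (?G n)) \<ge> 0" by (simp add: sum_nonneg)
    thus ?thesis by (simp add: m_def Im_divide_of_nat)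
  qed
  define \<omega> where "\<omega> n = z + of_real v * m n" for n
  have Im\<omega>: "Im (\<omega> n) \<ge> Im z" for n using Imm[of n] v by (simp add: \<omega>_def)
  define b where "b n i = (of_real (d n i) - \<omega> n) * g n i - 1" for n i
  have g_b: "g n i = (1 + b n i) / (of_real (d n i) - \<omega> n)" for n i
  proof -
    have "of_real (d n i) \<noteq> \<omega> n" using Im\<omega>[of n] z by (auto simp: complex_eq_iff)
    thus ?thesis by (simp add: b_def)
  qed
  define C where "C = (max \<bar>l\<bar> \<bar>u\<bar> + cmod z + v * c) * c + 1"
  have C: "C > 0" using c v by (simp add: C_def add_nonneg_pos)
  have bd: "\<forall>\<^sub>F n in sequentially. \<forall>i<n. d n i \<in> {l..u} \<and> cmod (b n i) \<le> C"
    using eig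
  proof eventually_elim
    case (elim n)
    show ?case
    proof (intro allI impI conjI)
      fix i assume i: "i < n"
      show d: "d n i \<in> {l..u}" using elim sym_eigvals_diag(2)[OF A(1) w i] by blast
      have "cmod (\<omega> n) \<le> cmod z + v * c"
        unfolding \<omega>_def using mb[of n] v by (intro norm_triangle_le add_mono) (auto simp: norm_mult)
      moreover have "\<bar>d n i\<bar> \<le> max \<bar>l\<bar> \<bar>u\<bar>" using d by auto
      ultimately have "cmod (of_real (d n i) - \<omega> n) \<le> max \<bar>l\<bar> \<bar>u\<bar> + cmod z + v * c"
        using norm_triangle_ineq4[of "of_real (d n i)" "\<omega> n"] by simp
      hence "cmod ((of_real (d n i) - \<omega> n) * g n i) \<le> (max \<bar>l\<bar> \<bar>u\<bar> + cmod z + v * c) * c"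
        unfolding norm_mult using gb[OF i] by (rule mult_mono) (use v c in auto)
      thus "cmod (b n i) \<le> C"
        unfolding b_def C_def using norm_triangle_ineq4[of "(of_real (d n i) - \<omega> n) * g n i" 1] by simp
    qed
  qed
  have res: "(\<lambda>n. (\<Sum>i<n. 1 / (of_real (d n i) - \<i> * of_nat (Suc k)) * b n i) / of_nat n) \<longlonglongrightarrow> 0" for k
  proof -
    let ?w = "\<i> * complex_of_nat (Suc k)"
    have w0: "Im ?w \<noteq> 0" by simp
    have ne: "of_real x \<noteq> ?w" for x by (auto simp: complex_eq_iff)
    have "defect (of_real v) z ?w (A n) (P n) = (\<Sum>i<n. 1 / (of_real (d n i) - ?w) * b n i) / of_nat n" for n
    proof -
      have dim: "dim_row (A n) = n" using A(1)[of n] by simp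
      have 1: "mat_trace (resolvent (A n) ?w) = (\<Sum>i<n. 1 / (of_real (d n i) - ?w))"
        unfolding resolvent_diag[OF A w w0] by (rule trace_orthogonal_conj(2)[OF Q one_carrier_mat])
      have 2: "mat_trace (resolvent (A n) ?w * ?G n) = (\<Sum>i<n. 1 / (of_real (d n i) - ?w) * g n i)"
        unfolding resolvent_diag[OF A w w0] g_def by (rule trace_diag_conj[OF Q(1) G(2)])
      have "defect (of_real v) z ?w (A n) (P n)
         = ((\<Sum>i<n. g n i) + (?w - \<omega> n) * (\<Sum>i<n. 1 / (of_real (d n i) - ?w) * g n i) - (\<Sum>i<n. 1 / (of_real (d n i) - ?w))) / of_nat n"
        unfolding defect_def dim Let_def 1 2 m_def[symmetric]
        by (simp add: \<omega>_def mg add_divide_distrib diff_divide_distrib algebra_simps)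
      also have "(\<Sum>i<n. g n i) + (?w - \<omega> n) * (\<Sum>i<n. 1 / (of_real (d n i) - ?w) * g n i) - (\<Sum>i<n. 1 / (of_real (d n i) - ?w))
         = (\<Sum>i<n. g n i + (?w - \<omega> n) * (1 / (of_real (d n i) - ?w) * g n i) - 1 / (of_real (d n i) - ?w))"
        by (simp only: sum.distrib sum_subtractf sum_distrib_left)
      also have "\<dots> = (\<Sum>i<n. 1 / (of_real (d n i) - ?w) * b n i)"
      proof (intro sum.cong refl)
        fix i
        have "x + (W - o') * (1 / (D - W) * x) - 1 / (D - W) = 1 / (D - W) * ((D - o') * x - 1)" if "D \<noteq> W" for x W o' D :: complex
        proof -
          have "D - W \<noteq> 0" using that by simp
          thus ?thesis by (simp add: divide_simps) (simp add: algebra_simps)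
        qed
        from this[OF ne] show "g n i + (?w - \<omega> n) * (1 / (of_real (d n i) - ?w) * g n i) - 1 / (of_real (d n i) - ?w)
            = 1 / (of_real (d n i) - ?w) * b n i" unfolding b_def .
      qed
      finally show ?thesis .
    qed
    thus ?thesis using def0[of k] by simp
  qed
  (* Functions on {l..u} are extended to the line as constants, to become test functions for weak
     convergence. *)
  define clip where "clip t = max l (min u t)" for t
  have clip: "clip t \<in> {l..u}" "t \<in> {l..u} \<Longrightarrow> clip t = t" for t using lu by (auto simp: clip_def)
  have clipc: "continuous_on UNIV clip" unfolding clip_def by (intro continuous_intros)
  (* Along any subsequence on which m converges, the point \<omega> in the integrand may be replaced by
     its limit o', at the cost of the error E. *)
  have key: "(\<lambda>n. (\<Sum>i<R n. f (d (R n) i) * g (R n) i) / of_nat (R n))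
       \<longlonglongrightarrow> (\<integral>t. f (clip t) / (of_real (clip t) - (z + of_real v * s')) \<partial>H)"
    if R: "strict_mono R" and ml: "(\<lambda>n. m (R n)) \<longlonglongrightarrow> s'" and f: "continuous_on {l..u} f"
    for R :: "nat \<Rightarrow> nat" and s' and f :: "real \<Rightarrow> complex"
  proof -
    define o' where "o' = z + of_real v * s'"
    have \<omega>l: "(\<lambda>n. \<omega> (R n)) \<longlonglongrightarrow> o'" unfolding \<omega>_def o'_def by (intro tendsto_intros ml)
    have Imo: "Im o' \<ge> Im z"
      by (rule LIMSEQ_le_const[OF tendsto_Im[OF \<omega>l]]) (use Im\<omega> in auto)
    have ne: "of_real x \<noteq> o'" "of_real x \<noteq> \<omega> n" for x n using Imo Im\<omega>[of n] z by (auto simp: complex_eq_iff)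
    have "\<exists>K. \<forall>t\<in>{l..u}. cmod (f t) \<le> K"
      using compact_imp_bounded[OF compact_continuous_image[OF f compact_Icc]] unfolding bounded_iff by auto
    then obtain K where K: "\<And>t. t \<in> {l..u} \<Longrightarrow> cmod (f t) \<le> K" by blast
    have "cmod (f l) \<le> K" using K lu by simp
    hence K0: "K \<ge> 0" by (rule order_trans[OF norm_ge_zero])
    define F where "F t = f t / (of_real t - o')" for t
    have Fc: "continuous_on {l..u} F" unfolding F_def using ne by (intro continuous_intros f) auto
    have Fclip: "continuous_on UNIV (\<lambda>t. F (clip t))"
      by (rule continuous_on_compose2[OF Fc clipc]) (use clip in auto)
    have inv: "1 / cmod (of_real x - y) \<le> c" if "Im y \<ge> Im z" for x y
    proof -
      have "Im z \<le> cmod (of_real x - y)" using cmod_diff_real_ge[of y x] that z by linarith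
      thus ?thesis unfolding c_def using z by (intro frac_le) auto
    qed
    have Fb: "cmod (F (clip t)) \<le> K * c" for t
    proof -
      have "cmod (F (clip t)) = cmod (f (clip t)) * (1 / cmod (of_real (clip t) - o'))" by (simp add: F_def norm_divide)
      also have "\<dots> \<le> K * c" by (intro mult_mono K clip inv Imo) (use K0 in auto)
      finally show ?thesis .
    qed
    have T1: "(\<lambda>n. \<integral>t. F (clip t) \<partial>esd (A n)) \<longlonglongrightarrow> (\<integral>t. F (clip t) \<partial>H)"
      by (rule supp(3)[OF Fclip Fb])
    have T2: "(\<lambda>n. (\<Sum>i<n. F (d n i) * b n i) / of_nat n) \<longlonglongrightarrow> 0"
      by (rule weighted_sums_vanish[OF bd res Fc])
    define E where "E n = (\<Sum>i<n. f (d n i) * g n i) / of_nat n - (\<integral>t. F (clip t) \<partial>esd (A n)) - (\<Sum>i<n. F (d n i) * b n i) / of_nat n" for n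
    have Eb: "\<forall>\<^sub>F n in sequentially. cmod (E n) \<le> K * (1 + C) * c * c * cmod (\<omega> n - o')"
      using bd eventually_gt_at_top[of 0]
    proof eventually_elim
      case (elim n)
      let ?X = "\<lambda>i. f (d n i) * (1 + b n i) * ((\<omega> n - o') * (1 / (of_real (d n i) - \<omega> n) * (1 / (of_real (d n i) - o'))))" and ?Y = "\<lambda>i. f (d n i) * g n i - F (d n i) - F (d n i) * b n i"
      have "(\<integral>t. F (clip t) \<partial>esd (A n)) = (\<Sum>i<n. F (clip (d n i))) / n"
        by (rule esd_integral[OF A(1) w]) (rule borel_measurable_continuous_onI[OF Fclip])
      also have "(\<Sum>i<n. F (clip (d n i))) = (\<Sum>i<n. F (d n i))"
        by (intro sum.cong refl) (use elim clip(2) in auto)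
      finally have "E n = (\<Sum>i<n. ?Y i) / of_nat n"
        by (simp add: E_def sum_subtractf diff_divide_distrib)
      also have "(\<Sum>i<n. ?Y i)
         = (\<Sum>i<n. ?X i)"
      proof (intro sum.cong refl)
        fix i
        have "x * ((1 + B) / p) - x / q - x / q * B = x * (1 + B) * ((q - p) * (1 / p * (1 / q)))" if "p \<noteq> 0" "q \<noteq> 0" for x B p q :: complex
          using that by (simp add: divide_simps) (simp add: algebra_simps)
        from this[of "of_real (d n i) - \<omega> n" "of_real (d n i) - o'" "f (d n i)" "b n i"]
        show "?Y i = ?X i"
          unfolding g_b F_def using ne by simp
      qed
      also have "cmod (\<dots> / of_nat n) \<le> (\<Sum>i<n. K * (1 + C) * (cmod (\<omega> n - o') * (c * c))) / n"
        unfolding norm_divide norm_of_nat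
      proof (intro divide_right_mono order_trans[OF norm_sum] sum_mono)
        fix i assume "i \<in> {..<n}"
        hence di: "d n i \<in> {l..u}" "cmod (b n i) \<le> C" using elim by auto
        have "cmod (1 + b n i) \<le> 1 + C" using norm_triangle_ineq[of 1 "b n i"] di by simp
        moreover have "cmod (1 / (of_real (d n i) - \<omega> n) * (1 / (of_real (d n i) - o'))) \<le> c * c"
          unfolding norm_mult norm_divide norm_one using c by (intro mult_mono inv Imo Im\<omega>) auto
        ultimately show "cmod (?X i)
            \<le> K * (1 + C) * (cmod (\<omega> n - o') * (c * c))"
          unfolding norm_mult[of "f (d n i) * _"] norm_mult[of "f (d n i)"] norm_mult[of "\<omega> n - o'"]
          using K[OF di(1)] K0 C c by (intro mult_mono mult_left_mono mult_nonneg_nonneg) auto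
      qed simp
      also have "\<dots> = K * (1 + C) * c * c * cmod (\<omega> n - o')" using elim(2) by simp
      finally show ?case .
    qed
    have "(\<lambda>n. E (R n)) \<longlonglongrightarrow> 0"
    proof (rule Lim_null_comparison)
      show "\<forall>\<^sub>F n in sequentially. norm (E (R n)) \<le> K * (1 + C) * c * c * cmod (\<omega> (R n) - o')"
        using eventually_subseq[OF R Eb] by simp
      have "(\<lambda>n. K * (1 + C) * c * c * cmod (\<omega> (R n) - o')) \<longlonglongrightarrow> K * (1 + C) * c * c * cmod (o' - o')"
        by (intro tendsto_intros \<omega>l)
      thus "(\<lambda>n. K * (1 + C) * c * c * cmod (\<omega> (R n) - o')) \<longlonglongrightarrow> 0" by simp
    qed
    from tendsto_add[OF tendsto_add[OF this LIMSEQ_subseq_LIMSEQ[OF T1 R, unfolded o_def]] LIMSEQ_subseq_LIMSEQ[OF T2 R, unfolded o_def]]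
    have "(\<lambda>n. (\<Sum>i<R n. f (d (R n) i) * g (R n) i) / of_nat (R n)) \<longlonglongrightarrow> (\<integral>t. F (clip t) \<partial>H)"
      by (simp add: E_def)
    thus ?thesis by (simp add: F_def o'_def)
  qed
  have mlim: "m \<longlonglongrightarrow> s"
  proof (rule ccontr)
    assume "\<not> m \<longlonglongrightarrow> s"
    then obtain e where e: "e > 0" "\<not> (\<forall>\<^sub>F n in sequentially. dist (m n) s < e)"
      unfolding tendsto_iff by blast
    hence "infinite {n. \<not> dist (m n) s < e}"
      unfolding eventually_sequentially infinite_nat_iff_unbounded_le by auto
    then obtain r :: "nat \<Rightarrow> nat" where r: "strict_mono r" "\<And>n. r n \<in> {n. \<not> dist (m n) s < e}"
      using infinite_enumerate by blast
    have "bounded (range (\<lambda>n. m (r n)))" using mb by (auto simp: bounded_iff)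
    then obtain s' r' where r': "strict_mono (r' :: nat \<Rightarrow> nat)" "(\<lambda>n. m (r (r' n))) \<longlonglongrightarrow> s'"
      using bounded_imp_convergent_subsequence[of "\<lambda>n. m (r n)"] by (auto simp: o_def)
    have R: "strict_mono (\<lambda>n. r (r' n))" using strict_mono_o[OF r(1) r'(1)] by (simp add: o_def)
    have "(\<lambda>n. m (r (r' n))) \<longlonglongrightarrow> (\<integral>t. 1 / (of_real (clip t) - (z + of_real v * s')) \<partial>H)"
      using key[OF R r'(2), of "\<lambda>_. 1"] by (simp add: mg)
    hence "s' = (\<integral>t. 1 / (of_real (clip t) - (z + of_real v * s')) \<partial>H)"
      using r'(2) LIMSEQ_unique by blast
    also have "\<dots> = (\<integral>t. 1 / (of_real t - (z + of_real v * s')) \<partial>H)"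
    proof (rule integral_cong_AE)
      show "AE t in H. 1 / (of_real (clip t) - (z + of_real v * s')) = 1 / (of_real t - (z + of_real v * s'))"
        using supp(2) by eventually_elim (simp add: clip)
      have [measurable]: "clip \<in> borel_measurable borel" using borel_measurable_continuous_onI[OF clipc] .
      show "(\<lambda>t. 1 / (complex_of_real (clip t) - (z + of_real v * s'))) \<in> borel_measurable H" by measurable
    qed simp
    finally have "s' = stieltjes H (z + of_real v * s')" by (simp add: stieltjes_def)
    moreover have "Im s' \<ge> 0"
      by (rule LIMSEQ_le_const[OF tendsto_Im[OF r'(2)]]) (use Imm in auto)
    ultimately have "s' = s" using H.stieltjes_fixed_point_unique[OF z v _ _ s] by blast
    hence "\<forall>\<^sub>F n in sequentially. dist (m (r (r' n))) s < e" using r'(2) e(1) by (auto simp: tendsto_iff)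
    then obtain n where "dist (m (r (r' n))) s < e" using eventually_happens' sequentially_bot by blast
    thus False using r(2) by auto
  qed
  have hc: "continuous_on {l..u} h" using S(2,3) continuous_on_subset by blast
  have ne_s: "of_real t - z - of_real v * s \<noteq> 0" for t
  proof -
    have "0 \<le> v * Im s" using v s(2) by simp
    hence "Im (of_real t - z - of_real v * s) < 0" using z by simp
    thus ?thesis by (metis zero_complex.sel(2) less_irrefl)
  qed
  have "(\<lambda>n. 1 / of_nat n * mat_trace (mat_fun h (A n) * ?G n)) \<longlonglongrightarrow> (\<integral>t. h (clip t) / (of_real (clip t) - (z + of_real v * s)) \<partial>H)"
    using key[OF strict_mono_id[unfolded id_def] mlim hc] by (simp add: trf)
  also have "(\<integral>t. h (clip t) / (of_real (clip t) - (z + of_real v * s)) \<partial>H) = (LINT t:S|H. h t / (of_real t - z - of_real v * s))"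
    unfolding set_lebesgue_integral_def
  proof (rule integral_cong_AE)
    show "AE t in H. h (clip t) / (of_real (clip t) - (z + of_real v * s))
        = indicator S t *\<^sub>R (h t / (of_real t - z - of_real v * s))"
      using supp(2)
    proof eventually_elim
      case (elim t)
      hence "t \<in> S" using S(2) by auto
      thus ?case by (simp add: clip(2)[OF elim] diff_diff_eq)
    qed
    have [measurable]: "clip \<in> borel_measurable borel" using borel_measurable_continuous_onI[OF clipc] .
    have [measurable]: "(\<lambda>t. h (clip t)) \<in> borel_measurable borel"
      using borel_measurable_continuous_onI[OF continuous_on_compose2[OF hc clipc]] clip(1) by blast
    show "(\<lambda>t. h (clip t) / (of_real (clip t) - (z + of_real v * s))) \<in> borel_measurable H" by measurable
    show "(\<lambda>t. indicator S t *\<^sub>R (h t / (of_real t - z - of_real v * s))) \<in> borel_measurable H"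
    proof -
      have "(\<lambda>t. indicator S t *\<^sub>R (h t / (of_real t - z - of_real v * s))) \<in> borel_measurable borel"
        using S(1) by (intro borel_measurable_continuous_on_indicator continuous_intros S(3)) (use ne_s in auto)
      thus ?thesis by simp
    qed
  qed
  finally show ?thesis .
qed

theorem theorem2p2:
  fixes M :: "'w measure"
    and A :: "nat \<Rightarrow> 'w \<Rightarrow> real mat"
    and Z :: "nat \<Rightarrow> nat \<Rightarrow> 'w \<Rightarrow> real"
    and \<sigma> h\<^sub>1 h\<^sub>2 :: real
    and H \<mu>hat :: "real measure"
    and S :: "real set"
    and h :: "real \<Rightarrow> complex"
    and z :: complex
  assumes "prob_space M"
    and "\<sigma> > 0"
    and A_dim: "\<And>n \<omega>. \<omega> \<in> space M \<Longrightarrow> A n \<omega> \<in> carrier_mat n n"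
    and A_sym: "\<And>n \<omega>. \<omega> \<in> space M \<Longrightarrow> transpose_mat (A n \<omega>) = A n \<omega>"
    and H_prob: "real_distribution H"
    and esd_conv: "AE \<omega> in M. weak_conv_m (\<lambda>n. esd (A n \<omega>)) H"
    and H_supp: "compactly_supported H"
    and eig_bound: "AE \<omega> in M. \<forall>\<^sub>F n in sequentially. \<forall>x. eigenvalue (A n \<omega>) x \<longrightarrow> x \<in> {h\<^sub>1..h\<^sub>2}"
    and Z_sym: "\<And>i j \<omega>. \<omega> \<in> space M \<Longrightarrow> Z i j \<omega> = Z j i \<omega>"
    and Z_indep: "prob_space.indep_vars M (\<lambda>_. borel) (\<lambda>(i, j). Z i j) {(i, j). i \<le> j}"
    and Z_distr: "\<And>i j. i \<le> j \<Longrightarrow> distr M borel (Z i j) = distr M borel (Z 0 0)"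
    and Z_mean: "prob_space.expectation M (Z 0 0) = 0"
    and Z_var: "prob_space.variance M (Z 0 0) = 1"
    and Z_fourth: "integrable M (\<lambda>\<omega>. Z 0 0 \<omega> ^ 4)"
    and AZ_indep: "\<And>n. prob_space.indep_var M
          (\<Pi>\<^sub>M p\<in>{..<n} \<times> {..<n}. borel) (\<lambda>\<omega>. \<lambda>p\<in>{..<n} \<times> {..<n}. A n \<omega> $$ p)
          (\<Pi>\<^sub>M p\<in>{..<n} \<times> {..<n}. borel) (\<lambda>\<omega>. \<lambda>p\<in>{..<n} \<times> {..<n}. Z (fst p) (snd p) \<omega>)"
    and \<mu>hat: "is_free_additive_convolution H (semicircle (\<sigma>\<^sup>2)) \<mu>hat"
    and "open S" and "{h\<^sub>1..h\<^sub>2} \<subseteq> S" and "continuous_on S h"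
    and "Im z > 0"
  shows "AE \<omega> in M.
    (\<lambda>n. 1 / of_nat n *
       mat_trace (mat_fun h (A n \<omega>) * resolvent (perturbed \<sigma> (A n \<omega>) (\<lambda>i j. Z i j \<omega>)) z))
    \<longlonglongrightarrow> (LINT t:S|H. h t / (of_real t - z - of_real (\<sigma>\<^sup>2) * stieltjes \<mu>hat z))"
proof -
  have v: "\<sigma>\<^sup>2 > 0" using \<open>\<sigma> > 0\<close> by simp
  interpret K: real_distribution \<mu>hat using \<mu>hat by (simp add: is_free_additive_convolution_def)
  have s: "stieltjes \<mu>hat z = stieltjes H (z + of_real (\<sigma>\<^sup>2) * stieltjes \<mu>hat z)"
    by (rule free_convolution_semicircle_subordination[OF H_prob v \<mu>hat \<open>Im z > 0\<close>])
  have "AE \<omega> in M. \<forall>k. (\<lambda>n. defect (of_real (\<sigma>\<^sup>2)) z (\<i> * of_nat (Suc k)) (A n \<omega>) (perturbed \<sigma> (A n \<omega>) (\<lambda>i j. Z i j \<omega>))) \<longlonglongrightarrow> 0"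
    unfolding AE_all_countable
  proof (rule allI)
    fix k
    have w: "Im (\<i> * complex_of_nat (Suc k)) \<noteq> 0" by simp
    show "AE \<omega> in M. (\<lambda>n. defect (of_real (\<sigma>\<^sup>2)) z (\<i> * of_nat (Suc k)) (A n \<omega>) (perturbed \<sigma> (A n \<omega>) (\<lambda>i j. Z i j \<omega>))) \<longlonglongrightarrow> 0"
      by (rule AE_defect_tendsto_0[OF \<open>prob_space M\<close> A_dim A_sym Z_sym Z_indep Z_distr Z_mean Z_var Z_fourth AZ_indep \<open>Im z > 0\<close> w])
  qed
  with esd_conv eig_bound AE_space show ?thesis
  proof eventually_elim
    case (elim \<omega>)
    have P: "perturbed \<sigma> (A n \<omega>) (\<lambda>i j. Z i j \<omega>) \<in> carrier_mat n n"
      "transpose_mat (perturbed \<sigma> (A n \<omega>) (\<lambda>i j. Z i j \<omega>)) = perturbed \<sigma> (A n \<omega>) (\<lambda>i j. Z i j \<omega>)" for n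
    proof -
      note An = A_dim[OF elim(3), of n] A_sym[OF elim(3), of n]
      show "perturbed \<sigma> (A n \<omega>) (\<lambda>i j. Z i j \<omega>) \<in> carrier_mat n n"
        using An by (simp add: perturbed_def)
      show "transpose_mat (perturbed \<sigma> (A n \<omega>) (\<lambda>i j. Z i j \<omega>)) = perturbed \<sigma> (A n \<omega>) (\<lambda>i j. Z i j \<omega>)"
        using An(1) sym_entry[OF An] Z_sym[OF elim(3)] by (intro eq_matI) (auto simp: perturbed_def)
    qed
    show ?case
      by (rule trace_limit[OF A_dim[OF elim(3)] A_sym[OF elim(3)] P H_prob elim(1,2) \<open>Im z > 0\<close> v _ s
            K.Im_stieltjes_nonneg[OF \<open>Im z > 0\<close>] _ \<open>{h\<^sub>1..h\<^sub>2} \<subseteq> S\<close>])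
         (use elim(4) \<open>open S\<close> \<open>continuous_on S h\<close> in auto)
  qed
qed

end
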